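(* Let $q:\mathbb{Z}^n\to\mathbb{Z}$ be a connected non-negative unit form with associated root system $R(q)=q^{-1}(0)\cup q^{-1}(1)$. Then the Lie algebra $E(q)$ is an extended affine Lie algebra with root system $R(q)$. Furthermore, let $q$ and $q'$ be connected non-negative unit forms. Then $q$ and $q'$ are equivalent if and only if $E(q)$ and $E(q')$ are isomorphic as graded Lie algebras.
   Context: **Unit forms.** A unit form is a quadratic form $q:\mathbb{Z}^n\to\mathbb{Z}$, $q(x)=\sum_{i=1}^n x_i^2+\sum_{i<j}q_{ij}x_ix_j$ with $q_{ij}\in\mathbb{Z}$. It is non-negative if $q(x)\ge 0$ for all $x$. It is connected if the graph on vertices $1,\dots,n$ with $i,j$ joined whenever $q_{ij}\ne 0$ is connected. The associated symmetric bilinear form is $q(x,y)=q(x+y)-q(x)-q(y)$, so $q(x,x)=2q(x)$; it is extended bilinearly to $\mathbb{C}^n$. The radical is $\operatorname{rad} q=\{x\in\mathbb{Z}^n: q(x,-)=0\}$; for non-negative $q$, $\operatorname{rad} q=q^{-1}(0)$. Put $\operatorname{rad}_{\mathbb{C}}q=\mathbb{C}\otimes_{\mathbb{Z}}\operatorname{rad}q\subseteq\mathbb{C}^n$, with $\mathbb{C}$-dual $(\operatorname{rad}_{\mathbb{C}}q)^*$. Two unit forms $q,q'$ are equivalent if they have the same number $n$ of variables and $q'=q\circ T$ for some automorphism $T$ of $\mathbb{Z}^n$. Write $R=R(q)=q^{-1}(0)\cup q^{-1}(1)$, $R^\times=q^{-1}(1)$, $R^0=q^{-1}(0)$. **The Lie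 algebra $N(q)$.** Let $N=\bigoplus_{\alpha\in R}N_\alpha$, where $N_\alpha=\mathbb{C}e_\alpha$ (one-dimensional with basis $e_\alpha$) for $\alpha\in R^\times$, $N_\alpha=\mathbb{C}^n/\mathbb{C}\alpha$ for $\alpha\in R^0\setminus\{0\}$, and $N_0=\mathbb{C}^n\oplus(\operatorname{rad}_{\mathbb{C}}q)^*$. For $0\ne\sigma\in R^0$ let $\pi_\sigma:\mathbb{C}^n\to N_\sigma$ be the canonical projection; let $\pi_0:\mathbb{C}^n\to N_0$ be the inclusion. Choose a (not necessarily symmetric) bilinear form $B:\mathbb{Z}^n\times\mathbb{Z}^n\to\mathbb{Z}$ with $B(x,x)=q(x)$ for all $x$, set $\epsilon(\alpha,\beta)=(-1)^{B(\alpha,\beta)}$, and choose a linear projection $\rho:\mathbb{C}^n\to\operatorname{rad}_{\mathbb{C}}q$ (identity on $\operatorname{rad}_{\mathbb{C}}q$). For $\alpha,\beta\in R^\times$, $\sigma,\tau\in R^0$, $v,w\in\mathbb{C}^n$, $\xi,\zeta\in(\operatorname{rad}_{\mathbb{C}}q)^*$ the bracket is the bilinear map given by: - $[\pi_\sigma(v),\pi_\tau(w)]=\epsilon(\sigma,\tau)q(v,w)\pi_{\sigma+\tau}(\sigma)$; - $[\pi_\sigma(v),e_\beta]=-[e_\beta,\pi_\sigma(v)]=\epsilon(\sigma,\beta)q(v,\beta)e_{\beta+\sigma}$; - $[e_\alpha,e_\beta]=\epsilon(\alpha,\beta)e_{\alpha+\beta}$ if $\alpha+\beta\in R^\times$,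 $=\epsilon(\alpha,\beta)\pi_{\alpha+\beta}(\alpha)$ if $\alpha+\beta\in R^0$, and $=0$ otherwise; - $[\xi,e_\beta]=-[e_\beta,\xi]=\xi(\rho(\beta))e_\beta$; - $[\xi,\pi_\tau(w)]=-[\pi_\tau(w),\xi]=\xi(\rho(\tau))\pi_\tau(w)$ for $\tau \in R^0$ (so this is $0$ for $\tau=0$); - $[\xi,\zeta]=0$. This makes $N$ a Lie algebra, independent of the choices of $B$ and $\rho$ up to isomorphism. **The Lie algebra $E(q)$.** $E=E(q)$ is the factor Lie algebra of $N$ induced by the canonical epimorphisms $N_\alpha\to\mathbb{C}^n/\operatorname{rad}_{\mathbb{C}}q$ for $\alpha\in R^0\setminus\{0\}$. So $E=\bigoplus_{\alpha\in R}E_\alpha$ with $E_\alpha=\mathbb{C}e_\alpha$ for $\alpha\in R^\times$, $E_\alpha=\mathbb{C}^n/\operatorname{rad}_{\mathbb{C}}q$ for $\alpha\in R^0\setminus\{0\}$, $E_0=\mathbb{C}^n\oplus(\operatorname{rad}_{\mathbb{C}}q)^*$. It is graded by $\mathbb{Z}^n$ with support $R$. **Extended affine Lie algebra.** A triple $(L,H,(-,-))$, with $L$ a complex Lie algebra, such that: - (EA1) $(-,-)$ is a non-degenerate symmetric bilinear form on $L$ with $([x,y],z)=(x,[y,z])$. - (EA2) $H$ is a non-trivial finite dimensional abelian subalgebra of $L$ equal to its own centralizer, and $\operatorname{ad}_L h$ is diagonalizable for all $h\in H$. Then $L=\bigoplus_{\alpha\in H^*}L_\alpha$ with $L_\alpha=\{x:[h,x]=\alpha(h)x\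 \forall h\in H\}$; the root system of $L$ is $R_L=\{\alpha\in H^*:L_\alpha\ne 0\}$. The form restricted to $H$ is non-degenerate and is transferred to $H^*$ via $h\mapsto(h,-)$; $R_L^0$ and $R_L^\times$ are the sets of roots with $(\alpha,\alpha)=0$ and $(\alpha,\alpha)\neq0$ respectively. - (EA3) For $\alpha\in R_L^\times$ and $x\in L_\alpha$, $\operatorname{ad}_Lx$ is locally nilpotent on $L$. - (EA4) $R_L$ is a discrete subset of $H^*$. - (EA5) $R_L^\times$ is not a disjoint union of two non-empty subsets $R_1,R_2$ with $(R_1,R_2)=\{0\}$. "$E(q)$ is an extended affine Lie algebra with root system $R(q)$" means: with $H=E_0$ and a suitable form on $E(q)$, the triple is an extended affine Lie algebra whose root system is $R(q)$ and whose root spaces are the $E_\alpha$, where $\mathbb{Z}^n$ is regarded as a subset of $H^*$ via the injection $\alpha\mapsto\big(\pi_0(v)+\xi\mapsto q(v,\alpha)+\xi(\rho(\alpha))\big)$. **Graded isomorphism.** For $q$ in $n$ variables and $q'$ in $m$ variables, $E(q)$ and $E(q')$ are isomorphic as graded Lie algebras if there are a Lie algebra isomorphism $\varphi:E(q)\to E(q')$ and a group isomorphism $\psi:\mathbb{Z}^n\to\mathbb{Z}^m$ with $\psi(R(q))=R(q')$ and $\varphi(E(q)_\alpha)=E(q')_{\psi(\alpha)}$ for all $\alpha\in R(q)$. *)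

theory Defs
  imports "HOL-Analysis.Analysis" "HOL-Algebra.Module" "HOL-Library.Set_Algebras"
begin

section \<open>Unit forms\<close>

text \<open>A finite linearly ordered index type \<open>'n\<close> plays the role of \<open>{1, \<dots>, n}\<close>. It is
  non-empty, so \<open>n \<ge> 1\<close>. Only the values \<open>c i j\<close> with \<open>i < j\<close> are used below.\<close>

definition has_coeffs ::
  "(int^'n::{finite,linorder} \<Rightarrow> int) \<Rightarrow> ('n \<Rightarrow> 'n \<Rightarrow> int) \<Rightarrow> bool" where
  "has_coeffs q c \<longleftrightarrow>
     (\<forall>x. q x = (\<Sum>i\<in>UNIV. (x $ i)\<^sup>2) + (\<Sum>(i, j)\<in>{(i, j). i < j}. c i j * x $ i * x $ j))"

definition unit_form :: "(int^'n::{finite,linorder} \<Rightarrow> int) \<Rightarrow> bool" where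
  "unit_form q \<longleftrightarrow> (\<exists>c. has_coeffs q c)"

definition nonneg_form :: "(int^'n::{finite,linorder} \<Rightarrow> int) \<Rightarrow> bool" where
  "nonneg_form q \<longleftrightarrow> (\<forall>x. 0 \<le> q x)"

definition connected_form :: "(int^'n::{finite,linorder} \<Rightarrow> int) \<Rightarrow> bool" where
  "connected_form q \<longleftrightarrow> (\<exists>c. has_coeffs q c \<and>
     (\<forall>i j. (i, j) \<in> {(i, j). (i < j \<and> c i j \<noteq> 0) \<or> (j < i \<and> c j i \<noteq> 0)}\<^sup>*))"

text \<open>For forms over two index types, an automorphism of \<open>\<int>\<^sup>n\<close> becomes a group isomorphism
  between the two copies of \<open>\<int>\<^sup>n\<close>.\<close>

definition equivalent_forms ::
  "(int^'n::{finite,linorder} \<Rightarrow> int) \<Rightarrow> (int^'m::{finite,linorder} \<Rightarrow> int) \<Rightarrow> bool" where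
  "equivalent_forms q q' \<longleftrightarrow> CARD('n) = CARD('m) \<and>
     (\<exists>T. Modules.additive T \<and> bij T \<and> q' = q \<circ> T)"

definition polar :: "(int^'n::finite \<Rightarrow> int) \<Rightarrow> int^'n \<Rightarrow> int^'n \<Rightarrow> int" where
  "polar q x y = q (x + y) - q x - q y"

definition polarC :: "(int^'n::finite \<Rightarrow> int) \<Rightarrow> complex^'n \<Rightarrow> complex^'n \<Rightarrow> complex" where
  "polarC q v w =
     (\<Sum>i\<in>UNIV. \<Sum>j\<in>UNIV. v $ i * w $ j * of_int (polar q (axis i 1) (axis j 1)))"

definition cvec :: "int^'n::finite \<Rightarrow> complex^'n" where
  "cvec x = (\<chi> i. of_int (x $ i))"

definition rad :: "(int^'n::finite \<Rightarrow> int) \<Rightarrow> (int^'n) set" where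
  "rad q = {x. \<forall>y. polar q x y = 0}"

definition radC :: "(int^'n::finite \<Rightarrow> int) \<Rightarrow> (complex^'n) set" where
  "radC q = vec.span (cvec ` rad q)"

definition real_roots :: "(int^'n::finite \<Rightarrow> int) \<Rightarrow> (int^'n) set" where
  "real_roots q = {x. q x = 1}"

definition null_roots :: "(int^'n::finite \<Rightarrow> int) \<Rightarrow> (int^'n) set" where
  "null_roots q = {x. q x = 0}"

definition roots :: "(int^'n::finite \<Rightarrow> int) \<Rightarrow> (int^'n) set" where
  "roots q = null_roots q \<union> real_roots q"


section \<open>Complex Lie algebras and extended affine Lie algebras\<close>

text \<open>Complex Lie algebras are carried by the module records of HOL-Algebra. The \<open>mult\<close> field
  (written \<open>\<otimes>\<close>) holds the Lie bracket, and the \<open>one\<close> field is not used.\<close>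

definition complex_ring :: "complex ring" where
  "complex_ring = \<lparr>carrier = UNIV, monoid.mult = (*), one = 1, ring.zero = 0, add = (+)\<rparr>"

locale complex_lie_algebra = Module.module complex_ring L for L (structure) +
  assumes bracket_closed: "x \<in> carrier L \<Longrightarrow> y \<in> carrier L \<Longrightarrow> x \<otimes> y \<in> carrier L"
    and bracket_add_left: "x \<in> carrier L \<Longrightarrow> y \<in> carrier L \<Longrightarrow> z \<in> carrier L \<Longrightarrow>
      (x \<oplus> y) \<otimes> z = (x \<otimes> z) \<oplus> (y \<otimes> z)"
    and bracket_add_right: "x \<in> carrier L \<Longrightarrow> y \<in> carrier L \<Longrightarrow> z \<in> carrier L \<Longrightarrow>
      x \<otimes> (y \<oplus> z) = (x \<otimes> y) \<oplus> (x \<otimes> z)"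
    and bracket_smult_left: "x \<in> carrier L \<Longrightarrow> y \<in> carrier L \<Longrightarrow> (c \<odot> x) \<otimes> y = c \<odot> (x \<otimes> y)"
    and bracket_smult_right: "x \<in> carrier L \<Longrightarrow> y \<in> carrier L \<Longrightarrow> x \<otimes> (c \<odot> y) = c \<odot> (x \<otimes> y)"
    and bracket_self: "x \<in> carrier L \<Longrightarrow> x \<otimes> x = \<zero>"
    and jacobi: "x \<in> carrier L \<Longrightarrow> y \<in> carrier L \<Longrightarrow> z \<in> carrier L \<Longrightarrow>
      (x \<otimes> (y \<otimes> z)) \<oplus> (y \<otimes> (z \<otimes> x)) \<oplus> (z \<otimes> (x \<otimes> y)) = \<zero>"

definition lie_iso :: "(complex, 'a) module \<Rightarrow> (complex, 'b) module \<Rightarrow> ('a \<Rightarrow> 'b) \<Rightarrow> bool" where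
  "lie_iso L L' \<phi> \<longleftrightarrow> bij_betw \<phi> (carrier L) (carrier L') \<and>
     (\<forall>x\<in>carrier L. \<forall>y\<in>carrier L. \<phi> (x \<oplus>\<^bsub>L\<^esub> y) = \<phi> x \<oplus>\<^bsub>L'\<^esub> \<phi> y) \<and>
     (\<forall>c. \<forall>x\<in>carrier L. \<phi> (c \<odot>\<^bsub>L\<^esub> x) = c \<odot>\<^bsub>L'\<^esub> \<phi> x) \<and>
     (\<forall>x\<in>carrier L. \<forall>y\<in>carrier L. \<phi> (x \<otimes>\<^bsub>L\<^esub> y) = \<phi> x \<otimes>\<^bsub>L'\<^esub> \<phi> y)"

text \<open>Linear functionals on \<open>S\<close>, extended by \<open>0\<close> outside \<open>S\<close> so that equality of functions is
  equality of functionals.\<close>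

definition functionals ::
  "'a set \<Rightarrow> ('a \<Rightarrow> 'a \<Rightarrow> 'a) \<Rightarrow> (complex \<Rightarrow> 'a \<Rightarrow> 'a) \<Rightarrow> ('a \<Rightarrow> complex) set" where
  "functionals S pls scl = {f.
     (\<forall>x\<in>S. \<forall>y\<in>S. f (pls x y) = f x + f y) \<and>
     (\<forall>c. \<forall>x\<in>S. f (scl c x) = c * f x) \<and>
     (\<forall>x. x \<notin> S \<longrightarrow> f x = 0)}"

definition bilinear_form_on :: "(complex, 'a) module \<Rightarrow> ('a \<Rightarrow> 'a \<Rightarrow> complex) \<Rightarrow> bool" where
  "bilinear_form_on L b \<longleftrightarrow>
     (\<forall>x\<in>carrier L. \<forall>y\<in>carrier L. \<forall>z\<in>carrier L.
        b (x \<oplus>\<^bsub>L\<^esub> y) z = b x z + b y z \<and> b x (y \<oplus>\<^bsub>L\<^esub> z) = b x y + b x z) \<and>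
     (\<forall>c. \<forall>x\<in>carrier L. \<forall>y\<in>carrier L.
        b (c \<odot>\<^bsub>L\<^esub> x) y = c * b x y \<and> b x (c \<odot>\<^bsub>L\<^esub> y) = c * b x y)"

definition EA1 :: "(complex, 'a) module \<Rightarrow> ('a \<Rightarrow> 'a \<Rightarrow> complex) \<Rightarrow> bool" where
  "EA1 L b \<longleftrightarrow> bilinear_form_on L b \<and>
     (\<forall>x\<in>carrier L. \<forall>y\<in>carrier L. b x y = b y x) \<and>
     (\<forall>x\<in>carrier L. (\<forall>y\<in>carrier L. b x y = 0) \<longrightarrow> x = \<zero>\<^bsub>L\<^esub>) \<and>
     (\<forall>x\<in>carrier L. \<forall>y\<in>carrier L. \<forall>z\<in>carrier L. b (x \<otimes>\<^bsub>L\<^esub> y) z = b x (y \<otimes>\<^bsub>L\<^esub> z))"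

definition finite_dim_subspace :: "(complex, 'a) module \<Rightarrow> 'a set \<Rightarrow> bool" where
  "finite_dim_subspace L H \<longleftrightarrow> submodule H complex_ring L \<and>
     (\<exists>S. finite S \<and> S \<subseteq> H \<and> (\<forall>h\<in>H. \<exists>c. h = (\<Oplus>\<^bsub>L\<^esub>s\<in>S. c s \<odot>\<^bsub>L\<^esub> s)))"

text \<open>An endomorphism is diagonalizable when the whole space is spanned by eigenvectors. A basis
  of eigenvectors can then be selected.\<close>

definition diagonalizable :: "(complex, 'a) module \<Rightarrow> ('a \<Rightarrow> 'a) \<Rightarrow> bool" where
  "diagonalizable L f \<longleftrightarrow>
     (\<forall>x\<in>carrier L. \<exists>S. finite S \<and> S \<subseteq> {y \<in> carrier L. \<exists>c. f y = c \<odot>\<^bsub>L\<^esub> y} \<and>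
        x = (\<Oplus>\<^bsub>L\<^esub>s\<in>S. s))"

definition EA2 :: "(complex, 'a) module \<Rightarrow> 'a set \<Rightarrow> bool" where
  "EA2 L H \<longleftrightarrow> finite_dim_subspace L H \<and> H \<noteq> {\<zero>\<^bsub>L\<^esub>} \<and>
     (\<forall>x\<in>H. \<forall>y\<in>H. x \<otimes>\<^bsub>L\<^esub> y = \<zero>\<^bsub>L\<^esub>) \<and>
     {x \<in> carrier L. \<forall>h\<in>H. h \<otimes>\<^bsub>L\<^esub> x = \<zero>\<^bsub>L\<^esub>} = H \<and>
     (\<forall>h\<in>H. diagonalizable L (\<lambda>x. h \<otimes>\<^bsub>L\<^esub> x))"

definition dual_of :: "(complex, 'a) module \<Rightarrow> 'a set \<Rightarrow> ('a \<Rightarrow> complex) set" where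
  "dual_of L H = functionals H (\<lambda>x y. x \<oplus>\<^bsub>L\<^esub> y) (\<lambda>c x. c \<odot>\<^bsub>L\<^esub> x)"

definition root_space :: "(complex, 'a) module \<Rightarrow> 'a set \<Rightarrow> ('a \<Rightarrow> complex) \<Rightarrow> 'a set" where
  "root_space L H \<kappa> = {x \<in> carrier L. \<forall>h\<in>H. h \<otimes>\<^bsub>L\<^esub> x = \<kappa> h \<odot>\<^bsub>L\<^esub> x}"

definition root_system :: "(complex, 'a) module \<Rightarrow> 'a set \<Rightarrow> ('a \<Rightarrow> complex) set" where
  "root_system L H = {\<kappa> \<in> dual_of L H. root_space L H \<kappa> \<noteq> {\<zero>\<^bsub>L\<^esub>}}"

text \<open>The form transferred to \<open>H\<^sup>*\<close> along \<open>h \<mapsto> (h, -)\<close>: a functional is replaced by the unique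
  element of \<open>H\<close> which represents it.\<close>

definition dual_form ::
  "'a set \<Rightarrow> ('a \<Rightarrow> 'a \<Rightarrow> complex) \<Rightarrow> ('a \<Rightarrow> complex) \<Rightarrow> ('a \<Rightarrow> complex) \<Rightarrow> complex" where
  "dual_form H b \<kappa> \<mu> =
     b (THE t. t \<in> H \<and> (\<forall>h\<in>H. b t h = \<kappa> h)) (THE t. t \<in> H \<and> (\<forall>h\<in>H. b t h = \<mu> h))"

definition nonisotropic_roots ::
  "(complex, 'a) module \<Rightarrow> 'a set \<Rightarrow> ('a \<Rightarrow> 'a \<Rightarrow> complex) \<Rightarrow> ('a \<Rightarrow> complex) set" where
  "nonisotropic_roots L H b = {\<kappa> \<in> root_system L H. dual_form H b \<kappa> \<kappa> \<noteq> 0}"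

definition EA3 :: "(complex, 'a) module \<Rightarrow> 'a set \<Rightarrow> ('a \<Rightarrow> 'a \<Rightarrow> complex) \<Rightarrow> bool" where
  "EA3 L H b \<longleftrightarrow> (\<forall>\<kappa>\<in>nonisotropic_roots L H b. \<forall>x\<in>root_space L H \<kappa>.
     \<forall>y\<in>carrier L. \<exists>k. ((\<lambda>z. x \<otimes>\<^bsub>L\<^esub> z) ^^ k) y = \<zero>\<^bsub>L\<^esub>)"

text \<open>The topology on functions is that of pointwise convergence. On the finite dimensional
  space \<open>H\<^sup>*\<close> it induces the usual vector space topology.\<close>

definition EA4 :: "(complex, 'a) module \<Rightarrow> 'a set \<Rightarrow> bool" where
  "EA4 L H \<longleftrightarrow> discrete (root_system L H)"

definition EA5 :: "(complex, 'a) module \<Rightarrow> 'a set \<Rightarrow> ('a \<Rightarrow> 'a \<Rightarrow> complex) \<Rightarrow> bool" where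
  "EA5 L H b \<longleftrightarrow> \<not> (\<exists>R1 R2. R1 \<noteq> {} \<and> R2 \<noteq> {} \<and> R1 \<inter> R2 = {} \<and>
     R1 \<union> R2 = nonisotropic_roots L H b \<and> (\<forall>\<kappa>\<in>R1. \<forall>\<mu>\<in>R2. dual_form H b \<kappa> \<mu> = 0))"

definition extended_affine_lie_algebra ::
  "(complex, 'a) module \<Rightarrow> 'a set \<Rightarrow> ('a \<Rightarrow> 'a \<Rightarrow> complex) \<Rightarrow> bool" where
  "extended_affine_lie_algebra L H b \<longleftrightarrow>
     complex_lie_algebra L \<and> EA1 L b \<and> EA2 L H \<and> EA3 L H b \<and> EA4 L H \<and> EA5 L H b"


section \<open>The Lie algebra \<open>N(q)\<close>\<close>

text \<open>
  Given subspaces \<open>W \<sigma>\<close> of \<open>\<complex>\<^sup>n\<close>, an element of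
  \<open>(\<Oplus>\<alpha>\<in>R\<^sup>\<times>. \<complex> e\<^sub>\<alpha>) \<oplus> (\<Oplus>\<sigma>\<in>R\<^sup>0. \<complex>\<^sup>n / W \<sigma>) \<oplus> (rad\<^sub>\<complex> q)\<^sup>*\<close> is given by its three parts:
  the coefficients of the \<open>e\<^sub>\<alpha>\<close>, a family of cosets \<open>v + W \<sigma>\<close>, and a functional. For \<open>\<sigma>\<close> outside
  \<open>R\<^sup>0\<close> there is no summand, and the entry is the empty set. Both \<open>N(q)\<close> and \<open>E(q)\<close> have
  \<open>W 0 = {0}\<close>, so that \<open>v \<in> \<complex>\<^sup>n\<close> appears in degree \<open>0\<close> as the coset \<open>{v}\<close>.
\<close>

datatype ('n::finite) gelt =
  Gelt (ecoeff: "int^'n \<Rightarrow> complex") (pcoset: "int^'n \<Rightarrow> (complex^'n) set")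
       (dfun: "complex^'n \<Rightarrow> complex")

definition esupp :: "'n::finite gelt \<Rightarrow> (int^'n) set" where
  "esupp x = {\<alpha>. ecoeff x \<alpha> \<noteq> 0}"

definition psupp ::
  "(int^'n::finite \<Rightarrow> int) \<Rightarrow> (int^'n \<Rightarrow> (complex^'n) set) \<Rightarrow> 'n gelt \<Rightarrow> (int^'n) set" where
  "psupp q W x = {\<sigma> \<in> null_roots q. pcoset x \<sigma> \<noteq> W \<sigma>}"

definition gspace ::
  "(int^'n::finite \<Rightarrow> int) \<Rightarrow> (int^'n \<Rightarrow> (complex^'n) set) \<Rightarrow> 'n gelt set" where
  "gspace q W = {x.
     finite (esupp x) \<and> esupp x \<subseteq> real_roots q \<and>
     finite (psupp q W x) \<and> (\<forall>\<sigma>\<in>null_roots q. \<exists>v. pcoset x \<sigma> = v +o W \<sigma>) \<and>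
     (\<forall>\<sigma>. \<sigma> \<notin> null_roots q \<longrightarrow> pcoset x \<sigma> = {}) \<and>
     dfun x \<in> functionals (radC q) (+) (*s)}"

definition gcomp ::
  "(int^'n::finite \<Rightarrow> int) \<Rightarrow> (int^'n \<Rightarrow> (complex^'n) set) \<Rightarrow> int^'n \<Rightarrow> 'n gelt set" where
  "gcomp q W \<alpha> = {x \<in> gspace q W. esupp x \<subseteq> {\<alpha>} \<and> psupp q W x \<subseteq> {\<alpha>} \<and>
     (\<alpha> \<noteq> 0 \<longrightarrow> dfun x = (\<lambda>_. 0))}"

definition gzero ::
  "(int^'n::finite \<Rightarrow> int) \<Rightarrow> (int^'n \<Rightarrow> (complex^'n) set) \<Rightarrow> 'n gelt" where
  "gzero q W = Gelt (\<lambda>_. 0) (\<lambda>\<sigma>. if \<sigma> \<in> null_roots q then W \<sigma> else {}) (\<lambda>_. 0)"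

definition gadd :: "'n::finite gelt \<Rightarrow> 'n gelt \<Rightarrow> 'n gelt" where
  "gadd x y = Gelt (\<lambda>\<alpha>. ecoeff x \<alpha> + ecoeff y \<alpha>) (\<lambda>\<sigma>. pcoset x \<sigma> + pcoset y \<sigma>)
     (\<lambda>v. dfun x v + dfun y v)"

text \<open>Adding \<open>W \<sigma>\<close> makes \<open>0 \<odot> (v + W \<sigma>)\<close> equal to \<open>W \<sigma>\<close> rather than \<open>{0}\<close>.\<close>

definition gsmult ::
  "(int^'n \<Rightarrow> (complex^'n) set) \<Rightarrow> complex \<Rightarrow> 'n::finite gelt \<Rightarrow> 'n gelt" where
  "gsmult W c x = Gelt (\<lambda>\<alpha>. c * ecoeff x \<alpha>) (\<lambda>\<sigma>. ((*s) c) ` pcoset x \<sigma> + W \<sigma>)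
     (\<lambda>v. c * dfun x v)"

definition evec ::
  "(int^'n::finite \<Rightarrow> int) \<Rightarrow> (int^'n \<Rightarrow> (complex^'n) set) \<Rightarrow> int^'n \<Rightarrow> 'n gelt" where
  "evec q W \<alpha> = Gelt (\<lambda>\<beta>. if \<beta> = \<alpha> then 1 else 0) (pcoset (gzero q W)) (\<lambda>_. 0)"

definition pvec ::
  "(int^'n::finite \<Rightarrow> int) \<Rightarrow> (int^'n \<Rightarrow> (complex^'n) set) \<Rightarrow> int^'n \<Rightarrow> complex^'n \<Rightarrow> 'n gelt" where
  "pvec q W \<sigma> v = Gelt (\<lambda>_. 0) ((pcoset (gzero q W))(\<sigma> := v +o W \<sigma>)) (\<lambda>_. 0)"

definition dvec ::
  "(int^'n::finite \<Rightarrow> int) \<Rightarrow> (int^'n \<Rightarrow> (complex^'n) set) \<Rightarrow> (complex^'n \<Rightarrow> complex) \<Rightarrow> 'n gelt" where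
  "dvec q W \<xi> = Gelt (\<lambda>_. 0) (pcoset (gzero q W)) \<xi>"

definition eps :: "(int^'n::finite \<Rightarrow> int^'n \<Rightarrow> int) \<Rightarrow> int^'n \<Rightarrow> int^'n \<Rightarrow> complex" where
  "eps B \<alpha> \<beta> = (-1) powi (B \<alpha> \<beta>)"

text \<open>The auxiliary data entering the construction of \<open>N(q)\<close>.\<close>

definition admissible_choice ::
  "(int^'n::finite \<Rightarrow> int) \<Rightarrow> (int^'n \<Rightarrow> int^'n \<Rightarrow> int) \<Rightarrow> (complex^'n \<Rightarrow> complex^'n) \<Rightarrow> bool" where
  "admissible_choice q B \<rho> \<longleftrightarrow>
     (\<forall>x. Modules.additive (B x)) \<and> (\<forall>y. Modules.additive (\<lambda>x. B x y)) \<and> (\<forall>x. B x x = q x) \<and>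
     Vector_Spaces.linear (*s) (*s) \<rho> \<and> range \<rho> \<subseteq> radC q \<and> (\<forall>v\<in>radC q. \<rho> v = v)"

definition WN :: "int^'n::finite \<Rightarrow> (complex^'n) set" where
  "WN \<sigma> = vec.span {cvec \<sigma>}"

definition rep :: "(complex^'n::finite) set \<Rightarrow> complex^'n" where
  "rep A = (SOME v. v \<in> A)"

text \<open>The bracket is the bilinear extension of the rules for the \<open>e\<^sub>\<alpha>\<close>, \<open>\<pi>\<^sub>\<sigma>(v)\<close> and \<open>\<xi>\<close>, sorted
  by the degree \<open>\<gamma>\<close> of the result: the coefficient of \<open>e\<^sub>\<gamma>\<close> collects the values of
  \<open>[e\<^sub>\<alpha>, e\<^sub>\<beta>]\<close>, \<open>[\<pi>\<^sub>\<sigma>(v), e\<^sub>\<beta>]\<close>, \<open>[e\<^sub>\<alpha>, \<pi>\<^sub>\<tau>(w)]\<close>, \<open>[\<xi>, e\<^sub>\<gamma>]\<close>, \<open>[e\<^sub>\<gamma>, \<zeta>]\<close>, and the coset in degree \<open>\<gamma>\<close> those of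
  \<open>[\<pi>\<^sub>\<sigma>(v), \<pi>\<^sub>\<tau>(w)]\<close>, \<open>[e\<^sub>\<alpha>, e\<^sub>\<beta>]\<close>, \<open>[\<xi>, \<pi>\<^sub>\<gamma>(w)]\<close>, \<open>[\<pi>\<^sub>\<gamma>(v), \<zeta>]\<close>. The theorems
  \<open>N_bracket_pp\<close>, \<open>N_bracket_pe\<close>, \<open>N_bracket_ee\<close>, \<open>N_bracket_de\<close>, \<open>N_bracket_dp\<close>, \<open>N_bracket_dd\<close> below
  recover the rules.\<close>

definition N_bracket ::
  "(int^'n::finite \<Rightarrow> int) \<Rightarrow> (int^'n \<Rightarrow> int^'n \<Rightarrow> int) \<Rightarrow> (complex^'n \<Rightarrow> complex^'n) \<Rightarrow>
   'n gelt \<Rightarrow> 'n gelt \<Rightarrow> 'n gelt" where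
  "N_bracket q B \<rho> x y = Gelt
     (\<lambda>\<gamma>. if \<gamma> \<in> real_roots q then
          (\<Sum>\<alpha>\<in>esupp x. eps B \<alpha> (\<gamma> - \<alpha>) * ecoeff x \<alpha> * ecoeff y (\<gamma> - \<alpha>))
        + (\<Sum>\<sigma>\<in>psupp q WN x. eps B \<sigma> (\<gamma> - \<sigma>) *
             polarC q (rep (pcoset x \<sigma>)) (cvec (\<gamma> - \<sigma>)) * ecoeff y (\<gamma> - \<sigma>))
        - (\<Sum>\<tau>\<in>psupp q WN y. eps B \<tau> (\<gamma> - \<tau>) *
             polarC q (rep (pcoset y \<tau>)) (cvec (\<gamma> - \<tau>)) * ecoeff x (\<gamma> - \<tau>))
        + dfun x (\<rho> (cvec \<gamma>)) * ecoeff y \<gamma>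
        - dfun y (\<rho> (cvec \<gamma>)) * ecoeff x \<gamma>
      else 0)
     (\<lambda>\<gamma>. if \<gamma> \<in> null_roots q then
         ((\<Sum>\<sigma>\<in>psupp q WN x. (eps B \<sigma> (\<gamma> - \<sigma>) *
             polarC q (rep (pcoset x \<sigma>)) (rep (pcoset y (\<gamma> - \<sigma>)))) *s cvec \<sigma>)
        + (\<Sum>\<alpha>\<in>esupp x. (eps B \<alpha> (\<gamma> - \<alpha>) * ecoeff x \<alpha> * ecoeff y (\<gamma> - \<alpha>)) *s cvec \<alpha>)
        + dfun x (\<rho> (cvec \<gamma>)) *s rep (pcoset y \<gamma>)
        - dfun y (\<rho> (cvec \<gamma>)) *s rep (pcoset x \<gamma>)) +o WN \<gamma>
      else {})
     (\<lambda>_. 0)"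

definition N_alg ::
  "(int^'n::finite \<Rightarrow> int) \<Rightarrow> (int^'n \<Rightarrow> int^'n \<Rightarrow> int) \<Rightarrow> (complex^'n \<Rightarrow> complex^'n) \<Rightarrow>
   (complex, 'n gelt) module" where
  "N_alg q B \<rho> = \<lparr>carrier = gspace q WN, monoid.mult = N_bracket q B \<rho>, one = gzero q WN,
     ring.zero = gzero q WN, add = gadd, smult = gsmult WN\<rparr>"


subsection \<open>The bracket of \<open>N(q)\<close> on generators\<close>

context
  fixes q :: "int^'n::finite \<Rightarrow> int" and B \<rho>
  assumes nonneg: "\<And>x. 0 \<le> q x" and adm: "admissible_choice q B \<rho>"
begin

lemma B_add:
  "B (x + y) z = B x z + B y z" "B x (y + z) = B x y + B x z"
  using adm by (auto simp: admissible_choice_def Modules.additive_def)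

lemma q_eq_B: "q x = B x x"
  using adm by (simp add: admissible_choice_def)

lemma polar_eq_B: "polar q x y = B x y + B y x"
  by (simp add: polar_def q_eq_B B_add)

lemma B_sum: "B (\<Sum>i\<in>I. f i) z = (\<Sum>i\<in>I. B (f i) z)" "B z (\<Sum>i\<in>I. f i) = (\<Sum>i\<in>I. B z (f i))"
proof -
  have "Modules.additive (\<lambda>x. B x z)" "Modules.additive (B z)"
    using adm by (auto simp: admissible_choice_def)
  then show "B (\<Sum>i\<in>I. f i) z = (\<Sum>i\<in>I. B (f i) z)" "B z (\<Sum>i\<in>I. f i) = (\<Sum>i\<in>I. B z (f i))"
    using additive.sum[of "\<lambda>x. B x z" f I] additive.sum[of "B z" f I] by auto
qed

lemma B_scale: "B (k *s x) y = k * B x y" "B x (k *s y) = k * B x y"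
proof -
  have a: "Modules.additive (\<lambda>k. B (k *s x) y)" "Modules.additive (\<lambda>k. B x (k *s y))"
    by (auto simp: Modules.additive_def B_add vector_sadd_rdistrib)
  have int_lin: "g k = k * g 1" if "Modules.additive g" for g :: "int \<Rightarrow> int" and k
  proof (induction k rule: int_induct[where k = 0])
    case base show ?case using additive.zero[OF that] by simp
  next
    case (step1 i) then show ?case by (simp add: additive.add[OF that] algebra_simps)
  next
    case (step2 i) then show ?case by (simp add: additive.diff[OF that] algebra_simps)
  qed
  show "B (k *s x) y = k * B x y" "B x (k *s y) = k * B x y"
    using int_lin[OF a(1)] int_lin[OF a(2)] by simp_all
qed

lemma null_root_polar: assumes "\<sigma> \<in> null_roots q" shows "polar q \<sigma> y = 0"
proof (rule ccontr)
  assume p: "polar q \<sigma> y \<noteq> 0"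
  define k where "k = - sgn (polar q \<sigma> y) * (q y + 1)"
  have "q (k *s \<sigma> + y) = k * polar q \<sigma> y + q y"
    using assms by (simp add: q_eq_B B_add B_scale polar_eq_B null_roots_def algebra_simps)
  also have "\<dots> = q y - \<bar>polar q \<sigma> y\<bar> * (q y + 1)"
    by (simp add: k_def abs_sgn)
  also have "\<dots> < 0"
  proof -
    have "1 \<le> \<bar>polar q \<sigma> y\<bar>" using p by linarith
    then have "1 * (q y + 1) \<le> \<bar>polar q \<sigma> y\<bar> * (q y + 1)"
      using nonneg[of y] by (intro mult_right_mono) auto
    then show ?thesis by simp
  qed
  finally show False using nonneg[of "k *s \<sigma> + y"] by simp
qed

lemma polar_commute: "polar q x y = polar q y x"
  by (simp add: polar_def add.commute)

lemma q_add_null: assumes "\<sigma> \<in> null_roots q" shows "q (\<sigma> + y) = q y" "q (y + \<sigma>) = q y"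
  using null_root_polar[OF assms, of y] assms by (simp_all add: polar_def null_roots_def add.commute)

lemma polarC_add: "polarC q (v + v') w = polarC q v w + polarC q v' w"
  "polarC q v (w + w') = polarC q v w + polarC q v w'"
  by (simp_all add: polarC_def algebra_simps sum.distrib)

lemma polarC_scale: "polarC q (c *s v) w = c * polarC q v w" "polarC q v (c *s w) = c * polarC q v w"
  by (simp_all add: polarC_def algebra_simps sum_distrib_left)

lemma polarC_commute: "polarC q v w = polarC q w v"
  unfolding polarC_def by (subst sum.swap) (simp add: polar_commute mult.commute mult.left_commute)

lemma polarC_cvec: "polarC q (cvec x) (cvec y) = of_int (polar q x y)"
proof -
  have exp: "z = (\<Sum>i\<in>UNIV. (z $ i) *s axis i 1)" for z :: "int^'n"
    by (simp add: vec_eq_iff axis_def if_distrib[where f = "\<lambda>t. _ * t"] cong: if_cong)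
  have "B x y = (\<Sum>i\<in>UNIV. \<Sum>j\<in>UNIV. x $ i * y $ j * B (axis i 1) (axis j 1))" for x y
    by (subst exp[of x], subst exp[of y])
      (simp add: B_sum B_scale sum_distrib_left mult.assoc, subst sum.swap, simp add: mult.left_commute)
  note b = this
  have "polar q x y = (\<Sum>i\<in>UNIV. \<Sum>j\<in>UNIV. x $ i * y $ j * polar q (axis i 1) (axis j 1))"
    unfolding polar_eq_B by (subst b[of x y], subst b[of y x], subst (2) sum.swap)
      (simp add: sum.distrib algebra_simps)
  then show ?thesis by (simp add: polarC_def cvec_def)
qed

lemma polarC_null: assumes "\<sigma> \<in> null_roots q" shows "polarC q (cvec \<sigma>) w = 0" "polarC q w (cvec \<sigma>) = 0"
proof -
  have exp: "w = (\<Sum>j\<in>UNIV. (w $ j) *s cvec (axis j 1))"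
    by (simp add: vec_eq_iff cvec_def axis_def if_distrib[where f = "\<lambda>t. _ * t"] if_distrib[where f = of_int] cong: if_cong)
  have s: "polarC q v (\<Sum>j\<in>J. f j) = (\<Sum>j\<in>J. polarC q v (f j))" for v and f :: "'n \<Rightarrow> complex^'n" and J
  proof -
    have "polarC q v 0 = 0" by (simp add: polarC_def)
    then show ?thesis by (induction J rule: infinite_finite_induct) (simp_all add: polarC_add)
  qed
  show "polarC q (cvec \<sigma>) w = 0"
    by (subst exp) (simp add: s polarC_scale polarC_cvec null_root_polar[OF assms])
  then show "polarC q w (cvec \<sigma>) = 0" by (simp add: polarC_commute)
qed

lemma WN_iff: "v \<in> WN \<sigma> \<longleftrightarrow> (\<exists>c. v = c *s cvec \<sigma>)"
  by (auto simp: WN_def vec.span_singleton)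

lemma coset_WN_eq: "v +o WN \<sigma> = w +o WN \<sigma> \<longleftrightarrow> v - w \<in> WN \<sigma>"
proof
  assume "v +o WN \<sigma> = w +o WN \<sigma>"
  moreover have "v \<in> v +o WN \<sigma>"
    by (auto simp: elt_set_plus_def WN_def vec.span_zero intro: bexI[of _ 0])
  ultimately show "v - w \<in> WN \<sigma>" by (auto simp: elt_set_plus_def)
next
  assume d: "v - w \<in> WN \<sigma>"
  have "x \<in> v +o WN \<sigma> \<longleftrightarrow> x \<in> w +o WN \<sigma>" for x
  proof -
    have "x - v \<in> WN \<sigma> \<longleftrightarrow> x - w \<in> WN \<sigma>"
      using d vec.span_add[of "x - v" _ "v - w"] vec.span_diff[of "x - w" _ "v - w"]
      unfolding WN_def by auto
    moreover have "x \<in> u +o WN \<sigma> \<longleftrightarrow> x - u \<in> WN \<sigma>" for u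
      by (auto simp: elt_set_plus_def intro: bexI[of _ "x - u"])
    ultimately show ?thesis by simp
  qed
  then show "v +o WN \<sigma> = w +o WN \<sigma>" by blast
qed

lemma coset_WN_zero: "0 +o WN \<sigma> = WN \<sigma>"
  by (simp add: elt_set_plus_def)

lemma rep_coset: "rep (v +o WN \<sigma>) - v \<in> WN \<sigma>"
proof -
  have "v \<in> v +o WN \<sigma>"
    by (auto simp: elt_set_plus_def WN_def vec.span_zero intro: bexI[of _ 0])
  then have "rep (v +o WN \<sigma>) \<in> v +o WN \<sigma>" unfolding rep_def by (rule someI)
  then show ?thesis by (auto simp: elt_set_plus_def)
qed

lemma rep_WN: "rep (WN \<sigma>) \<in> WN \<sigma>"
  using rep_coset[of 0 \<sigma>] by (simp add: coset_WN_zero)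

lemma polarC_WN: assumes "\<sigma> \<in> null_roots q" "v - v' \<in> WN \<sigma>"
  shows "polarC q v w = polarC q v' w" "polarC q w v = polarC q w v'"
proof -
  obtain c where "v - v' = c *s cvec \<sigma>" using assms by (auto simp: WN_iff)
  then have "v = v' + c *s cvec \<sigma>" by (simp add: algebra_simps)
  then show "polarC q v w = polarC q v' w" "polarC q w v = polarC q w v'"
    using polarC_null[OF assms(1)] by (simp_all add: polarC_add polarC_scale)
qed

lemma esupp_gens [simp]:
  "esupp (evec q W \<alpha>) = {\<alpha>}" "esupp (pvec q W \<sigma> v) = {}" "esupp (dvec q W \<xi>) = {}"
  by (auto simp: esupp_def evec_def pvec_def dvec_def)

lemma psupp_gens [simp]: "psupp q W (evec q W \<alpha>) = {}" "psupp q W (dvec q W \<xi>) = {}"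
  by (auto simp: psupp_def evec_def dvec_def gzero_def)

lemma sum_psupp_pvec:
  assumes "\<sigma> \<in> null_roots q" "v \<in> WN \<sigma> \<Longrightarrow> g \<sigma> = 0"
  shows "(\<Sum>\<tau>\<in>psupp q WN (pvec q WN \<sigma> v). g \<tau>) = (g \<sigma> :: 'b::comm_monoid_add)"
proof -
  have "psupp q WN (pvec q WN \<sigma> v) = (if v \<in> WN \<sigma> then {} else {\<sigma>})"
    using assms(1) coset_WN_eq[of v \<sigma> 0]
    by (auto simp: psupp_def pvec_def gzero_def coset_WN_zero split: if_splits)
  then show ?thesis using assms(2) by auto
qed

lemma null_roots_add: "\<sigma> \<in> null_roots q \<Longrightarrow> \<tau> \<in> null_roots q \<Longrightarrow> \<sigma> + \<tau> \<in> null_roots q"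
  using q_add_null by (simp add: null_roots_def)

lemma real_roots_add_null: "\<sigma> \<in> null_roots q \<Longrightarrow> \<beta> + \<sigma> \<in> real_roots q \<longleftrightarrow> \<beta> \<in> real_roots q"
  using q_add_null by (simp add: real_roots_def)

lemma zero_null_root: "0 \<in> null_roots q"
  using B_scale(1)[of 0 0 0] by (simp add: null_roots_def q_eq_B)

lemma smult_coset_WN: "((*s) c) ` (v +o WN \<sigma>) + WN \<sigma> = (c *s v) +o WN \<sigma>"
proof -
  have "((*s) c) ` WN \<sigma> \<subseteq> WN \<sigma>" by (auto simp: WN_def vec.span_scale)
  have 1: "x \<in> (c *s v) +o WN \<sigma>" if "x \<in> ((*s) c) ` (v +o WN \<sigma>) + WN \<sigma>" for x
  proof -
    from that obtain u w where "u \<in> WN \<sigma>" "w \<in> WN \<sigma>" "x = c *s (v + u) + w"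
      by (auto simp: elt_set_plus_def set_plus_def)
    then have "x = c *s v + (c *s u + w)" "c *s u + w \<in> WN \<sigma>"
      by (auto simp: vec.scale_right_distrib WN_def intro: vec.span_add vec.span_scale)
    then show ?thesis by (auto simp: elt_set_plus_def)
  qed
  have 2: "x \<in> ((*s) c) ` (v +o WN \<sigma>) + WN \<sigma>" if x: "x \<in> (c *s v) +o WN \<sigma>" for x
  proof -
    have "v \<in> v +o WN \<sigma>"
      by (auto simp: elt_set_plus_def WN_def vec.span_zero intro: bexI[of _ 0])
    then show ?thesis using x by (auto simp: elt_set_plus_def set_plus_def)
  qed
  show ?thesis using 1 2 by blast
qed

lemma gsmult_gens:
  "gsmult WN c (evec q WN \<alpha>) = Gelt (\<lambda>\<beta>. if \<beta> = \<alpha> then c else 0) (pcoset (gzero q WN)) (\<lambda>_. 0)"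
  "\<sigma> \<in> null_roots q \<Longrightarrow> gsmult WN c (pvec q WN \<sigma> v) = pvec q WN \<sigma> (c *s v)"
proof -
  have e: "((*s) c) ` pcoset (gzero q WN) \<tau> + WN \<tau> = pcoset (gzero q WN) \<tau>" for \<tau>
    using smult_coset_WN[of c 0 \<tau>] by (simp add: gzero_def coset_WN_zero set_plus_def)
  show "gsmult WN c (evec q WN \<alpha>) = Gelt (\<lambda>\<beta>. if \<beta> = \<alpha> then c else 0) (pcoset (gzero q WN)) (\<lambda>_. 0)"
    by (auto simp: gsmult_def evec_def e)
  show "gsmult WN c (pvec q WN \<sigma> v) = pvec q WN \<sigma> (c *s v)"
    using e by (auto simp: gsmult_def pvec_def smult_coset_WN fun_eq_iff)
qed

lemma rep_gzero: "\<gamma> \<in> null_roots q \<Longrightarrow> rep (pcoset (gzero q WN) \<gamma>) \<in> WN \<gamma>"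
  by (simp add: gzero_def rep_WN)

lemma coset_of_WN: "w \<in> WN \<gamma> \<Longrightarrow> w +o WN \<gamma> = WN \<gamma>"
  using coset_WN_eq[of w \<gamma> 0] by (simp add: coset_WN_zero)

lemma WN_closed: "0 \<in> WN \<gamma>" "u \<in> WN \<gamma> \<Longrightarrow> c *s u \<in> WN \<gamma>" "u \<in> WN \<gamma> \<Longrightarrow> - u \<in> WN \<gamma>"
  "u \<in> WN \<gamma> \<Longrightarrow> v \<in> WN \<gamma> \<Longrightarrow> u + v \<in> WN \<gamma>" "u \<in> WN \<gamma> \<Longrightarrow> v \<in> WN \<gamma> \<Longrightarrow> u - v \<in> WN \<gamma>"
  by (auto simp: WN_def vec.span_zero vec.span_scale vec.span_neg vec.span_add vec.span_diff)

lemma gen_sel [simp]: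
  "ecoeff (evec q W \<alpha>) = (\<lambda>\<beta>. if \<beta> = \<alpha> then 1 else 0)" "pcoset (evec q W \<alpha>) = pcoset (gzero q W)"
  "dfun (evec q W \<alpha>) = (\<lambda>_. 0)" "ecoeff (pvec q W \<sigma> v) = (\<lambda>_. 0)"
  "pcoset (pvec q W \<sigma> v) = (pcoset (gzero q W))(\<sigma> := v +o W \<sigma>)" "dfun (pvec q W \<sigma> v) = (\<lambda>_. 0)"
  "ecoeff (dvec q W \<xi>) = (\<lambda>_. 0)" "pcoset (dvec q W \<xi>) = pcoset (gzero q W)" "dfun (dvec q W \<xi>) = \<xi>"
  by (simp_all add: evec_def pvec_def dvec_def)

lemma null_roots_diff: "\<gamma> \<in> null_roots q \<Longrightarrow> \<sigma> \<in> null_roots q \<Longrightarrow> \<gamma> - \<sigma> \<in> null_roots q"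
  using q_add_null(1)[of \<sigma> "\<gamma> - \<sigma>"] by (simp add: null_roots_def)

lemma polarC_rep:
  assumes "\<sigma> \<in> null_roots q"
  shows "polarC q (rep (v +o WN \<sigma>)) w = polarC q v w" "polarC q w (rep (v +o WN \<sigma>)) = polarC q w v"
  using polarC_WN[OF assms rep_coset] by auto

lemma polarC_WN_zero:
  assumes "\<sigma> \<in> null_roots q" "v \<in> WN \<sigma>"
  shows "polarC q v w = 0" "polarC q w v = 0"
  using polarC_WN[OF assms(1), of v 0] assms(2) by (simp_all add: polarC_def)

lemma coset_scaled_rep: "(c *s rep (v +o WN \<gamma>)) +o WN \<gamma> = (c *s v) +o WN \<gamma>"
proof -
  have "c *s rep (v +o WN \<gamma>) - c *s v \<in> WN \<gamma>"
    using WN_closed(2)[OF rep_coset, of c] by (simp add: vec.scale_right_diff_distrib)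
  then show ?thesis by (simp add: coset_WN_eq)
qed

lemma gzero_coset: "pcoset (gzero q WN) \<gamma> = (if \<gamma> \<in> null_roots q then WN \<gamma> else {})"
  by (simp add: gzero_def)

theorem N_bracket_pp:
  assumes "\<sigma> \<in> null_roots q" "\<tau> \<in> null_roots q"
  shows "N_bracket q B \<rho> (pvec q WN \<sigma> v) (pvec q WN \<tau> w) =
    gsmult WN (eps B \<sigma> \<tau> * polarC q v w) (pvec q WN (\<sigma> + \<tau>) (cvec \<sigma>))"
proof -
  have st: "\<sigma> + \<tau> \<in> null_roots q" using assms by (rule null_roots_add)
  let ?x = "pvec q WN \<sigma> v" and ?y = "pvec q WN \<tau> w"
  have c: "(\<Sum>\<sigma>'\<in>psupp q WN ?x. (eps B \<sigma>' (\<gamma> - \<sigma>') *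
             polarC q (rep (pcoset ?x \<sigma>')) (rep (pcoset ?y (\<gamma> - \<sigma>')))) *s cvec \<sigma>') =
           (if \<gamma> = \<sigma> + \<tau> then (eps B \<sigma> \<tau> * polarC q v w) *s cvec \<sigma> else 0)"
    if "\<gamma> \<in> null_roots q" for \<gamma>
  proof (subst sum_psupp_pvec[OF assms(1)])
    show "(eps B \<sigma> (\<gamma> - \<sigma>) *
      polarC q (rep (pcoset ?x \<sigma>)) (rep (pcoset ?y (\<gamma> - \<sigma>)))) *s cvec \<sigma> = 0" if "v \<in> WN \<sigma>"
      using polarC_WN_zero[OF assms(1) that] by (simp add: polarC_rep[OF assms(1)])
    show "(eps B \<sigma> (\<gamma> - \<sigma>) *
      polarC q (rep (pcoset ?x \<sigma>)) (rep (pcoset ?y (\<gamma> - \<sigma>)))) *s cvec \<sigma> =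
      (if \<gamma> = \<sigma> + \<tau> then (eps B \<sigma> \<tau> * polarC q v w) *s cvec \<sigma> else 0)"
    proof (cases "\<gamma> = \<sigma> + \<tau>")
      case True
      then show ?thesis by (simp add: polarC_rep assms)
    next
      case False
      then have "\<gamma> - \<sigma> \<noteq> \<tau>" by (auto simp: algebra_simps)
      moreover have "\<gamma> - \<sigma> \<in> null_roots q" using null_roots_diff that assms(1) by blast
      ultimately show ?thesis
        using False polarC_WN_zero(2)[OF _ rep_WN] by (simp add: gzero_coset)
    qed
  qed
  show ?thesis
    unfolding gsmult_gens(2)[OF st] N_bracket_def
    by (simp only: c cong: if_cong)
      (use st in \<open>auto simp: pvec_def gzero_coset coset_WN_zero fun_eq_iff\<close>)
qed

theorem N_bracket_pe:
  assumes "\<sigma> \<in> null_roots q" "\<beta> \<in> real_roots q"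
  shows "N_bracket q B \<rho> (pvec q WN \<sigma> v) (evec q WN \<beta>) =
      gsmult WN (eps B \<sigma> \<beta> * polarC q v (cvec \<beta>)) (evec q WN (\<beta> + \<sigma>))"
    and "N_bracket q B \<rho> (evec q WN \<beta>) (pvec q WN \<sigma> v) =
      gsmult WN (- (eps B \<sigma> \<beta> * polarC q v (cvec \<beta>))) (evec q WN (\<beta> + \<sigma>))"
proof -
  let ?x = "pvec q WN \<sigma> v" and ?y = "evec q WN \<beta>"
  have bs: "\<beta> + \<sigma> \<in> real_roots q" using assms real_roots_add_null by blast
  have c: "(\<Sum>\<sigma>'\<in>psupp q WN ?x. eps B \<sigma>' (\<gamma> - \<sigma>') *
             polarC q (rep (pcoset ?x \<sigma>')) (cvec (\<gamma> - \<sigma>')) * ecoeff ?y (\<gamma> - \<sigma>')) =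
           (if \<gamma> = \<beta> + \<sigma> then eps B \<sigma> \<beta> * polarC q v (cvec \<beta>) else 0)" for \<gamma>
  proof (subst sum_psupp_pvec[OF assms(1)])
    show "eps B \<sigma> (\<gamma> - \<sigma>) *
      polarC q (rep (pcoset ?x \<sigma>)) (cvec (\<gamma> - \<sigma>)) * ecoeff ?y (\<gamma> - \<sigma>) = 0" if "v \<in> WN \<sigma>"
      using polarC_WN_zero[OF assms(1) that] by (simp add: polarC_rep[OF assms(1)])
    show "eps B \<sigma> (\<gamma> - \<sigma>) *
      polarC q (rep (pcoset ?x \<sigma>)) (cvec (\<gamma> - \<sigma>)) * ecoeff ?y (\<gamma> - \<sigma>) =
      (if \<gamma> = \<beta> + \<sigma> then eps B \<sigma> \<beta> * polarC q v (cvec \<beta>) else 0)"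
      using polarC_rep[OF assms(1)] by (auto simp: algebra_simps)
  qed
  show "N_bracket q B \<rho> ?x ?y =
      gsmult WN (eps B \<sigma> \<beta> * polarC q v (cvec \<beta>)) (evec q WN (\<beta> + \<sigma>))"
    unfolding gsmult_gens(1) N_bracket_def c using bs
    by (auto simp: gzero_coset coset_WN_zero fun_eq_iff polarC_WN_zero(2)[OF _ rep_WN]
        null_roots_diff assms psupp_def intro!: sum.neutral)
  show "N_bracket q B \<rho> ?y ?x =
      gsmult WN (- (eps B \<sigma> \<beta> * polarC q v (cvec \<beta>))) (evec q WN (\<beta> + \<sigma>))"
    unfolding gsmult_gens(1) N_bracket_def c using bs
    by (auto simp: gzero_coset coset_WN_zero fun_eq_iff)
qed

theorem N_bracket_ee:
  assumes "\<alpha> \<in> real_roots q" "\<beta> \<in> real_roots q"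
  shows "\<alpha> + \<beta> \<in> real_roots q \<Longrightarrow> N_bracket q B \<rho> (evec q WN \<alpha>) (evec q WN \<beta>) =
      gsmult WN (eps B \<alpha> \<beta>) (evec q WN (\<alpha> + \<beta>))"
    and "\<alpha> + \<beta> \<in> null_roots q \<Longrightarrow> N_bracket q B \<rho> (evec q WN \<alpha>) (evec q WN \<beta>) =
      gsmult WN (eps B \<alpha> \<beta>) (pvec q WN (\<alpha> + \<beta>) (cvec \<alpha>))"
    and "\<alpha> + \<beta> \<notin> roots q \<Longrightarrow> N_bracket q B \<rho> (evec q WN \<alpha>) (evec q WN \<beta>) = gzero q WN"
proof -
  let ?x = "evec q WN \<alpha>" and ?y = "evec q WN \<beta>"
  have disj: "\<gamma> \<in> real_roots q \<Longrightarrow> \<gamma> \<notin> null_roots q" for \<gamma>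
    by (simp add: real_roots_def null_roots_def)
  have [simp]: "\<gamma> - \<alpha> = \<beta> \<longleftrightarrow> \<gamma> = \<alpha> + \<beta>" for \<gamma> by (auto simp: algebra_simps)
  show "N_bracket q B \<rho> ?x ?y = gsmult WN (eps B \<alpha> \<beta>) (evec q WN (\<alpha> + \<beta>))"
    if "\<alpha> + \<beta> \<in> real_roots q"
    unfolding gsmult_gens(1) N_bracket_def using that disj[OF that]
    by (auto simp: gzero_coset coset_WN_zero fun_eq_iff)
  show "N_bracket q B \<rho> ?x ?y = gsmult WN (eps B \<alpha> \<beta>) (pvec q WN (\<alpha> + \<beta>) (cvec \<alpha>))"
    if "\<alpha> + \<beta> \<in> null_roots q"
    unfolding gsmult_gens(2)[OF that] unfolding N_bracket_def pvec_def using that disj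
    by (auto simp: gzero_coset coset_WN_zero fun_eq_iff)
  show "N_bracket q B \<rho> ?x ?y = gzero q WN" if "\<alpha> + \<beta> \<notin> roots q"
    using that unfolding N_bracket_def gzero_def roots_def
    by (auto simp: coset_WN_zero fun_eq_iff)
qed

theorem N_bracket_de:
  assumes "\<beta> \<in> real_roots q"
  shows "N_bracket q B \<rho> (dvec q WN \<xi>) (evec q WN \<beta>) =
      gsmult WN (\<xi> (\<rho> (cvec \<beta>))) (evec q WN \<beta>)"
    and "N_bracket q B \<rho> (evec q WN \<beta>) (dvec q WN \<xi>) =
      gsmult WN (- \<xi> (\<rho> (cvec \<beta>))) (evec q WN \<beta>)"
  unfolding gsmult_gens N_bracket_def using assms
  by (auto simp: gzero_coset coset_WN_zero fun_eq_iff coset_of_WN WN_closed rep_WN)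

theorem N_bracket_dp:
  assumes "\<tau> \<in> null_roots q"
  shows "N_bracket q B \<rho> (dvec q WN \<xi>) (pvec q WN \<tau> w) =
      gsmult WN (\<xi> (\<rho> (cvec \<tau>))) (pvec q WN \<tau> w)"
    and "N_bracket q B \<rho> (pvec q WN \<tau> w) (dvec q WN \<xi>) =
      gsmult WN (- \<xi> (\<rho> (cvec \<tau>))) (pvec q WN \<tau> w)"
proof -
  let ?x = "dvec q WN \<xi>" and ?y = "pvec q WN \<tau> w"
  show "N_bracket q B \<rho> ?x ?y = gsmult WN (\<xi> (\<rho> (cvec \<tau>))) ?y"
    unfolding gsmult_gens(2)[OF assms] N_bracket_def using assms
    by (auto simp: pvec_def gzero_coset fun_eq_iff coset_of_WN WN_closed rep_WN coset_scaled_rep)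
  have "(\<Sum>\<sigma>\<in>psupp q WN ?y. (eps B \<sigma> (\<gamma> - \<sigma>) *
      polarC q (rep (pcoset ?y \<sigma>)) (rep (pcoset ?x (\<gamma> - \<sigma>)))) *s cvec \<sigma>) = 0"
    if "\<gamma> \<in> null_roots q" for \<gamma>
  proof (rule sum.neutral, rule ballI)
    fix \<sigma> assume "\<sigma> \<in> psupp q WN ?y"
    then have "\<gamma> - \<sigma> \<in> null_roots q" using null_roots_diff that by (auto simp: psupp_def)
    then show "(eps B \<sigma> (\<gamma> - \<sigma>) *
      polarC q (rep (pcoset ?y \<sigma>)) (rep (pcoset ?x (\<gamma> - \<sigma>)))) *s cvec \<sigma> = 0"
      using polarC_WN_zero(2)[OF _ rep_WN] by (simp add: gzero_coset)
  qed
  note c = this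
  have m: "- (c *s u) = (- c) *s u" for c and u :: "complex^'n" by simp
  show "N_bracket q B \<rho> ?y ?x = gsmult WN (- \<xi> (\<rho> (cvec \<tau>))) ?y"
    unfolding gsmult_gens(2)[OF assms] N_bracket_def
    by (simp only: c cong: if_cong)
      (use assms coset_scaled_rep[of "- \<xi> (\<rho> (cvec \<tau>))" w \<tau>] in
        \<open>auto simp: pvec_def gzero_coset fun_eq_iff coset_of_WN WN_closed rep_WN\<close>)
qed

theorem N_bracket_dd: "N_bracket q B \<rho> (dvec q WN \<xi>) (dvec q WN \<zeta>) = gzero q WN"
  unfolding N_bracket_def gzero_def
  by (auto simp: fun_eq_iff gzero_coset coset_of_WN WN_closed rep_WN)

end


section \<open>The Lie algebra \<open>E(q)\<close>\<close>

definition WE :: "(int^'n::finite \<Rightarrow> int) \<Rightarrow> int^'n \<Rightarrow> (complex^'n) set" where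
  "WE q \<sigma> = (if \<sigma> = 0 then {0} else radC q)"

text \<open>The canonical epimorphism \<open>N(q) \<rightarrow> E(q)\<close>. The bracket of \<open>E(q)\<close> is computed on preimages.\<close>

definition N_to_E :: "(int^'n::finite \<Rightarrow> int) \<Rightarrow> 'n gelt \<Rightarrow> 'n gelt" where
  "N_to_E q x = Gelt (ecoeff x) (\<lambda>\<sigma>. pcoset x \<sigma> + WE q \<sigma>) (dfun x)"

definition E_bracket ::
  "(int^'n::finite \<Rightarrow> int) \<Rightarrow> (int^'n \<Rightarrow> int^'n \<Rightarrow> int) \<Rightarrow> (complex^'n \<Rightarrow> complex^'n) \<Rightarrow>
   'n gelt \<Rightarrow> 'n gelt \<Rightarrow> 'n gelt" where
  "E_bracket q B \<rho> x y = N_to_E q (N_bracket q B \<rho>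
     (inv_into (gspace q WN) (N_to_E q) x) (inv_into (gspace q WN) (N_to_E q) y))"

definition E_alg ::
  "(int^'n::finite \<Rightarrow> int) \<Rightarrow> (int^'n \<Rightarrow> int^'n \<Rightarrow> int) \<Rightarrow> (complex^'n \<Rightarrow> complex^'n) \<Rightarrow>
   (complex, 'n gelt) module" where
  "E_alg q B \<rho> = \<lparr>carrier = gspace q (WE q), monoid.mult = E_bracket q B \<rho>, one = gzero q (WE q),
     ring.zero = gzero q (WE q), add = gadd, smult = gsmult (WE q)\<rparr>"

abbreviation E_comp :: "(int^'n::finite \<Rightarrow> int) \<Rightarrow> int^'n \<Rightarrow> 'n gelt set" where
  "E_comp q \<alpha> \<equiv> gcomp q (WE q) \<alpha>"

text \<open>The functional \<open>\<pi>\<^sub>0(v) + \<xi> \<mapsto> q(v, \<alpha>) + \<xi>(\<rho>(\<alpha>))\<close> on \<open>H = E\<^sub>0\<close>.\<close>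

definition root_emb ::
  "(int^'n::finite \<Rightarrow> int) \<Rightarrow> (complex^'n \<Rightarrow> complex^'n) \<Rightarrow> int^'n \<Rightarrow> 'n gelt \<Rightarrow> complex" where
  "root_emb q \<rho> \<alpha> x =
     (if x \<in> E_comp q 0
      then polarC q (the_elem (pcoset x 0)) (cvec \<alpha>) + dfun x (\<rho> (cvec \<alpha>)) else 0)"

definition E_is_EALA_with_roots ::
  "(int^'n::finite \<Rightarrow> int) \<Rightarrow> (int^'n \<Rightarrow> int^'n \<Rightarrow> int) \<Rightarrow> (complex^'n \<Rightarrow> complex^'n) \<Rightarrow> bool" where
  "E_is_EALA_with_roots q B \<rho> \<longleftrightarrow>
     (\<exists>b. extended_affine_lie_algebra (E_alg q B \<rho>) (E_comp q 0) b) \<and>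
     inj (root_emb q \<rho>) \<and>
     root_system (E_alg q B \<rho>) (E_comp q 0) = root_emb q \<rho> ` roots q \<and>
     (\<forall>\<alpha>\<in>roots q. root_space (E_alg q B \<rho>) (E_comp q 0) (root_emb q \<rho> \<alpha>) = E_comp q \<alpha>)"

definition E_graded_isomorphic ::
  "(int^'n::finite \<Rightarrow> int) \<Rightarrow> (int^'n \<Rightarrow> int^'n \<Rightarrow> int) \<Rightarrow> (complex^'n \<Rightarrow> complex^'n) \<Rightarrow>
   (int^'m::finite \<Rightarrow> int) \<Rightarrow> (int^'m \<Rightarrow> int^'m \<Rightarrow> int) \<Rightarrow> (complex^'m \<Rightarrow> complex^'m) \<Rightarrow> bool" where
  "E_graded_isomorphic q B \<rho> q' B' \<rho>' \<longleftrightarrow>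
     (\<exists>\<phi> \<psi>. lie_iso (E_alg q B \<rho>) (E_alg q' B' \<rho>') \<phi> \<and> Modules.additive \<psi> \<and> bij \<psi> \<and>
        \<psi> ` roots q = roots q' \<and> (\<forall>\<alpha>\<in>roots q. \<phi> ` E_comp q \<alpha> = E_comp q' (\<psi> \<alpha>)))"

end

theory Submission
  imports Defs
begin

text \<open>
  The quotient \<open>E(q)\<close> of \<open>N(q)\<close> is well defined because \<open>rad\<^sub>\<complex> q\<close> pairs to zero with everything. Choosing
  in each coset of \<open>\<complex>\<^sup>n / rad\<^sub>\<complex> q\<close> the representative in the kernel of \<open>\<rho>\<close> gives coordinates, in which the
  bracket is an explicit bilinear expression (\<open>E_bracket_eq\<close>). The Jacobi identity and the invariance of
  the form are then checked on the generators \<open>e\<^sub>\<alpha>\<close>, \<open>\<pi>\<^sub>\<sigma>(v)\<close> and \<open>\<xi>\<close>. The \<open>\<xi>\<close> act as derivations by the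
  degree, and a bracket of two \<open>\<pi>\<close> is the \<open>\<pi>\<close> of a null vector, which commutes with all \<open>e\<close> and \<open>\<pi>\<close>. The
  main case is that of three real roots \<open>\<alpha>, \<beta>, \<gamma>\<close>. Non-negativity bounds the pairings \<open>a, b, c\<close> of two of them by \<open>2\<close> in absolute
  value, and \<open>q(\<alpha> + \<beta> + \<gamma>) = 3 + a + b + c\<close> has to be \<open>0\<close> or \<open>1\<close>, which leaves a finite check
  (\<open>jac_eee\<close>).

  The form pairs degree \<open>\<alpha>\<close> with degree \<open>-\<alpha>\<close>, and the radical in degree \<open>0\<close> with its dual. It is nondegenerate
  because the radical of the complexified form is spanned by integral vectors, being the kernel of an
  integer matrix (\<open>mem_radC_iff\<close>). The same fact shows that every coordinate of a lattice vector \<open>\<alpha>\<close> is the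
  value of the functional \<open>\<alpha>\<close> at a suitable element of \<open>H\<close> (\<open>ev_separates\<close>). Hence \<open>H\<close> separates the degrees, so
  the root spaces are the graded components, and the root system is discrete. Real root vectors act
  nilpotently since \<open>q(\<beta> + 3\<alpha>) > 1\<close> for every real root \<open>\<alpha>\<close> and every root \<open>\<beta>\<close>. The functional \<open>\<alpha>\<close> is represented by
  \<open>\<pi>\<^sub>0(\<alpha>)\<close>, which makes the transferred form equal to \<open>q\<close> on the roots. An orthogonal decomposition of the
  non-isotropic roots would therefore separate basis vectors that connectedness links.

  As to the classification, the root system determines the form. Null roots are the roots whose
  double is a root, and pairings of real roots can be read off from the sums and differences that are
  roots (\<open>roots_determine_form\<close>). An isomorphism of the lattices that matches the root systems is thus an
  isometry. Conversely, let \<open>\<psi>\<close> be an isometry. The signs \<open>\<epsilon>\<close> of the two sides differ by the sign of an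
  alternating form, which is a coboundary \<open>\<theta>\<close> modulo \<open>2\<close> (\<open>sign_of_alternating\<close>). The projections \<open>\<rho>\<close> of the two
  sides differ by a map that vanishes on the radical. Composed with a functional \<open>\<xi>\<close> it is of the form
  \<open>q(v, -)\<close>, so adding \<open>\<pi>\<^sub>0(v)\<close> to the image of \<open>\<xi>\<close> corrects the difference (\<open>correction_exists\<close>). This gives an
  isomorphism \<open>\<phi>\<close> of graded Lie algebras.
\<close>

section \<open>Linear algebra over the integers\<close>

lemma common_denominator:
  assumes "finite (R :: rat set)"
  shows "\<exists>N::int. N \<noteq> 0 \<and> (\<forall>r\<in>R. of_int N * r \<in> \<int>)"
  using assms
proof induction
  case empty
  show ?case by (intro exI[of _ 1]) simp
next
  case (insert r R)
  then obtain N :: int where N: "N \<noteq> 0" "\<forall>r\<in>R. of_int N * r \<in> \<int>" by blast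
  obtain a b :: int where ab: "r = of_int a / of_int b" "b > 0"
    by (metis quotient_of_unique Fract_of_int_quotient)
  have "of_int (b * N) * s \<in> \<int>" if "s \<in> insert r R" for s
  proof (cases "s = r")
    case True
    then have "of_int (b * N) * s = of_int (N * a)" using ab by simp
    then show ?thesis by (simp only: Ints_of_int)
  next
    case False
    then have "of_int N * s \<in> \<int>" using N that by blast
    then have "of_int b * (of_int N * s) \<in> \<int>" using Ints_mult[OF Ints_of_int] by blast
    then show ?thesis by (simp only: of_int_mult mult.assoc)
  qed
  then show ?case using N ab by (intro exI[of _ "b * N"]) auto
qed

text \<open>Expanding the entries of a complex solution in a basis of the rational vector space that they
  span, each basis element contributes a rational solution, and clearing denominators makes it
  integral.\<close>

lemma integer_kernel_spans_complex_kernel: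
  fixes m :: "'n::finite \<Rightarrow> 'n \<Rightarrow> int" and v :: "complex^'n"
  assumes ker: "\<And>j. (\<Sum>i\<in>UNIV. v $ i * of_int (m i j)) = 0"
  shows "v \<in> vec.span (cvec ` {x. \<forall>j. (\<Sum>i\<in>UNIV. x $ i * m i j) = 0})"
proof -
  interpret Q: vector_space "\<lambda>(r::rat) (c::complex). of_rat r * c"
    by unfold_locales (simp_all add: algebra_simps of_rat_add of_rat_mult)
  obtain S where S: "S \<subseteq> range (($) v)" "Q.independent S" "range (($) v) \<subseteq> Q.span S"
    using Q.maximal_independent_subset[of "range (($) v)"] by metis
  have fin: "finite S" using S(1) by (rule finite_subset) simp
  have "\<exists>u. v $ i = (\<Sum>b\<in>S. of_rat (u b) * b)" for i
    using S(3) Q.span_finite[OF fin] by auto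
  then obtain r where r: "\<And>i. v $ i = (\<Sum>b\<in>S. of_rat (r i b) * b)" by metis
  have rat_ker: "(\<Sum>i\<in>UNIV. r i b * of_int (m i j)) = 0" if "b \<in> S" for b j
  proof -
    have "(\<Sum>b\<in>S. of_rat (\<Sum>i\<in>UNIV. r i b * of_int (m i j)) * b)
        = (\<Sum>b\<in>S. \<Sum>i\<in>UNIV. of_rat (r i b) * b * of_int (m i j))"
      by (simp add: of_rat_sum of_rat_mult sum_distrib_left sum_distrib_right mult_ac)
    also have "\<dots> = (\<Sum>i\<in>UNIV. v $ i * of_int (m i j))"
      by (subst sum.swap) (simp add: r sum_distrib_right)
    finally show ?thesis
      using Q.independentD[OF S(2) fin order_refl _ that] ker by simp
  qed
  obtain N :: int where N: "N \<noteq> 0" "\<forall>x\<in>(\<lambda>(i, b). r i b) ` (UNIV \<times> S). of_int N * x \<in> \<int>"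
    using common_denominator[of "(\<lambda>(i, b). r i b) ` (UNIV \<times> S)"] fin by auto
  have "\<forall>i. \<forall>b\<in>S. \<exists>k::int. of_int N * r i b = of_int k"
    using N(2) by (auto elim!: Ints_cases)
  then obtain k :: "'n \<Rightarrow> complex \<Rightarrow> int" where k: "\<And>i b. b \<in> S \<Longrightarrow> of_int N * r i b = of_int (k i b)"
    by metis
  define z where "z b = (\<chi> i. k i b)" for b
  have z: "z b \<in> {x. \<forall>j. (\<Sum>i\<in>UNIV. x $ i * m i j) = 0}" if "b \<in> S" for b
  proof -
    have "(of_int (\<Sum>i\<in>UNIV. z b $ i * m i j) :: rat) = of_int N * (\<Sum>i\<in>UNIV. r i b * of_int (m i j))" for j
      by (simp add: z_def k[OF that, symmetric] sum_distrib_left mult.assoc)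
    then have "(of_int (\<Sum>i\<in>UNIV. z b $ i * m i j) :: rat) = 0" for j
      by (simp add: rat_ker[OF that])
    then show ?thesis by (simp only: of_int_eq_0_iff mem_Collect_eq) blast
  qed
  have k': "complex_of_int (k i b) = of_int N * of_rat (r i b)" if "b \<in> S" for i b
    using k[OF that, of i] by (metis of_rat_mult of_rat_of_int_eq)
  have "v = (\<Sum>b\<in>S. (b / of_int N) *s cvec (z b))"
    by (simp add: vec_eq_iff cvec_def z_def r k' N mult.commute cong: sum.cong)
  moreover have "(\<Sum>b\<in>S. (b / of_int N) *s cvec (z b)) \<in>
      vec.span (cvec ` {x. \<forall>j. (\<Sum>i\<in>UNIV. x $ i * m i j) = 0})"
    using z by (intro vec.span_sum vec.span_scale vec.span_base imageI)
  ultimately show ?thesis by simp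
qed

lemma cvec_simps [simp]:
  "cvec (x + y) = cvec x + cvec y" "cvec (x - y) = cvec x - cvec y" "cvec (- x) = - cvec x"
  "cvec 0 = 0" "cvec x = cvec y \<longleftrightarrow> x = y"
  by (auto simp: cvec_def vec_eq_iff)

lemma cvec_eq_0 [simp]: "cvec x = 0 \<longleftrightarrow> x = 0"
  using cvec_simps(5)[of x 0] by simp

lemma vec_axis_expansion: "v = (\<Sum>j\<in>UNIV. (v $ j) *s axis j (1 :: 'a::semiring_1))"
  by (simp add: vec_eq_iff axis_def if_distrib[where f = "\<lambda>t. _ * t"] cong: if_cong)

lemma cvec_axis: "cvec (axis j 1) = axis j 1"
  by (simp add: cvec_def vec_eq_iff axis_def)


section \<open>Non-negative unit forms\<close>

text \<open>A quadratic form \<open>q(x) = B(x, x)\<close> with an integral bilinear form \<open>B\<close> has integral coefficients. It is a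
  unit form exactly if \<open>q(e\<^sub>i) = 1\<close> for the standard basis vectors.\<close>

locale nonneg_unit_form =
  fixes q :: "int^'n::finite \<Rightarrow> int" and B :: "int^'n \<Rightarrow> int^'n \<Rightarrow> int"
    and \<rho> :: "complex^'n \<Rightarrow> complex^'n"
  assumes nonneg: "0 \<le> q x" and adm: "admissible_choice q B \<rho>" and unit: "q (axis i 1) = 1"
begin

lemmas B_add = Defs.B_add[OF nonneg adm]
lemmas q_eq_B = Defs.q_eq_B[OF nonneg adm]
lemmas polar_eq_B = Defs.polar_eq_B[OF nonneg adm]
lemmas B_scale = Defs.B_scale[OF nonneg adm]
lemmas null_root_polar = Defs.null_root_polar[OF nonneg adm]
lemmas polar_commute = Defs.polar_commute[OF nonneg adm]
lemmas q_add_null = Defs.q_add_null[OF nonneg adm]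
lemmas polarC_commute = Defs.polarC_commute[OF nonneg adm]
lemmas polarC_cvec = Defs.polarC_cvec[OF nonneg adm]
lemmas polarC_null = Defs.polarC_null[OF nonneg adm]
lemmas null_roots_add = Defs.null_roots_add[OF nonneg adm]
lemmas null_roots_diff = Defs.null_roots_diff[OF nonneg adm]
lemmas real_roots_add_null = Defs.real_roots_add_null[OF nonneg adm]
lemmas zero_null_root [simp] = Defs.zero_null_root[OF nonneg adm]

lemma B_simps:
  "B (x + y) z = B x z + B y z" "B z (x + y) = B z x + B z y"
  "B (x - y) z = B x z - B y z" "B z (x - y) = B z x - B z y"
  "B (- x) z = - B x z" "B z (- x) = - B z x" "B 0 z = 0" "B z 0 = 0"
proof -
  have 0: "B 0 z = 0" "B z 0 = 0" for z using B_add(1)[of 0 0 z] B_add(2)[of z 0 0] by simp_all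
  have m: "B (- x) z = - B x z" "B z (- x) = - B z x" for x z
    using B_add(1)[of "- x" x z] B_add(2)[of z "- x" x] 0 by simp_all
  show "B (x - y) z = B x z - B y z" "B z (x - y) = B z x - B z y"
    using B_add(1)[of x "- y" z] B_add(2)[of z x "- y"] m by simp_all
  show "B (- x) z = - B x z" "B z (- x) = - B z x" "B 0 z = 0" "B z 0 = 0"
    "B (x + y) z = B x z + B y z" "B z (x + y) = B z x + B z y"
    using 0 m B_add by simp_all
qed

lemma polar_simps:
  "polar q (x + y) z = polar q x z + polar q y z" "polar q z (x + y) = polar q z x + polar q z y"
  "polar q (x - y) z = polar q x z - polar q y z" "polar q z (x - y) = polar q z x - polar q z y"
  "polar q (- x) z = - polar q x z" "polar q z (- x) = - polar q z x"
  "polar q 0 z = 0" "polar q z 0 = 0"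
  by (simp_all add: polar_eq_B B_simps)

lemma polar_self: "polar q x x = 2 * q x"
  by (simp add: polar_eq_B q_eq_B)

lemma q_zero [simp]: "q 0 = 0" and q_minus [simp]: "q (- x) = q x"
  by (simp_all add: q_eq_B B_simps)

lemma q_add: "q (x + y) = q x + q y + polar q x y"
  by (simp add: polar_def)

lemma q_diff: "q (x - y) = q x + q y - polar q x y"
  by (simp add: q_eq_B polar_eq_B B_simps)

lemma polarC_simps:
  "polarC q (v + v') w = polarC q v w + polarC q v' w"
  "polarC q w (v + v') = polarC q w v + polarC q w v'"
  "polarC q (v - v') w = polarC q v w - polarC q v' w"
  "polarC q w (v - v') = polarC q w v - polarC q w v'"
  "polarC q (- v) w = - polarC q v w" "polarC q w (- v) = - polarC q w v"
  "polarC q (c *s v) w = c * polarC q v w" "polarC q w (c *s v) = c * polarC q w v"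
  "polarC q 0 w = 0" "polarC q w 0 = 0"
  by (simp_all add: polarC_def algebra_simps sum.distrib sum_distrib_left sum_subtractf sum_negf)

lemma polarC_sum:
  "polarC q (\<Sum>i\<in>I. f i) w = (\<Sum>i\<in>I. polarC q (f i) w)"
  "polarC q w (\<Sum>i\<in>I. f i) = (\<Sum>i\<in>I. polarC q w (f i))"
  by (induction I rule: infinite_finite_induct) (simp_all add: polarC_simps)

lemma null_roots_minus [simp]: "- \<sigma> \<in> null_roots q \<longleftrightarrow> \<sigma> \<in> null_roots q"
  and real_roots_minus [simp]: "- \<alpha> \<in> real_roots q \<longleftrightarrow> \<alpha> \<in> real_roots q"
  by (simp_all add: null_roots_def real_roots_def)

lemma real_not_null: "\<alpha> \<in> real_roots q \<Longrightarrow> \<alpha> \<notin> null_roots q"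
  by (simp add: null_roots_def real_roots_def)

lemma rad_eq_null_roots: "rad q = null_roots q"
proof -
  have "x \<in> null_roots q" if "x \<in> rad q" for x
    using that polar_self[of x] by (simp add: rad_def null_roots_def)
  then show ?thesis using null_root_polar by (auto simp: rad_def)
qed

lemma cvec_null_in_radC: "\<sigma> \<in> null_roots q \<Longrightarrow> cvec \<sigma> \<in> radC q"
  by (simp add: radC_def rad_eq_null_roots vec.span_base)

lemma radC_subspace: "vec.subspace (radC q)"
  by (simp add: radC_def)

text \<open>The radical of the complexified form is the complexified radical, because the kernel of an
  integer matrix is spanned by integer vectors.\<close>

lemma mem_radC_iff: "v \<in> radC q \<longleftrightarrow> (\<forall>w. polarC q v w = 0)"
proof
  have "radC q \<subseteq> {v. \<forall>w. polarC q v w = 0}"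
    unfolding radC_def rad_eq_null_roots
    by (rule vec.span_minimal) (auto simp: vec.subspace_def polarC_simps polarC_null)
  then show "v \<in> radC q \<Longrightarrow> \<forall>w. polarC q v w = 0" by blast
next
  assume v: "\<forall>w. polarC q v w = 0"
  let ?m = "\<lambda>i j. polar q (axis i 1) (axis j 1)"
  have "axis j (1::complex) $ k = (if k = j then 1 else 0)" for j k :: 'n
    by (simp add: axis_def)
  then have "polarC q v (axis j 1) = (\<Sum>i\<in>UNIV. \<Sum>k\<in>UNIV. if k = j then v $ i * of_int (?m i k) else 0)" for j
    unfolding polarC_def by (intro sum.cong refl) auto
  then have "polarC q v (axis j 1) = (\<Sum>i\<in>UNIV. v $ i * of_int (?m i j))" for j
    by simp
  then have "v \<in> vec.span (cvec ` {x. \<forall>j. (\<Sum>i\<in>UNIV. x $ i * ?m i j) = 0})"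
    using v by (intro integer_kernel_spans_complex_kernel) simp
  also have "{x. \<forall>j. (\<Sum>i\<in>UNIV. x $ i * ?m i j) = 0} \<subseteq> rad q"
  proof
    fix x assume x: "x \<in> {x. \<forall>j. (\<Sum>i\<in>UNIV. x $ i * ?m i j) = 0}"
    have "complex_of_int (polar q x y) = 0" for y
    proof -
      have "complex_of_int (polar q x y) =
          (\<Sum>j\<in>UNIV. of_int (y $ j) * of_int (\<Sum>i\<in>UNIV. x $ i * ?m i j))"
        unfolding polarC_cvec[of x y, symmetric] polarC_def cvec_def
        by (subst sum.swap) (simp add: sum_distrib_left mult_ac)
      also have "\<dots> = 0" using x by (simp del: of_int_sum of_int_mult)
      finally show ?thesis .
    qed
    then show "x \<in> rad q" by (simp add: rad_def)
  qed
  then have "vec.span (cvec ` {x. \<forall>j. (\<Sum>i\<in>UNIV. x $ i * ?m i j) = 0}) \<subseteq> radC q"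
    unfolding radC_def by (intro vec.span_mono image_mono)
  finally show "v \<in> radC q" .
qed

lemma radC_closed:
  "0 \<in> radC q" "u \<in> radC q \<Longrightarrow> v \<in> radC q \<Longrightarrow> u + v \<in> radC q"
  "u \<in> radC q \<Longrightarrow> v \<in> radC q \<Longrightarrow> u - v \<in> radC q" "u \<in> radC q \<Longrightarrow> c *s u \<in> radC q"
  "u \<in> radC q \<Longrightarrow> - u \<in> radC q"
  by (simp_all add: mem_radC_iff polarC_simps)

lemma \<rho>_linear: "Vector_Spaces.linear (*s) (*s) \<rho>" and \<rho>_in_radC: "\<rho> v \<in> radC q"
  and \<rho>_radC: "v \<in> radC q \<Longrightarrow> \<rho> v = v"
  using adm by (auto simp: admissible_choice_def)

lemma \<rho>_simps [simp]:
  "\<rho> (v + w) = \<rho> v + \<rho> w" "\<rho> (v - w) = \<rho> v - \<rho> w" "\<rho> (- v) = - \<rho> v" "\<rho> (c *s v) = c *s \<rho> v"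
  "\<rho> 0 = 0" "\<rho> (\<rho> v) = \<rho> v"
  by (simp_all add: \<rho>_radC[OF \<rho>_in_radC] vec.linear_add[OF \<rho>_linear]
      vec.linear_diff[OF \<rho>_linear] vec.linear_neg[OF \<rho>_linear] vec.linear_scale[OF \<rho>_linear]
      vec.linear_0[OF \<rho>_linear])

lemma \<rho>_null: "\<sigma> \<in> null_roots q \<Longrightarrow> \<rho> (cvec \<sigma>) = cvec \<sigma>"
  by (simp add: \<rho>_radC cvec_null_in_radC)

lemma polarC_\<rho> [simp]: "polarC q (\<rho> v) w = 0" "polarC q w (\<rho> v) = 0"
proof -
  show "polarC q (\<rho> v) w = 0" for w using \<rho>_in_radC[of v] by (simp add: mem_radC_iff)
  then show "polarC q w (\<rho> v) = 0" by (simp add: polarC_commute)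
qed

text \<open>The form induces an injection of \<open>\<complex>\<^sup>n / rad\<^sub>\<complex> q\<close> into its dual, so the coordinates of
  \<open>v - \<rho> v\<close> are linear combinations of the values \<open>q(e\<^sub>j, v)\<close>. This is what makes elements of \<open>H\<close>
  separate degrees.\<close>

lemma complement_from_polar: "\<exists>a. \<forall>v. v - \<rho> v = (\<Sum>j\<in>UNIV. polarC q (axis j 1) v *s a j)"
proof -
  define f where "f v = (\<chi> j. polarC q (axis j 1) v)" for v
  have f: "Vector_Spaces.linear (*s) (*s) f"
    by unfold_locales (simp_all add: f_def vec_eq_iff polarC_simps vec.scale_right_distrib vec.scale_left_distrib)
  have r: "v \<in> radC q" if "f v = 0" for v
  proof -
    have "polarC q (axis j 1) v = 0" for j using that by (simp add: f_def vec_eq_iff)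
    then have "polarC q w v = 0" for w
      by (subst vec_axis_expansion[of w]) (simp add: polarC_sum polarC_simps)
    then show ?thesis by (simp add: mem_radC_iff polarC_commute)
  qed
  let ?K = "{v. \<rho> v = 0}"
  have K: "vec.subspace ?K" by (auto simp: vec.subspace_def)
  have "inj_on f ?K"
  proof (rule inj_onI)
    fix v w assume vw: "v \<in> ?K" "w \<in> ?K" "f v = f w"
    then have "f (v - w) = 0" by (simp add: vec.linear_diff[OF f])
    then show "v = w" using \<rho>_radC[OF r] vw by fastforce
  qed
  from vec.linear_exists_left_inverse_on[OF f K this]
  obtain g where g: "Vector_Spaces.linear (*s) (*s) g" "\<forall>v\<in>?K. g (f v) = v" by blast
  have "v - \<rho> v = (\<Sum>j\<in>UNIV. polarC q (axis j 1) v *s g (axis j 1))" for v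
  proof -
    have "v - \<rho> v = g (f (v - \<rho> v))" using g(2) by simp
    also have "f (v - \<rho> v) = f v" by (simp add: f_def vec_eq_iff polarC_simps)
    also have "g (f v) = g (\<Sum>j\<in>UNIV. (f v $ j) *s axis j 1)" by (simp flip: vec_axis_expansion)
    also have "\<dots> = (\<Sum>j\<in>UNIV. polarC q (axis j 1) v *s g (axis j 1))"
      by (simp add: vec.linear_sum[OF g(1)] vec.linear_scale[OF g(1)] f_def)
    finally show ?thesis .
  qed
  then show ?thesis by (intro exI[of _ "\<lambda>j. g (axis j 1)"] allI)
qed

end

section \<open>A space of coordinates\<close>

text \<open>The kernel of the projection \<open>\<rho>\<close> is a complement of \<open>rad\<^sub>\<complex> q\<close>, so each coset in \<open>\<complex>\<^sup>n / rad\<^sub>\<complex> q\<close> contains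
  exactly one vector of this kernel. Replacing the cosets of non-zero degree by these vectors turns
  \<open>E(q)\<close> into a space of triples of functions, in which sums and linear maps can be computed
  entry by entry.\<close>

datatype ('n::finite) coord =
  Coord (ec: "int^'n \<Rightarrow> complex") (pc: "int^'n \<Rightarrow> complex^'n") (df: "complex^'n \<Rightarrow> complex")

instantiation coord :: (finite) ab_group_add
begin

definition "0 = Coord (\<lambda>_. 0) (\<lambda>_. 0) (\<lambda>_. 0)"
definition "x + y = Coord (\<lambda>\<alpha>. ec x \<alpha> + ec y \<alpha>) (\<lambda>\<alpha>. pc x \<alpha> + pc y \<alpha>) (\<lambda>v. df x v + df y v)"
definition "- x = Coord (\<lambda>\<alpha>. - ec x \<alpha>) (\<lambda>\<alpha>. - pc x \<alpha>) (\<lambda>v. - df x v)"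
definition "x - y = Coord (\<lambda>\<alpha>. ec x \<alpha> - ec y \<alpha>) (\<lambda>\<alpha>. pc x \<alpha> - pc y \<alpha>) (\<lambda>v. df x v - df y v)"

instance
  by standard
    (simp_all add: zero_coord_def plus_coord_def uminus_coord_def minus_coord_def algebra_simps)

end

definition cscale :: "complex \<Rightarrow> 'n::finite coord \<Rightarrow> 'n coord" where
  "cscale c x = Coord (\<lambda>\<alpha>. c * ec x \<alpha>) (\<lambda>\<alpha>. c *s pc x \<alpha>) (\<lambda>v. c * df x v)"

lemma coord_sel [simp]:
  "ec 0 = (\<lambda>_. 0)" "pc 0 = (\<lambda>_. 0)" "df 0 = (\<lambda>_. 0)"
  "ec (x + y) = (\<lambda>\<alpha>. ec x \<alpha> + ec y \<alpha>)" "pc (x + y) = (\<lambda>\<alpha>. pc x \<alpha> + pc y \<alpha>)"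
  "df (x + y) = (\<lambda>v. df x v + df y v)"
  "ec (- x) = (\<lambda>\<alpha>. - ec x \<alpha>)" "pc (- x) = (\<lambda>\<alpha>. - pc x \<alpha>)" "df (- x) = (\<lambda>v. - df x v)"
  "ec (x - y) = (\<lambda>\<alpha>. ec x \<alpha> - ec y \<alpha>)" "pc (x - y) = (\<lambda>\<alpha>. pc x \<alpha> - pc y \<alpha>)"
  "df (x - y) = (\<lambda>v. df x v - df y v)"
  "ec (cscale c x) = (\<lambda>\<alpha>. c * ec x \<alpha>)" "pc (cscale c x) = (\<lambda>\<alpha>. c *s pc x \<alpha>)"
  "df (cscale c x) = (\<lambda>v. c * df x v)"
  by (simp_all add: zero_coord_def plus_coord_def uminus_coord_def minus_coord_def cscale_def)

lemma coord_sum_sel: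
  "ec (sum g A) \<alpha> = (\<Sum>i\<in>A. ec (g i) \<alpha>)" "pc (sum g A) \<alpha> = (\<Sum>i\<in>A. pc (g i) \<alpha>)"
  "df (sum g A) v = (\<Sum>i\<in>A. df (g i) v)"
  by (induction A rule: infinite_finite_induct) simp_all

lemma coord_eqI:
  "(\<And>\<alpha>. ec x \<alpha> = ec y \<alpha>) \<Longrightarrow> (\<And>\<alpha>. pc x \<alpha> = pc y \<alpha>) \<Longrightarrow> (\<And>v. df x v = df y v) \<Longrightarrow> x = y"
  by (cases x; cases y) auto

definition supp :: "'n::finite coord \<Rightarrow> (int^'n) set" where
  "supp x = {\<alpha>. ec x \<alpha> \<noteq> 0 \<or> pc x \<alpha> \<noteq> 0}"

lemma cscale_simps [simp]:
  "cscale c (x + y) = cscale c x + cscale c y" "cscale c (cscale d x) = cscale (c * d) x"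
  "cscale 0 x = 0" "cscale 1 x = x" "cscale c 0 = 0"
  by (auto intro!: coord_eqI simp: algebra_simps vec.scale_right_distrib)

lemma cscale_add_left: "cscale (c + d) x = cscale c x + cscale d x"
  by (auto intro!: coord_eqI simp: algebra_simps vec.scale_left_distrib)

lemma eps_simps:
  "eps B x y * eps B x y = 1" "eps B x y = 1 \<or> eps B x y = -1" "eps B x y \<noteq> 0"
  by (auto simp: eps_def power_int_minus_left)

context nonneg_unit_form
begin

abbreviation dual_rad where "dual_rad \<equiv> functionals (radC q) (+) (*s)"

text \<open>The parity sign, in the form in which it compares \<open>\<epsilon>(\<beta>, \<alpha>)\<close> with \<open>\<epsilon>(\<alpha>, \<beta>)\<close>.\<close>

definition sg :: "int \<Rightarrow> complex" where "sg k = (if even k then 1 else -1)"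

lemma eps_bilinear:
  "eps B (x + y) z = eps B x z * eps B y z" "eps B z (x + y) = eps B z x * eps B z y"
  "eps B (x - y) z = eps B x z * eps B y z" "eps B z (x - y) = eps B z x * eps B z y"
  "eps B (- x) z = eps B x z" "eps B z (- x) = eps B z x" "eps B 0 z = 1" "eps B z 0 = 1"
  by (auto simp: eps_def B_simps power_int_add power_int_diff power_int_minus power_int_minus_left)

lemma eps_swap: "eps B \<beta> \<alpha> = eps B \<alpha> \<beta> * sg (polar q \<alpha> \<beta>)"
proof -
  have "eps B \<beta> \<alpha> = sg (B \<beta> \<alpha>)" "eps B \<alpha> \<beta> = sg (B \<alpha> \<beta>)"
    by (auto simp: eps_def sg_def power_int_minus_left)
  then show ?thesis by (auto simp: polar_eq_B sg_def)
qed

lemma eps_self: "eps B \<alpha> \<alpha> = sg (q \<alpha>)"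
  by (auto simp: eps_def sg_def power_int_minus_left q_eq_B)

lemma eps_null_commute:
  "\<sigma> \<in> null_roots q \<Longrightarrow> eps B x \<sigma> = eps B \<sigma> x"
  using eps_swap[of x \<sigma>] by (simp add: null_root_polar sg_def)

text \<open>The normal form of a representative in degree \<open>\<sigma>\<close>. It does not change the pairing with other
  vectors, since \<open>rad\<^sub>\<complex> q\<close> pairs to zero with everything.\<close>

definition C :: "int^'n \<Rightarrow> complex^'n \<Rightarrow> complex^'n" where
  "C \<sigma> v = (if \<sigma> = 0 then v else v - \<rho> v)"

lemma C_simps [simp]:
  "C \<sigma> (v + w) = C \<sigma> v + C \<sigma> w" "C \<sigma> (v - w) = C \<sigma> v - C \<sigma> w" "C \<sigma> (- v) = - C \<sigma> v"
  "C \<sigma> (c *s v) = c *s C \<sigma> v" "C \<sigma> 0 = 0" "C \<sigma> (C \<sigma> v) = C \<sigma> v"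
  "polarC q (C \<sigma> v) w = polarC q v w" "polarC q w (C \<sigma> v) = polarC q w v"
  by (simp_all add: C_def polarC_simps algebra_simps vec.scale_right_diff_distrib)

lemma C_sum: "C \<sigma> (sum f A) = (\<Sum>i\<in>A. C \<sigma> (f i))"
  by (induction A rule: infinite_finite_induct) simp_all

lemma C_null: "\<tau> \<in> null_roots q \<Longrightarrow> \<sigma> \<noteq> 0 \<or> \<tau> = 0 \<Longrightarrow> C \<sigma> (cvec \<tau>) = 0"
  by (auto simp: C_def \<rho>_null)

text \<open>The coordinates of the elements of \<open>E(q)\<close>.\<close>

definition V :: "'n coord set" where
  "V = {x. finite (supp x) \<and> (\<forall>\<alpha>. ec x \<alpha> \<noteq> 0 \<longrightarrow> \<alpha> \<in> real_roots q) \<and>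
     (\<forall>\<sigma>. pc x \<sigma> \<noteq> 0 \<longrightarrow> \<sigma> \<in> null_roots q) \<and> (\<forall>\<sigma>. C \<sigma> (pc x \<sigma>) = pc x \<sigma>) \<and> df x \<in> dual_rad}"

lemma V_D:
  assumes "x \<in> V"
  shows "finite (supp x)" "\<alpha> \<notin> real_roots q \<Longrightarrow> ec x \<alpha> = 0" "\<alpha> \<notin> null_roots q \<Longrightarrow> pc x \<alpha> = 0"
    "C \<alpha> (pc x \<alpha>) = pc x \<alpha>" "df x \<in> dual_rad"
  using assms by (auto simp: V_def)

lemma supp_add: "supp (x + y) \<subseteq> supp x \<union> supp y" and supp_cscale: "supp (cscale c x) \<subseteq> supp x"
  and supp_minus [simp]: "supp (- x) = supp x" and supp_zero [simp]: "supp 0 = {}"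
  by (auto simp: supp_def)

lemma dual_rad_closed:
  "(\<lambda>_. 0) \<in> dual_rad" "f \<in> dual_rad \<Longrightarrow> g \<in> dual_rad \<Longrightarrow> (\<lambda>v. f v + g v) \<in> dual_rad"
  "f \<in> dual_rad \<Longrightarrow> (\<lambda>v. c * f v) \<in> dual_rad"
  by (auto simp: functionals_def algebra_simps)

lemma dual_rad_apply:
  assumes "f \<in> dual_rad"
  shows "f (\<rho> v + \<rho> w) = f (\<rho> v) + f (\<rho> w)" "f (\<rho> v - \<rho> w) = f (\<rho> v) - f (\<rho> w)"
    "f (c *s \<rho> v) = c * f (\<rho> v)" "f 0 = 0" "f (- \<rho> v) = - f (\<rho> v)"
proof -
  show a: "f (\<rho> v + \<rho> w) = f (\<rho> v) + f (\<rho> w)" and s: "f (c *s \<rho> v) = c * f (\<rho> v)" for v w c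
    using assms \<rho>_in_radC by (auto simp: functionals_def)
  show "f 0 = 0" using s[of 0 0] by simp
  show m: "f (- \<rho> v) = - f (\<rho> v)" for v using s[of "-1" v] by simp
  show "f (\<rho> v - \<rho> w) = f (\<rho> v) - f (\<rho> w)" using a[of v "- w"] m by simp
qed

lemma V_closed [simp]:
  "0 \<in> V" "x \<in> V \<Longrightarrow> y \<in> V \<Longrightarrow> x + y \<in> V" "x \<in> V \<Longrightarrow> cscale c x \<in> V"
proof -
  show "0 \<in> V" by (auto simp: V_def dual_rad_closed)
  show "x + y \<in> V" if "x \<in> V" "y \<in> V"
    using that finite_subset[OF supp_add[of x y]] by (auto simp: V_def dual_rad_closed) (metis add.right_neutral)+
  show "cscale c x \<in> V" if "x \<in> V"
    using that finite_subset[OF supp_cscale[of c x]] by (auto simp: V_def dual_rad_closed)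
qed

lemma V_minus [simp]: "x \<in> V \<Longrightarrow> - x \<in> V" "x \<in> V \<Longrightarrow> y \<in> V \<Longrightarrow> x - y \<in> V"
proof -
  have m: "- x = cscale (-1) x" for x :: "'n coord" by (auto intro!: coord_eqI)
  show 1: "x \<in> V \<Longrightarrow> - x \<in> V" for x unfolding m by (rule V_closed)
  show "x \<in> V \<Longrightarrow> y \<in> V \<Longrightarrow> x - y \<in> V" using V_closed(2)[of x "- y"] 1 by simp
qed

lemma V_sum: "(\<And>i. i \<in> A \<Longrightarrow> g i \<in> V) \<Longrightarrow> sum g A \<in> V"
  by (induction A rule: infinite_finite_induct) auto

text \<open>The generators \<open>c e\<^sub>\<alpha>\<close>, \<open>\<pi>\<^sub>\<sigma>(v)\<close> and \<open>\<xi>\<close>.\<close>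

definition ce :: "complex \<Rightarrow> int^'n \<Rightarrow> 'n coord" where
  "ce c \<alpha> = Coord (\<lambda>\<beta>. if \<beta> = \<alpha> then c else 0) (\<lambda>_. 0) (\<lambda>_. 0)"

definition cp :: "int^'n \<Rightarrow> complex^'n \<Rightarrow> 'n coord" where
  "cp \<sigma> v = Coord (\<lambda>_. 0) (\<lambda>\<tau>. if \<tau> = \<sigma> then C \<sigma> v else 0) (\<lambda>_. 0)"

definition cd :: "(complex^'n \<Rightarrow> complex) \<Rightarrow> 'n coord" where
  "cd f = Coord (\<lambda>_. 0) (\<lambda>_. 0) f"

lemma gens_sel [simp]:
  "ec (ce c \<alpha>) \<beta> = (if \<beta> = \<alpha> then c else 0)" "pc (ce c \<alpha>) = (\<lambda>_. 0)" "df (ce c \<alpha>) = (\<lambda>_. 0)"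
  "ec (cp \<sigma> v) = (\<lambda>_. 0)" "pc (cp \<sigma> v) \<tau> = (if \<tau> = \<sigma> then C \<sigma> v else 0)" "df (cp \<sigma> v) = (\<lambda>_. 0)"
  "ec (cd f) = (\<lambda>_. 0)" "pc (cd f) = (\<lambda>_. 0)" "df (cd f) = f"
  by (simp_all add: ce_def cp_def cd_def)

lemma supp_gens: "supp (ce c \<alpha>) \<subseteq> {\<alpha>}" "supp (cp \<sigma> v) \<subseteq> {\<sigma>}" "supp (cd f) = {}"
  by (auto simp: supp_def)

lemma gens_in_V [simp]:
  "\<alpha> \<in> real_roots q \<Longrightarrow> ce c \<alpha> \<in> V" "\<sigma> \<in> null_roots q \<Longrightarrow> cp \<sigma> v \<in> V" "f \<in> dual_rad \<Longrightarrow> cd f \<in> V"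
  using finite_subset[OF supp_gens(1)] finite_subset[OF supp_gens(2)] supp_gens(3)
  by (auto simp: V_def dual_rad_closed)

lemma gens_linear:
  "ce c \<alpha> + ce d \<alpha> = ce (c + d) \<alpha>" "cp \<sigma> v + cp \<sigma> w = cp \<sigma> (v + w)"
  "cd f + cd g = cd (\<lambda>v. f v + g v)"
  "cscale k (ce c \<alpha>) = ce (k * c) \<alpha>" "cscale k (cp \<sigma> v) = cp \<sigma> (k *s v)"
  "- ce c \<alpha> = ce (- c) \<alpha>" "- cp \<sigma> v = cp \<sigma> (- v)"
  by (auto intro!: coord_eqI)

lemma gens_zero [simp]: "ce 0 \<alpha> = 0" "cp \<sigma> 0 = 0" "cd (\<lambda>_. 0) = 0"
  by (auto intro!: coord_eqI)

lemma cp_null: "\<tau> \<in> null_roots q \<Longrightarrow> \<sigma> \<noteq> 0 \<or> \<tau> = 0 \<Longrightarrow> cp \<sigma> (c *s cvec \<tau>) = 0"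
  by (auto intro!: coord_eqI simp: C_null)

text \<open>The component of degree \<open>\<alpha>\<close>, without the functional that belongs to degree \<open>0\<close>.\<close>

definition hpart :: "'n coord \<Rightarrow> int^'n \<Rightarrow> 'n coord" where
  "hpart x \<alpha> = (if \<alpha> \<in> real_roots q then ce (ec x \<alpha>) \<alpha> else cp \<alpha> (pc x \<alpha>))"

lemma V_decompose:
  assumes x: "x \<in> V" and S: "finite S" "supp x \<subseteq> S"
  shows "x = (\<Sum>\<alpha>\<in>S. hpart x \<alpha>) + cd (df x)"
proof (rule coord_eqI)
  show "ec x \<gamma> = ec ((\<Sum>\<alpha>\<in>S. hpart x \<alpha>) + cd (df x)) \<gamma>" for \<gamma>
  proof -
    have "ec (hpart x \<alpha>) \<gamma> = (if \<gamma> = \<alpha> then ec x \<gamma> else 0)" for \<alpha>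
      using V_D(2)[OF x] by (auto simp: hpart_def)
    moreover have "ec x \<gamma> = 0" if "\<gamma> \<notin> S" using that S by (auto simp: supp_def)
    ultimately show ?thesis using S(1) by (auto simp: coord_sum_sel)
  qed
  show "pc x \<gamma> = pc ((\<Sum>\<alpha>\<in>S. hpart x \<alpha>) + cd (df x)) \<gamma>" for \<gamma>
  proof -
    have "pc (hpart x \<alpha>) \<gamma> = (if \<gamma> = \<alpha> then pc x \<gamma> else 0)" for \<alpha>
      using V_D(3,4)[OF x] real_not_null by (auto simp: hpart_def)
    moreover have "pc x \<gamma> = 0" if "\<gamma> \<notin> S" using that S by (auto simp: supp_def)
    ultimately show ?thesis using S(1) by (auto simp: coord_sum_sel)
  qed
  have "df (hpart x \<alpha>) v = 0" for \<alpha> v by (simp add: hpart_def)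
  then show "df x v = df ((\<Sum>\<alpha>\<in>S. hpart x \<alpha>) + cd (df x)) v" for v by (simp add: coord_sum_sel)
qed

lemma supp_in_roots: "x \<in> V \<Longrightarrow> supp x \<subseteq> roots q"
  by (auto simp: V_def supp_def roots_def)

lemma V_induct [consumes 1, case_names ce cp cd add]:
  assumes x: "x \<in> V"
    and e: "\<And>c \<alpha>. \<alpha> \<in> real_roots q \<Longrightarrow> P (ce c \<alpha>)"
    and p: "\<And>\<sigma> v. \<sigma> \<in> null_roots q \<Longrightarrow> P (cp \<sigma> v)"
    and d: "\<And>f. f \<in> dual_rad \<Longrightarrow> P (cd f)"
    and a: "\<And>x y. x \<in> V \<Longrightarrow> y \<in> V \<Longrightarrow> P x \<Longrightarrow> P y \<Longrightarrow> P (x + y)"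
  shows "P x"
proof -
  have "P (\<Sum>\<alpha>\<in>S. hpart x \<alpha>) \<and> (\<Sum>\<alpha>\<in>S. hpart x \<alpha>) \<in> V" if "finite S" "S \<subseteq> roots q" for S
    using that
  proof (induction S)
    case empty
    then show ?case using p[of 0 0] by simp
  next
    case (insert \<alpha> S)
    then have "P (hpart x \<alpha>)" "hpart x \<alpha> \<in> V" using e p by (auto simp: hpart_def roots_def)
    then show ?case using insert a by auto
  qed
  from this[OF V_D(1)[OF x] supp_in_roots[OF x]]
  have "P ((\<Sum>\<alpha>\<in>supp x. hpart x \<alpha>) + cd (df x))"
    using a d V_D(5)[OF x] by simp
  then show ?thesis using V_decompose[OF x V_D(1)[OF x]] by simp
qed

definition gens :: "'n coord set" where
  "gens = {ce c \<alpha> | c \<alpha>. \<alpha> \<in> real_roots q} \<union> {cp \<sigma> v | \<sigma> v. \<sigma> \<in> null_roots q} \<union> cd ` dual_rad"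

lemma V_gens_induct [consumes 1, case_names gen add]:
  assumes "x \<in> V" "\<And>x. x \<in> gens \<Longrightarrow> P x"
    "\<And>x y. x \<in> V \<Longrightarrow> y \<in> V \<Longrightarrow> P x \<Longrightarrow> P y \<Longrightarrow> P (x + y)"
  shows "P x"
  using assms(1)
proof (induction x rule: V_induct)
  case (ce c \<alpha>)
  then show ?case by (intro assms(2)) (auto simp: gens_def)
next
  case (cp \<sigma> v)
  then show ?case by (intro assms(2)) (auto simp: gens_def)
next
  case (cd f)
  then show ?case by (intro assms(2)) (auto simp: gens_def)
qed (rule assms(3))

text \<open>This reduces multilinear identities to generators.\<close>

lemma V_trilinear_induct [consumes 3, case_names gen add1 add2 add3]:
  assumes x: "x \<in> V" and y: "y \<in> V" and z: "z \<in> V"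
    and g: "\<And>x y z. x \<in> gens \<Longrightarrow> y \<in> gens \<Longrightarrow> z \<in> gens \<Longrightarrow> P x y z"
    and a: "\<And>x x' y z. x \<in> V \<Longrightarrow> x' \<in> V \<Longrightarrow> y \<in> V \<Longrightarrow> z \<in> V \<Longrightarrow> P x y z \<Longrightarrow> P x' y z \<Longrightarrow> P (x + x') y z"
      "\<And>x y y' z. x \<in> V \<Longrightarrow> y \<in> V \<Longrightarrow> y' \<in> V \<Longrightarrow> z \<in> V \<Longrightarrow> P x y z \<Longrightarrow> P x y' z \<Longrightarrow> P x (y + y') z"
      "\<And>x y z z'. x \<in> V \<Longrightarrow> y \<in> V \<Longrightarrow> z \<in> V \<Longrightarrow> z' \<in> V \<Longrightarrow> P x y z \<Longrightarrow> P x y z' \<Longrightarrow> P x y (z + z')"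
  shows "P x y z"
proof -
  have V: "w \<in> V" if "w \<in> gens" for w using that by (auto simp: gens_def)
  have 1: "P x y z" if "x \<in> gens" "y \<in> gens" "z \<in> V" for x y z
    using that(3) by (induction z rule: V_gens_induct) (use that V g a(3) in auto)
  have 2: "P x y z" if "x \<in> gens" "y \<in> V" "z \<in> V" for x y z
    using that(2) by (induction y rule: V_gens_induct) (use that V 1 a(2) in auto)
  show ?thesis using x by (induction x rule: V_gens_induct) (use y z 2 a(1) in auto)
qed

section \<open>The bracket in coordinates\<close>

text \<open>What the components of \<open>x\<close> in degree \<open>\<alpha>\<close> and of \<open>y\<close> in degree \<open>\<beta>\<close> contribute to the coefficient of
  \<open>e\<^sub>\<gamma>\<close> for \<open>\<gamma> = \<alpha> + \<beta>\<close>, by the rules for \<open>[e\<^sub>\<alpha>, e\<^sub>\<beta>]\<close>, \<open>[\<pi>\<^sub>\<alpha>(v), e\<^sub>\<beta>]\<close> and \<open>[e\<^sub>\<alpha>, \<pi>\<^sub>\<beta>(w)]\<close>. The last rule has the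
  sign \<open>\<epsilon>(\<beta>, \<alpha>)\<close>, which equals \<open>\<epsilon>(\<alpha>, \<beta>)\<close> because \<open>\<beta>\<close> is then a null root.\<close>

definition real_term :: "'n coord \<Rightarrow> 'n coord \<Rightarrow> int^'n \<Rightarrow> int^'n \<Rightarrow> complex" where
  "real_term x y \<alpha> \<beta> = eps B \<alpha> \<beta> * (ec x \<alpha> * ec y \<beta> + polarC q (pc x \<alpha>) (cvec \<beta>) * ec y \<beta>
     - polarC q (pc y \<beta>) (cvec \<alpha>) * ec x \<alpha>)"

text \<open>Both \<open>[\<pi>\<^sub>\<alpha>(v), \<pi>\<^sub>\<beta>(w)]\<close> and \<open>[e\<^sub>\<alpha>, e\<^sub>\<beta>]\<close>, if the latter has null degree, are multiples of \<open>\<pi>\<^sub>\<gamma>(\<alpha>)\<close> for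
  \<open>\<gamma> = \<alpha> + \<beta>\<close>. This is the factor.\<close>

definition null_term :: "'n coord \<Rightarrow> 'n coord \<Rightarrow> int^'n \<Rightarrow> int^'n \<Rightarrow> complex" where
  "null_term x y \<alpha> \<beta> = eps B \<alpha> \<beta> * (polarC q (pc x \<alpha>) (pc y \<beta>) + ec x \<alpha> * ec y \<beta>)"

text \<open>The first degrees are summed over a set \<open>S\<close> which may be larger than the support of \<open>x\<close>. The same \<open>S\<close>
  then serves \<open>x\<close>, \<open>x'\<close> and \<open>x + x'\<close>, and the bracket is seen to be additive.\<close>

definition brS :: "(int^'n) set \<Rightarrow> 'n coord \<Rightarrow> 'n coord \<Rightarrow> 'n coord" where
  "brS S x y = Coord
     (\<lambda>\<gamma>. if \<gamma> \<in> real_roots q then (\<Sum>\<alpha>\<in>S. real_term x y \<alpha> (\<gamma> - \<alpha>))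
         + df x (\<rho> (cvec \<gamma>)) * ec y \<gamma> - df y (\<rho> (cvec \<gamma>)) * ec x \<gamma> else 0)
     (\<lambda>\<gamma>. if \<gamma> \<in> null_roots q then C \<gamma> ((\<Sum>\<alpha>\<in>S. null_term x y \<alpha> (\<gamma> - \<alpha>) *s cvec \<alpha>)
         + df x (\<rho> (cvec \<gamma>)) *s pc y \<gamma> - df y (\<rho> (cvec \<gamma>)) *s pc x \<gamma>) else 0)
     (\<lambda>_. 0)"

definition br :: "'n coord \<Rightarrow> 'n coord \<Rightarrow> 'n coord" where
  "br x y = brS (supp x) x y"

lemma br_eq_brS:
  assumes "finite S" "supp x \<subseteq> S"
  shows "br x y = brS S x y"
proof -
  have z: "real_term x y \<alpha> \<beta> = 0" "null_term x y \<alpha> \<beta> = 0" if "\<alpha> \<notin> supp x" for \<alpha> \<beta>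
    using that by (simp_all add: supp_def real_term_def null_term_def polarC_simps)
  have "(\<Sum>\<alpha>\<in>supp x. real_term x y \<alpha> (\<gamma> - \<alpha>)) = (\<Sum>\<alpha>\<in>S. real_term x y \<alpha> (\<gamma> - \<alpha>))"
    "(\<Sum>\<alpha>\<in>supp x. null_term x y \<alpha> (\<gamma> - \<alpha>) *s cvec \<alpha>) = (\<Sum>\<alpha>\<in>S. null_term x y \<alpha> (\<gamma> - \<alpha>) *s cvec \<alpha>)" for \<gamma>
    using assms z by (auto intro!: sum.mono_neutral_left)
  then show ?thesis by (simp add: br_def brS_def cong: if_cong)
qed

lemma term_linear:
  "real_term (x + x') y \<alpha> \<beta> = real_term x y \<alpha> \<beta> + real_term x' y \<alpha> \<beta>" "real_term x (y + y') \<alpha> \<beta> = real_term x y \<alpha> \<beta> + real_term x y' \<alpha> \<beta>"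
  "real_term (cscale c x) y \<alpha> \<beta> = c * real_term x y \<alpha> \<beta>" "real_term x (cscale c y) \<alpha> \<beta> = c * real_term x y \<alpha> \<beta>"
  "null_term (x + x') y \<alpha> \<beta> = null_term x y \<alpha> \<beta> + null_term x' y \<alpha> \<beta>" "null_term x (y + y') \<alpha> \<beta> = null_term x y \<alpha> \<beta> + null_term x y' \<alpha> \<beta>"
  "null_term (cscale c x) y \<alpha> \<beta> = c * null_term x y \<alpha> \<beta>" "null_term x (cscale c y) \<alpha> \<beta> = c * null_term x y \<alpha> \<beta>"
  by (simp_all add: real_term_def null_term_def polarC_simps algebra_simps)

lemma brS_linear:
  "brS S (x + x') y = brS S x y + brS S x' y" "brS S x (y + y') = brS S x y + brS S x y'"
  "brS S (cscale c x) y = cscale c (brS S x y)" "brS S x (cscale c y) = cscale c (brS S x y)"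
  by (auto intro!: coord_eqI simp: brS_def term_linear sum.distrib algebra_simps C_sum vec.scale_left_distrib
      vec.scale_right_distrib sum_distrib_left vec.scale_sum_right vec.scale_right_diff_distrib)

lemma br_add:
  shows "x \<in> V \<Longrightarrow> x' \<in> V \<Longrightarrow> br (x + x') y = br x y + br x' y"
    and "br x (y + y') = br x y + br x y'"
proof -
  show "br (x + x') y = br x y + br x' y" if "x \<in> V" "x' \<in> V"
  proof -
    have f: "finite (supp x \<union> supp x')" using that V_D(1) by simp
    show ?thesis
      by (simp add: br_eq_brS[OF f supp_add] br_eq_brS[OF f Un_upper1] br_eq_brS[OF f Un_upper2] brS_linear)
  qed
qed (simp add: br_def brS_linear)

lemma br_cscale:
  assumes "x \<in> V"
  shows "br (cscale c x) y = cscale c (br x y)" "br x (cscale c y) = cscale c (br x y)"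
  by (simp_all add: br_eq_brS[OF V_D(1)[OF assms] supp_cscale] br_eq_brS[OF V_D(1)[OF assms] order_refl]
      brS_linear)

lemma br_zero [simp]: "br 0 y = 0" "br x 0 = 0"
  by (auto intro!: coord_eqI simp: br_def brS_def real_term_def null_term_def polarC_simps)

lemma diff_eq_iff: "\<gamma> - \<alpha> = \<beta> \<longleftrightarrow> \<gamma> = \<alpha> + (\<beta> :: int^'n)"
  by (auto simp: algebra_simps)

lemma br_gen_eq: "br (ce c \<alpha>) y = brS {\<alpha>} (ce c \<alpha>) y" "br (cp \<alpha> v) y = brS {\<alpha>} (cp \<alpha> v) y"
    "br (cd f) y = brS {} (cd f) y"
  by (auto intro!: br_eq_brS simp: supp_def split: if_splits)

lemma br_ce_ce:
  "br (ce c \<alpha>) (ce d \<beta>) = (if \<alpha> + \<beta> \<in> real_roots q then ce (eps B \<alpha> \<beta> * c * d) (\<alpha> + \<beta>)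
     else if \<alpha> + \<beta> \<in> null_roots q then cp (\<alpha> + \<beta>) ((eps B \<alpha> \<beta> * c * d) *s cvec \<alpha>) else 0)"
  by (rule coord_eqI)
    (auto simp: br_gen_eq brS_def real_term_def null_term_def polarC_simps diff_eq_iff real_not_null)

lemma br_cp_ce:
  assumes "\<sigma> \<in> null_roots q" "\<beta> \<in> real_roots q"
  shows "br (cp \<sigma> v) (ce c \<beta>) = ce (eps B \<sigma> \<beta> * polarC q v (cvec \<beta>) * c) (\<sigma> + \<beta>)"
    "br (ce c \<beta>) (cp \<sigma> v) = ce (- (eps B \<sigma> \<beta> * polarC q v (cvec \<beta>) * c)) (\<sigma> + \<beta>)"
proof -
  have "\<sigma> + \<beta> \<in> real_roots q" "\<beta> + \<sigma> \<in> real_roots q"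
    using assms real_roots_add_null[of \<sigma> \<beta>] by (simp_all add: add.commute[of \<sigma> \<beta>])
  then show "br (cp \<sigma> v) (ce c \<beta>) = ce (eps B \<sigma> \<beta> * polarC q v (cvec \<beta>) * c) (\<sigma> + \<beta>)"
    "br (ce c \<beta>) (cp \<sigma> v) = ce (- (eps B \<sigma> \<beta> * polarC q v (cvec \<beta>) * c)) (\<sigma> + \<beta>)"
    by (auto intro!: coord_eqI simp: br_gen_eq brS_def real_term_def null_term_def polarC_simps diff_eq_iff
        eps_null_commute[OF assms(1)] real_not_null)
qed

lemma br_cp_cp:
  assumes "\<sigma> \<in> null_roots q" "\<tau> \<in> null_roots q"
  shows "br (cp \<sigma> v) (cp \<tau> w) = cp (\<sigma> + \<tau>) ((eps B \<sigma> \<tau> * polarC q v w) *s cvec \<sigma>)"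
  using null_roots_add[OF assms]
  by (auto intro!: coord_eqI simp: br_gen_eq brS_def real_term_def null_term_def polarC_simps diff_eq_iff)

lemma br_cd_ce:
  assumes "\<beta> \<in> real_roots q"
  shows "br (cd f) (ce c \<beta>) = ce (f (\<rho> (cvec \<beta>)) * c) \<beta>"
    "br (ce c \<beta>) (cd f) = ce (- f (\<rho> (cvec \<beta>)) * c) \<beta>"
  using assms
  by (auto intro!: coord_eqI simp: br_gen_eq brS_def real_term_def null_term_def polarC_simps)

lemma br_cd_cp:
  assumes "\<tau> \<in> null_roots q"
  shows "br (cd f) (cp \<tau> v) = cp \<tau> (f (\<rho> (cvec \<tau>)) *s v)"
    "br (cp \<tau> v) (cd f) = cp \<tau> (- f (\<rho> (cvec \<tau>)) *s v)"
  using assms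
  by (auto intro!: coord_eqI simp: br_gen_eq brS_def real_term_def null_term_def polarC_simps)

lemma br_cd_cd: "br (cd f) (cd g) = 0"
  by (auto intro!: coord_eqI simp: br_gen_eq brS_def)

lemmas br_gens = br_ce_ce br_cp_ce br_cp_cp br_cd_ce br_cd_cp br_cd_cd

lemma br_in_V [simp]:
  assumes "x \<in> V" "y \<in> V"
  shows "br x y \<in> V"
  using assms(1)
proof (induction x rule: V_induct)
  case (ce c \<alpha>)
  show ?case using assms(2)
  proof (induction y rule: V_induct)
    case (cp \<sigma> v)
    then show ?case using ce real_roots_add_null[of \<sigma> \<alpha>] by (simp add: br_gens add.commute)
  qed (use ce in \<open>simp_all add: br_gens br_add\<close>)
next
  case (cp \<sigma> v)
  show ?case using assms(2)
  proof (induction y rule: V_induct)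
    case (ce c \<alpha>)
    then show ?case using cp real_roots_add_null[of \<sigma> \<alpha>] by (simp add: br_gens add.commute)
  qed (use cp in \<open>simp_all add: br_gens br_add null_roots_add\<close>)
next
  case (cd f)
  show ?case using assms(2)
    by (induction y rule: V_induct) (use cd in \<open>simp_all add: br_gens br_add\<close>)
qed (simp add: br_add)

section \<open>Antisymmetry and the grading\<close>

lemma real_roots_add_iff:
  assumes "\<alpha> \<in> real_roots q" "\<beta> \<in> real_roots q"
  shows "\<alpha> + \<beta> \<in> real_roots q \<longleftrightarrow> polar q \<alpha> \<beta> = -1" "\<alpha> + \<beta> \<in> null_roots q \<longleftrightarrow> polar q \<alpha> \<beta> = -2"
  using assms by (auto simp: real_roots_def null_roots_def q_add)

lemma real_polar_bounds:
  assumes "\<alpha> \<in> real_roots q" "\<beta> \<in> real_roots q"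
  shows "-2 \<le> polar q \<alpha> \<beta>" "polar q \<alpha> \<beta> \<le> 2"
  using assms nonneg[of "\<alpha> + \<beta>"] nonneg[of "\<alpha> - \<beta>"] by (auto simp: real_roots_def q_add q_diff)

lemma sg_simps [simp]: "sg 0 = 1" "sg 1 = -1" "sg (-1) = -1" "sg (-2) = 1" "sg 2 = 1" "sg (- x) = sg x"
  by (simp_all add: sg_def)

text \<open>If \<open>\<alpha> + \<beta>\<close> is real then \<open>q(\<alpha>, \<beta>) = -1\<close>, and exchanging \<open>\<alpha>\<close> and \<open>\<beta>\<close> changes the sign \<open>\<epsilon>\<close>. If \<open>\<alpha> + \<beta>\<close> is
  null then the sign stays the same, but \<open>\<pi>(\<alpha>) + \<pi>(\<beta>) = \<pi>(\<alpha> + \<beta>) = 0\<close> in degree \<open>\<alpha> + \<beta>\<close>.\<close>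

lemma br_antisym:
  assumes "x \<in> V" "y \<in> V"
  shows "br y x = - br x y"
  using assms(1)
proof (induction x rule: V_induct)
  case e: (ce c \<alpha>)
  show ?case using assms(2)
  proof (induction y rule: V_induct)
    case (ce d \<beta>)
    show ?case
    proof (cases "\<alpha> + \<beta> \<in> null_roots q")
      case True
      then have p: "polar q \<alpha> \<beta> = -2" using real_roots_add_iff e ce by blast
      then have "cp (\<alpha> + \<beta>) (k *s cvec \<beta>) = cp (\<alpha> + \<beta>) (- k *s cvec \<alpha>)" for k
        using cp_null[OF True, of "\<alpha> + \<beta>" k] gens_linear(2)[of "\<alpha> + \<beta>" "k *s cvec \<alpha>" "k *s cvec \<beta>"]
        by (auto simp: vec.scale_right_distrib gens_linear(7)[symmetric] eq_neg_iff_add_eq_0 add.commute)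
      moreover have "\<alpha> + \<beta> \<notin> real_roots q" using True real_not_null by blast
      ultimately show ?thesis using True p
        by (simp add: br_ce_ce add.commute[of \<beta> \<alpha>] eps_swap[of \<beta> \<alpha>] gens_linear mult_ac)
    next
      case False
      then show ?thesis using real_roots_add_iff(1) e ce
        by (auto simp: br_ce_ce add.commute[of \<beta> \<alpha>] eps_swap[of \<beta> \<alpha>] gens_linear mult_ac)
    qed
  qed (use e in \<open>simp_all add: br_gens br_add gens_linear\<close>)
next
  case p: (cp \<sigma> v)
  show ?case using assms(2)
  proof (induction y rule: V_induct)
    case (cp \<tau> w)
    have "cp (\<sigma> + \<tau>) (k *s cvec \<tau>) = cp (\<sigma> + \<tau>) (- k *s cvec \<sigma>)" for k
      using cp_null[OF null_roots_add[OF p cp], of "\<sigma> + \<tau>" k]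
        gens_linear(2)[of "\<sigma> + \<tau>" "k *s cvec \<sigma>" "k *s cvec \<tau>"]
      by (auto simp: vec.scale_right_distrib gens_linear(7)[symmetric] eq_neg_iff_add_eq_0 add.commute)
    then show ?case using p cp
      by (simp add: br_gens gens_linear add.commute[of \<tau> \<sigma>] eps_null_commute[of \<sigma> \<tau>] polarC_commute[of w v])
  qed (use p in \<open>simp_all add: br_gens br_add gens_linear\<close>)
next
  case d: (cd f)
  show ?case using assms(2)
    by (induction y rule: V_induct) (use d in \<open>simp_all add: br_gens br_add gens_linear\<close>)
qed (simp add: br_add assms)

text \<open>Functionals on the radical belong to degree \<open>0\<close>, as in \<open>E\<^sub>0 = \<complex>\<^sup>n \<oplus> (rad\<^sub>\<complex> q)\<^sup>*\<close>.\<close>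

definition homog :: "int^'n \<Rightarrow> 'n coord \<Rightarrow> bool" where
  "homog \<alpha> x \<longleftrightarrow> x \<in> V \<and> supp x \<subseteq> {\<alpha>} \<and> (\<alpha> \<noteq> 0 \<longrightarrow> df x = (\<lambda>_. 0))"

lemma homog_D:
  assumes "homog \<alpha> x"
  shows "x \<in> V" "supp x \<subseteq> {\<alpha>}" "\<beta> \<noteq> \<alpha> \<Longrightarrow> ec x \<beta> = 0" "\<beta> \<noteq> \<alpha> \<Longrightarrow> pc x \<beta> = 0"
    "\<alpha> \<noteq> 0 \<Longrightarrow> df x = (\<lambda>_. 0)"
  using assms by (auto simp: homog_def supp_def)

lemma homog_gens:
  "\<alpha> \<in> real_roots q \<Longrightarrow> homog \<alpha> (ce c \<alpha>)" "\<sigma> \<in> null_roots q \<Longrightarrow> homog \<sigma> (cp \<sigma> v)" "f \<in> dual_rad \<Longrightarrow> homog 0 (cd f)"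
  using supp_gens by (auto simp: homog_def)

lemma homog_induct [consumes 1, case_names homog add]:
  assumes "x \<in> V" "\<And>\<alpha> x. \<alpha> \<in> roots q \<Longrightarrow> homog \<alpha> x \<Longrightarrow> P x"
    "\<And>x y. x \<in> V \<Longrightarrow> y \<in> V \<Longrightarrow> P x \<Longrightarrow> P y \<Longrightarrow> P (x + y)"
  shows "P x"
  using assms(1)
proof (induction x rule: V_induct)
  case (ce c \<alpha>)
  show ?case by (rule assms(2)[of \<alpha>]) (use ce homog_gens in \<open>auto simp: roots_def\<close>)
next
  case (cp \<sigma> v)
  show ?case by (rule assms(2)[of \<sigma>]) (use cp homog_gens in \<open>auto simp: roots_def\<close>)
next
  case (cd f)
  show ?case by (rule assms(2)[of 0]) (use cd homog_gens in \<open>auto simp: roots_def\<close>)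
qed (rule assms(3))

lemma br_homog:
  assumes x: "homog \<alpha> x" and y: "homog \<beta> y"
  shows "homog (\<alpha> + \<beta>) (br x y)"
proof -
  note xy = homog_D[OF x] homog_D[OF y]
  have e: "br x y = brS {\<alpha>} x y" by (rule br_eq_brS) (use xy in auto)
  have k: "real_term x y \<alpha> (\<gamma> - \<alpha>) = 0" "null_term x y \<alpha> (\<gamma> - \<alpha>) = 0" if "\<gamma> \<noteq> \<alpha> + \<beta>" for \<gamma>
  proof -
    have "\<gamma> - \<alpha> \<noteq> \<beta>" using that by auto
    then show "real_term x y \<alpha> (\<gamma> - \<alpha>) = 0" "null_term x y \<alpha> (\<gamma> - \<alpha>) = 0"
      using xy(8,9) by (simp_all add: real_term_def null_term_def polarC_simps)
  qed
  have d: "df x v * ec y \<gamma> = 0" "df x v *s C \<gamma> (pc y \<gamma>) = 0"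
    "df y v * ec x \<gamma> = 0" "df y v *s C \<gamma> (pc x \<gamma>) = 0"
    if "\<gamma> \<noteq> \<alpha> + \<beta>" for \<gamma> v
  proof -
    have "df x v = 0 \<or> \<gamma> \<noteq> \<beta>" using that xy(5) by (cases "\<alpha> = 0") auto
    then show "df x v * ec y \<gamma> = 0" "df x v *s C \<gamma> (pc y \<gamma>) = 0" using xy(8,9)[of \<gamma>] by auto
    have "df y v = 0 \<or> \<gamma> \<noteq> \<alpha>" using that xy(10) by (cases "\<beta> = 0") auto
    then show "df y v * ec x \<gamma> = 0" "df y v *s C \<gamma> (pc x \<gamma>) = 0" using xy(3,4)[of \<gamma>] by auto
  qed
  have "supp (br x y) \<subseteq> {\<alpha> + \<beta>}"
  proof -
    have "ec (br x y) \<gamma> = 0" "pc (br x y) \<gamma> = 0" if "\<gamma> \<noteq> \<alpha> + \<beta>" for \<gamma>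
      unfolding e brS_def by (simp_all only: coord.sel C_simps) (simp_all add: d[OF that] k[OF that])
    then show ?thesis by (auto simp: supp_def)
  qed
  moreover have "df (br x y) = (\<lambda>_. 0)" by (simp add: br_def brS_def)
  ultimately show ?thesis using br_in_V xy by (simp add: homog_def)
qed

section \<open>The action of degree zero\<close>

text \<open>The value of the functional \<open>\<alpha>\<close> on an element of \<open>H\<close>.\<close>

definition ev :: "int^'n \<Rightarrow> 'n coord \<Rightarrow> complex" where
  "ev \<alpha> h = polarC q (pc h 0) (cvec \<alpha>) + df h (\<rho> (cvec \<alpha>))"

lemma zero_not_real: "0 \<notin> real_roots q"
  using real_not_null zero_null_root by blast

lemma br_degree_zero:
  assumes h: "homog 0 h" and x: "x \<in> V"
  shows "ec (br h x) \<gamma> = ev \<gamma> h * ec x \<gamma>" "pc (br h x) \<gamma> = ev \<gamma> h *s pc x \<gamma>" "df (br h x) v = 0"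
proof -
  note h' = homog_D[OF h]
  have e: "br h x = brS {0} h x" by (rule br_eq_brS) (use h' in auto)
  have e0: "ec h = (\<lambda>_. 0)"
    using h'(3) V_D(2)[OF h'(1) zero_not_real] by (auto simp: fun_eq_iff) metis
  show "ec (br h x) \<gamma> = ev \<gamma> h * ec x \<gamma>"
    using V_D(2)[OF x, of \<gamma>] by (simp add: e brS_def real_term_def e0 eps_bilinear ev_def algebra_simps)
  have p: "df x (\<rho> (cvec \<gamma>)) *s pc h \<gamma> = 0"
    using h'(4)[of \<gamma>] dual_rad_apply(4)[OF V_D(5)[OF x]] by (cases "\<gamma> = 0") auto
  show "pc (br h x) \<gamma> = ev \<gamma> h *s pc x \<gamma>"
    unfolding e brS_def coord.sel p using V_D(3)[OF x, of \<gamma>] V_D(4)[OF x, of \<gamma>]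
    by (cases "\<gamma> \<in> null_roots q") (simp_all add: ev_def polarC_null null_term_def)
  show "df (br h x) v = 0" by (simp add: br_def brS_def)
qed

lemma ev_zero [simp]: "h \<in> V \<Longrightarrow> ev 0 h = 0"
  using dual_rad_apply(4)[OF V_D(5)] by (simp add: ev_def polarC_simps)

lemma br_H_homog:
  assumes h: "homog 0 h" and x: "homog \<alpha> x"
  shows "br h x = cscale (ev \<alpha> h) x"
proof (rule coord_eqI)
  note e = br_degree_zero[OF h homog_D(1)[OF x]]
  show "ec (br h x) \<gamma> = ec (cscale (ev \<alpha> h) x) \<gamma>" "pc (br h x) \<gamma> = pc (cscale (ev \<alpha> h) x) \<gamma>" for \<gamma>
    using homog_D(3,4)[OF x, of \<gamma>] by (cases "\<gamma> = \<alpha>"; simp add: e)+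
  show "df (br h x) v = df (cscale (ev \<alpha> h) x) v" for v
    using homog_D(5)[OF x] homog_D(1)[OF h] by (cases "\<alpha> = 0") (simp_all add: e)
qed

lemma cscale_uminus: "- x = cscale (-1) x"
  by (auto intro!: coord_eqI)

lemma br_cd_homog:
  assumes x: "homog \<alpha> x" and f: "f \<in> dual_rad"
  shows "br (cd f) x = cscale (f (\<rho> (cvec \<alpha>))) x" "br x (cd f) = cscale (- f (\<rho> (cvec \<alpha>))) x"
proof -
  show 1: "br (cd f) x = cscale (f (\<rho> (cvec \<alpha>))) x"
    using br_H_homog[OF homog_gens(3)[OF f] x] by (simp add: ev_def polarC_simps)
  show "br x (cd f) = cscale (- f (\<rho> (cvec \<alpha>))) x"
    using br_antisym[OF gens_in_V(3)[OF f] homog_D(1)[OF x]] by (simp add: 1 cscale_uminus)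
qed

section \<open>The Jacobi identity\<close>

text \<open>The Jacobiator of the bracket.\<close>

definition jac where "jac x y z = br (br x y) z + br (br y z) x + br (br z x) y"

lemma jac_rotate: "jac x y z = jac y z x"
  by (simp add: jac_def add_ac)

lemma jac_add: "x \<in> V \<Longrightarrow> x' \<in> V \<Longrightarrow> y \<in> V \<Longrightarrow> z \<in> V \<Longrightarrow> jac (x + x') y z = jac x y z + jac x' y z"
  by (simp add: jac_def br_add add_ac)

text \<open>If \<open>\<alpha> + \<beta>\<close> is null then it pairs to zero with \<open>\<gamma>\<close>, hence \<open>q(\<alpha> + \<beta> + \<gamma>) = q(\<gamma>) = 1\<close> and only the first
  case can occur.\<close>

lemma br_eee:
  fixes x y z :: complex
  assumes "\<alpha> \<in> real_roots q" "\<beta> \<in> real_roots q" "\<gamma> \<in> real_roots q"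
  defines "k \<equiv> eps B \<alpha> \<beta> * eps B \<alpha> \<gamma> * eps B \<beta> \<gamma> * x * y * z" and "s \<equiv> \<alpha> + \<beta> + \<gamma>"
  shows "br (br (ce x \<alpha>) (ce y \<beta>)) (ce z \<gamma>) =
    (if q s = 1 then ce (k * (if polar q \<alpha> \<beta> = -1 then 1
        else if polar q \<alpha> \<beta> = -2 then of_int (polar q \<alpha> \<gamma>) else 0)) s
     else if q s = 0 \<and> polar q \<alpha> \<beta> = -1 then cp s (k *s cvec (\<alpha> + \<beta>)) else 0)"
proof -
  consider "polar q \<alpha> \<beta> = -1" | "polar q \<alpha> \<beta> = -2" | "polar q \<alpha> \<beta> \<noteq> -1" "polar q \<alpha> \<beta> \<noteq> -2" by blast
  then show ?thesis
  proof cases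
    case 1
    then have "\<alpha> + \<beta> \<in> real_roots q" using real_roots_add_iff assms by blast
    then show ?thesis using 1
      by (simp add: br_ce_ce s_def k_def real_roots_def null_roots_def eps_bilinear mult_ac)
  next
    case 2
    then have n: "\<alpha> + \<beta> \<in> null_roots q" using real_roots_add_iff assms by blast
    then have s: "q s = 1" using q_add_null(1)[OF n, of \<gamma>] assms(3) by (simp add: s_def real_roots_def)
    show ?thesis using 2 n s br_cp_ce(1)[OF n assms(3)]
      by (simp add: br_ce_ce real_not_null polarC_simps polarC_cvec eps_bilinear k_def mult_ac)
        (auto simp: s_def real_not_null real_roots_def null_roots_def)
  next
    case 3
    then show ?thesis using real_roots_add_iff[OF assms(1,2)] by (simp add: br_ce_ce)
  qed
qed

text \<open>For \<open>a = q(\<alpha>, \<beta>)\<close>, \<open>b = q(\<beta>, \<gamma>)\<close> and \<open>c = q(\<gamma>, \<alpha>)\<close> this is the sum of the coefficients of the three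
  iterated brackets of \<open>e\<^sub>\<alpha>\<close>, \<open>e\<^sub>\<beta>\<close>, \<open>e\<^sub>\<gamma>\<close>, up to a common factor, when \<open>\<alpha> + \<beta> + \<gamma>\<close> is a real root:
  \<open>q(\<alpha> + \<beta> + \<gamma>) = 3 + a + b + c = 1\<close>.\<close>

lemma jacobi_integer_identity:
  fixes a b c :: int
  assumes "-2 \<le> a" "a \<le> 2" "-2 \<le> b" "b \<le> 2" "-2 \<le> c" "c \<le> 2" "a + b + c = -2"
  shows "(if a = -1 then 1 else if a = -2 then of_int c else 0)
    + sg a * sg c * (if b = -1 then 1 else if b = -2 then of_int a else 0)
    + sg c * sg b * (if c = -1 then 1 else if c = -2 then of_int b else 0) = 0"
proof -
  have "a \<in> {-2, -1, 0, 1, 2}" "b \<in> {-2, -1, 0, 1, 2}" "c = -2 - a - b" using assms by auto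
  then show ?thesis using assms(5,6) by (auto simp: sg_def)
qed

text \<open>If \<open>s = \<alpha> + \<beta> + \<gamma>\<close> is null then all three pairings are \<open>-1\<close>, and the three iterated brackets have the
  same sign and add up to a multiple of \<open>\<pi>\<^sub>s(s) = 0\<close>.\<close>

lemma jac_eee:
  assumes r: "\<alpha> \<in> real_roots q" "\<beta> \<in> real_roots q" "\<gamma> \<in> real_roots q"
  shows "jac (ce x \<alpha>) (ce y \<beta>) (ce z \<gamma>) = 0"
proof -
  define a b c where "a = polar q \<alpha> \<beta>" and "b = polar q \<beta> \<gamma>" and "c = polar q \<gamma> \<alpha>"
  define s where "s = \<alpha> + \<beta> + \<gamma>"
  define k where "k = eps B \<alpha> \<beta> * eps B \<alpha> \<gamma> * eps B \<beta> \<gamma> * x * y * z"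
  have comm: "polar q \<beta> \<alpha> = a" "polar q \<gamma> \<beta> = b" "polar q \<alpha> \<gamma> = c"
    by (simp_all add: a_def b_def c_def polar_commute)
  have qs: "q s = 3 + a + b + c"
    using r by (simp add: s_def q_add polar_simps comm a_def b_def real_roots_def)
  have s: "\<beta> + \<gamma> + \<alpha> = s" "\<gamma> + \<alpha> + \<beta> = s" by (simp_all add: s_def add_ac)
  have k2: "eps B \<beta> \<gamma> * eps B \<beta> \<alpha> * eps B \<gamma> \<alpha> * y * z * x = k * (sg a * sg c)"
    using eps_swap[of \<beta> \<alpha>] eps_swap[of \<gamma> \<alpha>] by (simp add: k_def comm a_def[symmetric] mult_ac)
  have k3: "eps B \<gamma> \<alpha> * eps B \<gamma> \<beta> * eps B \<alpha> \<beta> * z * x * y = k * (sg c * sg b)"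
    using eps_swap[of \<gamma> \<alpha>] eps_swap[of \<gamma> \<beta>] by (simp add: k_def comm b_def[symmetric] mult_ac)
  note e = br_eee[OF r(1,2,3), where x = x and y = y and z = z, folded s_def k_def a_def, unfolded comm]
    br_eee[OF r(2,3,1), where x = y and y = z and z = x, unfolded s k2 comm, folded b_def]
    br_eee[OF r(3,1,2), where x = z and y = x and z = y, unfolded s k3 comm, folded c_def]
  have bounds: "-2 \<le> a" "a \<le> 2" "-2 \<le> b" "b \<le> 2" "-2 \<le> c" "c \<le> 2"
    using real_polar_bounds r by (auto simp: a_def b_def c_def)
  consider "q s = 1" | "q s = 0" | "q s \<noteq> 0" "q s \<noteq> 1" by blast
  then show ?thesis
  proof cases
    case 1
    then have "a + b + c = -2" using qs by simp
    note id = jacobi_integer_identity[OF bounds this]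
    have split: "ce (k * n1) s + ce (k * (sg a * sg c) * n2) s + ce (k * (sg c * sg b) * n3) s
      = ce (k * (n1 + sg a * sg c * n2 + sg c * sg b * n3)) s" for n1 n2 n3
      by (simp add: gens_linear algebra_simps)
    show ?thesis
      unfolding jac_def e by (simp only: 1 refl if_True split id mult_zero_right gens_zero)
  next
    case 2
    then have sum: "a + b + c = -3" using qs by simp
    \<comment> \<open>If \<open>\<beta>\<close> and \<open>\<gamma>\<close> had the pairing \<open>-2\<close> then their sum would be null and pair to zero with \<open>\<alpha>\<close>.\<close>
    have no_null: "polar q \<beta> \<gamma> \<noteq> -2"
      if "\<alpha> \<in> real_roots q" "\<beta> \<in> real_roots q" "\<gamma> \<in> real_roots q" "q (\<alpha> + \<beta> + \<gamma>) = 0" for \<alpha> \<beta> \<gamma>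
    proof
      assume "polar q \<beta> \<gamma> = -2"
      then have "\<beta> + \<gamma> \<in> null_roots q" using real_roots_add_iff(2) that by blast
      then have "q (\<alpha> + \<beta> + \<gamma>) = q \<alpha>" using q_add_null(2)[of "\<beta> + \<gamma>" \<alpha>] by (simp add: add.assoc)
      then show False using that by (simp add: real_roots_def)
    qed
    have "a \<noteq> -2" "b \<noteq> -2" "c \<noteq> -2"
      using no_null[OF r(3,1,2)] no_null[OF r] no_null[OF r(2,3,1)] 2 s by (simp_all add: a_def b_def c_def s_def)
    then have abc: "a = -1" "b = -1" "c = -1" using sum bounds by linarith+
    have "s \<in> null_roots q" using 2 by (simp add: null_roots_def)
    then have "cp s ((2 * k) *s cvec s) = 0" by (intro cp_null) auto
    moreover have "k *s cvec (\<alpha> + \<beta>) + k *s cvec (\<beta> + \<gamma>) + k *s cvec (\<gamma> + \<alpha>) = (2 * k) *s cvec s"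
      by (simp add: s_def vec_eq_iff algebra_simps)
    ultimately have "cp s (k *s cvec (\<alpha> + \<beta>)) + cp s (k *s cvec (\<beta> + \<gamma>)) + cp s (k *s cvec (\<gamma> + \<alpha>)) = 0"
      by (simp only: gens_linear)
    moreover have "jac (ce x \<alpha>) (ce y \<beta>) (ce z \<gamma>)
        = cp s (k *s cvec (\<alpha> + \<beta>)) + cp s (k *s cvec (\<beta> + \<gamma>)) + cp s (k *s cvec (\<gamma> + \<alpha>))"
      unfolding jac_def e abc 2 by (simp del: cvec_simps)
    ultimately show ?thesis by simp
  next
    case 3
    then show ?thesis unfolding jac_def e by (simp only: if_False simp_thms add_0_right)
  qed
qed

text \<open>If \<open>\<alpha> + \<beta>\<close> is null then \<open>q(v, \<beta>) = - q(v, \<alpha>)\<close>, and the three terms add up to a multiple of \<open>\<pi>\<^sub>s(s) = 0\<close> for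
  \<open>s = \<sigma> + \<alpha> + \<beta>\<close>.\<close>

lemma jac_pee:
  assumes n: "\<sigma> \<in> null_roots q" and r: "\<alpha> \<in> real_roots q" "\<beta> \<in> real_roots q"
  shows "jac (cp \<sigma> v) (ce x \<alpha>) (ce y \<beta>) = 0"
proof -
  have rs: "\<sigma> + \<alpha> \<in> real_roots q" "\<sigma> + \<beta> \<in> real_roots q"
    using n r real_roots_add_null[of \<sigma>] by (simp_all add: add.commute[of \<sigma>])
  have s: "\<sigma> + \<alpha> + \<beta> = \<sigma> + (\<alpha> + \<beta>)" "\<sigma> + \<beta> + \<alpha> = \<sigma> + (\<alpha> + \<beta>)" by (simp_all add: add_ac)
  have i: "\<sigma> + (\<alpha> + \<beta>) \<in> real_roots q \<longleftrightarrow> \<alpha> + \<beta> \<in> real_roots q"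
    "\<sigma> + (\<alpha> + \<beta>) \<in> null_roots q \<longleftrightarrow> \<alpha> + \<beta> \<in> null_roots q"
    using q_add_null[OF n, of "\<alpha> + \<beta>"] by (simp_all add: real_roots_def null_roots_def)
  have comm: "eps B \<alpha> \<sigma> = eps B \<sigma> \<alpha>" "eps B \<beta> \<sigma> = eps B \<sigma> \<beta>"
    using eps_null_commute[OF n] by auto
  define k where "k = eps B \<sigma> \<alpha> * eps B \<sigma> \<beta> * eps B \<alpha> \<beta> * x * y"
  have 1: "br (br (cp \<sigma> v) (ce x \<alpha>)) (ce y \<beta>) =
    (if \<alpha> + \<beta> \<in> real_roots q then ce (k * polarC q v (cvec \<alpha>)) (\<sigma> + (\<alpha> + \<beta>))
     else if \<alpha> + \<beta> \<in> null_roots q then cp (\<sigma> + (\<alpha> + \<beta>)) ((k * polarC q v (cvec \<alpha>)) *s cvec (\<sigma> + \<alpha>)) else 0)"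
    using br_cp_ce[OF n] r rs by (simp add: br_ce_ce s i k_def eps_bilinear mult_ac)
  have 3: "br (br (ce y \<beta>) (cp \<sigma> v)) (ce x \<alpha>) =
    (if \<alpha> + \<beta> \<in> real_roots q then ce (k * polarC q v (cvec \<beta>)) (\<sigma> + (\<alpha> + \<beta>))
     else if \<alpha> + \<beta> \<in> null_roots q then cp (\<sigma> + (\<alpha> + \<beta>)) ((- k * polarC q v (cvec \<beta>)) *s cvec (\<sigma> + \<beta>)) else 0)"
    using br_cp_ce[OF n] r rs real_roots_add_iff[OF r] eps_swap[of \<beta> \<alpha>]
    by (simp add: br_ce_ce s i k_def eps_bilinear mult_ac comm)
  have 2: "br (br (ce x \<alpha>) (ce y \<beta>)) (cp \<sigma> v) =
    (if \<alpha> + \<beta> \<in> real_roots q then ce (- k * polarC q v (cvec (\<alpha> + \<beta>))) (\<sigma> + (\<alpha> + \<beta>))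
     else if \<alpha> + \<beta> \<in> null_roots q then cp (\<sigma> + (\<alpha> + \<beta>)) ((k * polarC q v (cvec \<alpha>)) *s cvec (\<alpha> + \<beta>)) else 0)"
    using br_cp_ce[OF n] br_cp_cp[OF _ n]
    by (simp add: br_ce_ce k_def eps_bilinear mult_ac comm polarC_simps polarC_commute[of v] add.commute[of "\<alpha> + \<beta>" \<sigma>])
  show ?thesis
  proof (cases "\<alpha> + \<beta> \<in> null_roots q")
    case True
    then have m: "polarC q v (cvec \<beta>) = - polarC q v (cvec \<alpha>)"
      using polarC_null(2)[OF True, of v] by (simp add: polarC_simps add_eq_0_iff2 minus_unique)
    have "cp (\<sigma> + (\<alpha> + \<beta>)) ((2 * (k * polarC q v (cvec \<alpha>))) *s cvec (\<sigma> + (\<alpha> + \<beta>))) = 0"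
      using True i by (intro cp_null) auto
    moreover have "l *s cvec (\<sigma> + \<alpha>) + l *s cvec (\<alpha> + \<beta>) + l *s cvec (\<sigma> + \<beta>) = (2 * l) *s cvec (\<sigma> + (\<alpha> + \<beta>))" for l
      by (simp add: vec_eq_iff algebra_simps)
    ultimately show ?thesis using True real_not_null m
      by (auto simp: jac_def 1 2 3 gens_linear)
  next
    case False
    then show ?thesis by (simp add: jac_def 1 2 3 gens_linear polarC_simps algebra_simps)
  qed
qed

text \<open>A null root pairs to zero with everything, so \<open>\<pi>\<^sub>\<omega>(\<sigma>)\<close> commutes with all \<open>\<pi>\<^sub>\<tau>(v)\<close> and \<open>e\<^sub>\<beta>\<close>. In particular
  this holds for every bracket of two elements \<open>\<pi>\<close>.\<close>

lemma br_cp_of_null: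
  assumes "\<sigma> \<in> null_roots q" "\<omega> \<in> null_roots q"
  shows "\<tau> \<in> null_roots q \<Longrightarrow> br (cp \<omega> (k *s cvec \<sigma>)) (cp \<tau> v) = 0"
    and "\<beta> \<in> real_roots q \<Longrightarrow> br (cp \<omega> (k *s cvec \<sigma>)) (ce c \<beta>) = 0"
  using assms by (simp_all add: br_gens polarC_simps polarC_null)

lemma jac_ppe:
  assumes n: "\<sigma> \<in> null_roots q" "\<tau> \<in> null_roots q" and r: "\<beta> \<in> real_roots q"
  shows "jac (cp \<sigma> v) (cp \<tau> w) (ce c \<beta>) = 0"
proof -
  have rs: "\<sigma> + \<beta> \<in> real_roots q" "\<tau> + \<beta> \<in> real_roots q"
    using n r real_roots_add_null by (simp_all add: add.commute[of _ \<beta>])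
  have comm: "eps B \<tau> \<sigma> = eps B \<sigma> \<tau>" using eps_null_commute[OF n(1)] .
  have s: "\<tau> + (\<sigma> + \<beta>) = \<sigma> + (\<tau> + \<beta>)" by (simp add: add_ac)
  show ?thesis
    using n r rs
    by (simp add: jac_def br_cp_cp br_cp_of_null null_roots_add br_cp_ce gens_linear eps_bilinear comm s
        polarC_simps polarC_null mult_ac)
qed

lemma jac_ppp:
  assumes "\<sigma> \<in> null_roots q" "\<tau> \<in> null_roots q" "\<omega> \<in> null_roots q"
  shows "jac (cp \<sigma> u) (cp \<tau> v) (cp \<omega> w) = 0"
  unfolding jac_def br_cp_cp[OF assms(1,2)] br_cp_cp[OF assms(2,3)] br_cp_cp[OF assms(3,1)]
  using assms by (simp add: br_cp_of_null null_roots_add)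

text \<open>An element \<open>\<xi>\<close> acts on degree \<open>\<alpha>\<close> by the scalar \<open>\<xi>(\<rho>(\<alpha>))\<close>, which is additive in \<open>\<alpha>\<close>,
  so it acts as a derivation of every graded bracket.\<close>

lemma jac_d:
  assumes f: "f \<in> dual_rad" and y: "y \<in> V" and z: "z \<in> V"
  shows "jac (cd f) y z = 0"
  using y
proof (induction y rule: homog_induct)
  case y: (homog \<alpha> y)
  show ?case using z
  proof (induction z rule: homog_induct)
    case z: (homog \<beta> z)
    have V: "y \<in> V" "z \<in> V" "br y z \<in> V" using y z by (auto simp: homog_def)
    have "jac (cd f) y z = cscale (f (\<rho> (cvec \<alpha>))) (br y z)
        + cscale (- f (\<rho> (cvec (\<alpha> + \<beta>)))) (br y z) + cscale (- f (\<rho> (cvec \<beta>))) (br z y)"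
      by (simp only: jac_def br_cd_homog[OF y(2) f] br_cd_homog[OF z(2) f] br_cd_homog[OF br_homog[OF y(2) z(2)] f]
          br_cscale V)
    also have "br z y = cscale (-1) (br y z)"
      using br_antisym[OF V(1,2)] by (simp add: cscale_uminus)
    also have "cscale (f (\<rho> (cvec \<alpha>))) (br y z) + cscale (- f (\<rho> (cvec (\<alpha> + \<beta>)))) (br y z)
        + cscale (- f (\<rho> (cvec \<beta>))) (cscale (-1) (br y z)) = 0"
      by (simp add: dual_rad_apply[OF f] cscale_add_left[symmetric])
    finally show ?case .
  next
    case (add z z')
    then have "jac z (cd f) y = 0" "jac z' (cd f) y = 0" by (simp_all only: jac_rotate[of "cd f"] jac_rotate[of y])
    then have "jac (z + z') (cd f) y = 0" using y f add jac_add[of z z' "cd f" y] by (simp add: homog_def)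
    then show ?case by (simp only: jac_rotate[of "cd f"] jac_rotate[of y])
  qed
next
  case (add y y')
  then show ?case using z f jac_add[of y y' z "cd f"] by (simp add: jac_rotate[of "cd f"])
qed

lemma jac_add2:
  assumes "x \<in> V" "y \<in> V" "y' \<in> V" "z \<in> V"
  shows "jac x (y + y') z = jac x y z + jac x y' z" "jac x z (y + y') = jac x z y + jac x z y'"
proof -
  show "jac x (y + y') z = jac x y z + jac x y' z"
    using jac_add[of y y' z x] assms by (simp only: jac_rotate[of x])
  show "jac x z (y + y') = jac x z y + jac x z y'"
    using jac_add[of y y' x z] assms by (simp only: jac_rotate[of _ x z])
qed

lemma jac_zero:
  assumes "x \<in> V" "y \<in> V" "z \<in> V"
  shows "jac x y z = 0"
  using assms
proof (induction rule: V_trilinear_induct)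
  case (gen x y z)
  then have V: "x \<in> V" "y \<in> V" "z \<in> V" by (auto simp: gens_def)
  show ?case
  proof (cases "x \<in> cd ` dual_rad \<or> y \<in> cd ` dual_rad \<or> z \<in> cd ` dual_rad")
    case True
    then show ?thesis
      using V jac_d[of _ y z] jac_d[of _ z x] jac_d[of _ x y] jac_rotate[of x y z] jac_rotate[of z x y] by auto
  next
    case False
    have pee: "jac (ce a \<alpha>) (cp \<sigma> v) (ce b \<beta>) = 0" "jac (ce a \<alpha>) (ce b \<beta>) (cp \<sigma> v) = 0"
      if "\<sigma> \<in> null_roots q" "\<alpha> \<in> real_roots q" "\<beta> \<in> real_roots q" for \<sigma> \<alpha> \<beta> v a b
      using jac_pee[OF that(1,3,2), of v b a] jac_pee[OF that, of v a b]
      by (simp_all only: jac_rotate[of "ce a \<alpha>" "cp \<sigma> v"] jac_rotate[of "cp \<sigma> v" "ce a \<alpha>"])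
    have ppe: "jac (ce a \<alpha>) (cp \<sigma> v) (cp \<tau> w) = 0" "jac (cp \<sigma> v) (ce a \<alpha>) (cp \<tau> w) = 0"
      if "\<sigma> \<in> null_roots q" "\<tau> \<in> null_roots q" "\<alpha> \<in> real_roots q" for \<sigma> \<tau> \<alpha> v w a
      using jac_ppe[OF that, of v w a] jac_ppe[OF that(2,1,3), of w v a]
      by (simp_all only: jac_rotate[of "ce a \<alpha>" "cp \<sigma> v"] jac_rotate[of "cp \<tau> w" "cp \<sigma> v"])
    from gen False show ?thesis
      by (auto simp: gens_def jac_eee jac_pee pee jac_ppe ppe jac_ppp)
  qed
qed (simp_all add: jac_add jac_add2)

section \<open>The invariant form\<close>

text \<open>Degree \<open>\<alpha>\<close> is paired with degree \<open>-\<alpha>\<close>. Invariance and \<open>[e\<^sub>\<alpha>, e\<^bsub>-\<alpha>\<^esub>] = \<epsilon>(\<alpha>, -\<alpha>) \<pi>\<^sub>0(\<alpha>)\<close> force the value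
  \<open>\<epsilon>(\<alpha>, -\<alpha>) = -1\<close> on \<open>e\<^sub>\<alpha>, e\<^bsub>-\<alpha>\<^esub>\<close>. The value on \<open>\<xi>\<close> and \<open>\<pi>\<^sub>0(v)\<close> is \<open>\<xi>(\<rho>(v))\<close>.\<close>

definition bf :: "'n coord \<Rightarrow> 'n coord \<Rightarrow> complex" where
  "bf x y = (\<Sum>\<alpha>\<in>supp x. polarC q (pc x \<alpha>) (pc y (- \<alpha>)) - ec x \<alpha> * ec y (- \<alpha>))
     + df x (\<rho> (pc y 0)) + df y (\<rho> (pc x 0))"

lemma bf_superset:
  assumes "finite S" "supp x \<subseteq> S"
  shows "bf x y = (\<Sum>\<alpha>\<in>S. polarC q (pc x \<alpha>) (pc y (- \<alpha>)) - ec x \<alpha> * ec y (- \<alpha>))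
     + df x (\<rho> (pc y 0)) + df y (\<rho> (pc x 0))"
  unfolding bf_def using assms
  by (intro arg_cong2[where f = "(+)"] refl sum.mono_neutral_left)
    (auto simp: supp_def polarC_simps)

lemma bf_add:
  shows "x \<in> V \<Longrightarrow> x' \<in> V \<Longrightarrow> y \<in> V \<Longrightarrow> bf (x + x') y = bf x y + bf x' y"
    and "x \<in> V \<Longrightarrow> bf x (y + y') = bf x y + bf x y'"
proof -
  show "bf (x + x') y = bf x y + bf x' y" if x: "x \<in> V" "x' \<in> V" and y: "y \<in> V"
  proof -
    have f: "finite (supp x \<union> supp x')" using x V_D(1) by simp
    show ?thesis
      unfolding bf_superset[OF f supp_add] bf_superset[OF f Un_upper1] bf_superset[OF f Un_upper2]
      by (simp add: dual_rad_apply(1)[OF V_D(5)[OF y]] polarC_simps algebra_simps sum.distrib sum_subtractf)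
  qed
  show "bf x (y + y') = bf x y + bf x y'" if "x \<in> V"
    by (simp add: bf_def dual_rad_apply(1)[OF V_D(5)[OF that]] polarC_simps algebra_simps sum.distrib
        sum_subtractf)
qed

lemma bf_cscale:
  assumes x: "x \<in> V"
  shows "y \<in> V \<Longrightarrow> bf (cscale c x) y = c * bf x y" and "bf x (cscale c y) = c * bf x y"
proof -
  show "bf (cscale c x) y = c * bf x y" if "y \<in> V"
    unfolding bf_superset[OF V_D(1)[OF x] supp_cscale] bf_def[of x]
    by (simp add: dual_rad_apply(3)[OF V_D(5)[OF that]] polarC_simps algebra_simps sum_distrib_left
        sum_subtractf)
  show "bf x (cscale c y) = c * bf x y"
    by (simp add: bf_def dual_rad_apply(3)[OF V_D(5)[OF x]] polarC_simps algebra_simps sum_distrib_left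
        sum_subtractf)
qed

lemma bf_ce:
  assumes "x \<in> V" shows "bf x (ce c \<beta>) = - (ec x (- \<beta>) * c)"
proof -
  have i: "- \<alpha> = \<beta> \<longleftrightarrow> \<alpha> = - \<beta>" for \<alpha> by auto
  show ?thesis
    using V_D(1)[OF assms] dual_rad_apply(4)[OF V_D(5)[OF assms]]
    by (auto simp: bf_def polarC_simps i sum_negf supp_def if_distrib[where f = "\<lambda>t. _ * t"] cong: if_cong)
qed

lemma bf_cp:
  assumes "x \<in> V"
  shows "bf x (cp \<tau> w) = polarC q (pc x (- \<tau>)) w + (if \<tau> = 0 then df x (\<rho> w) else 0)"
proof -
  have i: "- \<alpha> = \<tau> \<longleftrightarrow> \<alpha> = - \<tau>" for \<alpha> by auto
  have "(\<Sum>\<alpha>\<in>supp x. polarC q (pc x \<alpha>) (pc (cp \<tau> w) (- \<alpha>)) - ec x \<alpha> * ec (cp \<tau> w) (- \<alpha>))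
      = (\<Sum>\<alpha>\<in>supp x. if \<alpha> = - \<tau> then polarC q (pc x (- \<tau>)) w else 0)"
    by (intro sum.cong refl) (auto simp: i polarC_simps)
  also have "\<dots> = polarC q (pc x (- \<tau>)) w"
    using V_D(1)[OF assms] by (auto simp: supp_def polarC_simps)
  finally show ?thesis
    using dual_rad_apply(4)[OF V_D(5)[OF assms]] by (simp add: bf_def C_def)
qed

lemma bf_cd:
  assumes "x \<in> V" "f \<in> dual_rad" shows "bf x (cd f) = f (\<rho> (pc x 0))"
  using dual_rad_apply(4)[OF V_D(5)[OF assms(1)]] by (simp add: bf_def polarC_simps)

lemma C_zero: "C 0 v = v"
  by (simp add: C_def)

lemma neg_sum_rotate: "\<alpha> = - (\<beta> + \<gamma>) \<longleftrightarrow> \<gamma> = - (\<alpha> + (\<beta> :: int^'n))"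
  by (simp only: eq_neg_iff_add_eq_0 add_ac)

lemma bf_zero [simp]: "bf 0 (ce c \<alpha>) = 0" "bf 0 (cp \<sigma> v) = 0" "f \<in> dual_rad \<Longrightarrow> bf 0 (cd f) = 0"
  by (simp_all add: bf_def dual_rad_apply)

lemma bf_gens:
  "\<alpha> \<in> real_roots q \<Longrightarrow> bf (ce c \<alpha>) (ce d \<beta>) = (if \<beta> = - \<alpha> then - (c * d) else 0)"
  "\<alpha> \<in> real_roots q \<Longrightarrow> bf (ce c \<alpha>) (cp \<tau> w) = 0"
  "\<alpha> \<in> real_roots q \<Longrightarrow> f \<in> dual_rad \<Longrightarrow> bf (ce c \<alpha>) (cd f) = 0"
  "\<sigma> \<in> null_roots q \<Longrightarrow> bf (cp \<sigma> v) (ce d \<beta>) = 0"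
  "\<sigma> \<in> null_roots q \<Longrightarrow> bf (cp \<sigma> v) (cp \<tau> w) = (if \<tau> = - \<sigma> then polarC q v w else 0)"
  "\<sigma> \<in> null_roots q \<Longrightarrow> f \<in> dual_rad \<Longrightarrow> bf (cp \<sigma> v) (cd f) = (if \<sigma> = 0 then f (\<rho> v) else 0)"
  "f \<in> dual_rad \<Longrightarrow> bf (cd f) (ce d \<beta>) = 0"
  "f \<in> dual_rad \<Longrightarrow> bf (cd f) (cp \<tau> w) = (if \<tau> = 0 then f (\<rho> w) else 0)"
  "f \<in> dual_rad \<Longrightarrow> g \<in> dual_rad \<Longrightarrow> bf (cd f) (cd g) = 0"
  by (auto simp: bf_ce bf_cp bf_cd polarC_simps dual_rad_apply C_zero)

lemma bf_sym:
  assumes "x \<in> V" "y \<in> V"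
  shows "bf y x = bf x y"
  using assms(1)
proof (induction x rule: V_induct)
  case e: (ce c \<alpha>)
  show ?case using assms(2)
    by (induction y rule: V_induct) (use e in \<open>auto simp: bf_gens bf_add\<close>)
next
  case p: (cp \<sigma> v)
  show ?case using assms(2)
    by (induction y rule: V_induct) (use p in \<open>auto simp: bf_gens bf_add polarC_commute\<close>)
next
  case d: (cd f)
  show ?case using assms(2)
    by (induction y rule: V_induct) (use d in \<open>auto simp: bf_gens bf_add\<close>)
qed (use assms in \<open>simp add: bf_add\<close>)

text \<open>For a symmetric form, invariance says that \<open>([x, y], z)\<close> does not change under cyclic rotation of
  \<open>x, y, z\<close>. In this formulation two of the three rotations of a triple imply the third.\<close>

definition cyclic :: "'n coord \<Rightarrow> 'n coord \<Rightarrow> 'n coord \<Rightarrow> bool" where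
  "cyclic x y z \<longleftrightarrow> bf (br x y) z = bf (br y z) x"

lemma cyclic_add:
  assumes "x \<in> V" "x' \<in> V" "y \<in> V" "z \<in> V"
  shows "cyclic x y z \<Longrightarrow> cyclic x' y z \<Longrightarrow> cyclic (x + x') y z"
    "cyclic y x z \<Longrightarrow> cyclic y x' z \<Longrightarrow> cyclic y (x + x') z"
    "cyclic y z x \<Longrightarrow> cyclic y z x' \<Longrightarrow> cyclic y z (x + x')"
  using assms by (simp_all add: cyclic_def br_add bf_add)

lemma cyclic_third: "cyclic x y z \<Longrightarrow> cyclic y z x \<Longrightarrow> cyclic z x y"
  by (simp add: cyclic_def)

text \<open>If \<open>\<alpha> + \<beta> + \<gamma> = 0\<close> then \<open>q(\<alpha>, \<beta>) = -1\<close>, and the signs \<open>\<epsilon>(\<alpha>, \<beta>)\<close> and \<open>\<epsilon>(\<beta>, \<gamma>)\<close> agree.\<close>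

lemma cyclic_eee:
  assumes r: "\<alpha> \<in> real_roots q" "\<beta> \<in> real_roots q" "\<gamma> \<in> real_roots q"
  shows "cyclic (ce x \<alpha>) (ce y \<beta>) (ce z \<gamma>)"
proof (cases "\<gamma> = - (\<alpha> + \<beta>)")
  case True
  then have ab: "\<alpha> + \<beta> \<in> real_roots q" using r(3) real_roots_minus[of "\<alpha> + \<beta>"] by simp
  then have "polar q \<alpha> \<beta> = -1" using real_roots_add_iff r by blast
  then have "eps B \<beta> \<gamma> = eps B \<alpha> \<beta>"
    using r(2) by (simp add: True eps_bilinear eps_self eps_swap[of \<beta> \<alpha>] real_roots_def)
  moreover have "\<beta> + \<gamma> = - \<alpha>" using True by simp
  ultimately show ?thesis using r ab
    by (simp add: cyclic_def br_ce_ce bf_gens True)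
next
  case False
  then have "\<alpha> \<noteq> - (\<beta> + \<gamma>)" using neg_sum_rotate by metis
  with False show ?thesis using r by (simp add: cyclic_def br_ce_ce bf_gens)
qed

lemma cyclic_eep:
  assumes r: "\<alpha> \<in> real_roots q" "\<beta> \<in> real_roots q" and n: "\<sigma> \<in> null_roots q"
  shows "cyclic (ce x \<alpha>) (ce y \<beta>) (cp \<sigma> v)" "cyclic (ce x \<alpha>) (cp \<sigma> v) (ce y \<beta>)"
proof -
  have rs: "\<sigma> + \<alpha> \<in> real_roots q" "\<sigma> + \<beta> \<in> real_roots q"
    using n r real_roots_add_null[of \<sigma>] by (simp_all add: add.commute[of \<sigma>])
  have "cyclic (ce x \<alpha>) (ce y \<beta>) (cp \<sigma> v) \<and> cyclic (ce x \<alpha>) (cp \<sigma> v) (ce y \<beta>)"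
  proof (cases "\<sigma> = - (\<alpha> + \<beta>)")
    case True
    then have ab: "\<alpha> + \<beta> \<in> null_roots q" using n null_roots_minus[of "\<alpha> + \<beta>"] by simp
    then have p: "polar q \<alpha> \<beta> = -2" using real_roots_add_iff r by blast
    have e: "eps B \<sigma> \<beta> = - eps B \<alpha> \<beta>" "eps B \<sigma> \<alpha> = - eps B \<alpha> \<beta>"
      using r p by (simp_all add: True eps_bilinear eps_self eps_swap[of \<beta> \<alpha>] real_roots_def)
    have m: "polarC q v (cvec \<beta>) = - polarC q v (cvec \<alpha>)"
      using polarC_null(2)[OF ab, of v] by (simp add: polarC_simps add_eq_0_iff2)
    have s: "\<sigma> + \<beta> = - \<alpha>" "\<sigma> + \<alpha> = - \<beta>" using True by simp_all
    show ?thesis using r n rs ab real_not_null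
      by (auto simp: cyclic_def br_ce_ce br_cp_ce bf_gens True[symmetric] e m s polarC_simps polarC_commute[of "cvec \<alpha>"])
        (auto simp: True polarC_simps polarC_commute[of "cvec \<alpha>"])
  next
    case False
    then have "\<alpha> \<noteq> - (\<sigma> + \<beta>)" "\<beta> \<noteq> - (\<sigma> + \<alpha>)" using neg_sum_rotate add.commute by metis+
    with False show ?thesis using r n rs by (simp add: cyclic_def br_ce_ce br_cp_ce bf_gens)
  qed
  then show "cyclic (ce x \<alpha>) (ce y \<beta>) (cp \<sigma> v)" "cyclic (ce x \<alpha>) (cp \<sigma> v) (ce y \<beta>)" by auto
qed

lemma cyclic_epp:
  assumes "\<alpha> \<in> real_roots q" "\<sigma> \<in> null_roots q" "\<tau> \<in> null_roots q"
  shows "cyclic (ce x \<alpha>) (cp \<sigma> v) (cp \<tau> w)" "cyclic (cp \<sigma> v) (cp \<tau> w) (ce x \<alpha>)"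
proof -
  have "\<sigma> + \<alpha> \<in> real_roots q" "\<tau> + \<alpha> \<in> real_roots q"
    using assms real_roots_add_null by (simp_all add: add.commute[of _ \<alpha>])
  then show "cyclic (ce x \<alpha>) (cp \<sigma> v) (cp \<tau> w)" "cyclic (cp \<sigma> v) (cp \<tau> w) (ce x \<alpha>)"
    using assms null_roots_add by (simp_all add: cyclic_def br_cp_ce br_cp_cp bf_gens)
qed

lemma cyclic_ppp:
  assumes "\<sigma> \<in> null_roots q" "\<tau> \<in> null_roots q" "\<omega> \<in> null_roots q"
  shows "cyclic (cp \<sigma> u) (cp \<tau> v) (cp \<omega> w)"
  using assms null_roots_add by (simp add: cyclic_def br_cp_cp bf_gens polarC_simps polarC_null)

lemma dual_rad_apply_neg: "f \<in> dual_rad \<Longrightarrow> f (- (c *s \<rho> v)) = - (c * f (\<rho> v))"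
  using dual_rad_apply(3)[of f "- c" v] by simp

lemma cyclic_d:
  assumes f: "f \<in> dual_rad" and y: "y \<in> V" and z: "z \<in> V"
  shows "cyclic (cd f) y z \<and> cyclic y z (cd f)"
  using y
proof (induction y rule: V_induct)
  case e: (ce c \<alpha>)
  show ?case using z
  proof (induction z rule: V_induct)
    case (ce d \<beta>)
    show ?case
    proof (cases "\<beta> = - \<alpha>")
      case True
      then show ?thesis using e ce f zero_null_root real_not_null[of 0]
        by (auto simp: cyclic_def br_gens bf_gens eps_bilinear eps_self real_roots_def dual_rad_apply
            dual_rad_apply_neg)
    next
      case False
      then have "\<alpha> \<noteq> - \<beta>" "\<alpha> + \<beta> \<noteq> 0" by (auto simp: eq_neg_iff_add_eq_0 add.commute)
      then show ?thesis using e ce f False by (auto simp: cyclic_def br_gens bf_gens)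
    qed
  next
    case (cp \<sigma> v)
    then show ?case using e f real_roots_add_null[of \<sigma> \<alpha>]
      by (auto simp: cyclic_def br_gens bf_gens add.commute)
  next
    case (cd g)
    then show ?case using e f by (auto simp: cyclic_def br_gens bf_gens)
  next
    case (add z z')
    then show ?case using e f cyclic_add by simp
  qed
next
  case p: (cp \<sigma> v)
  show ?case using z
  proof (induction z rule: V_induct)
    case (ce d \<beta>)
    then show ?case using p f real_roots_add_null[of \<sigma> \<beta>]
      by (auto simp: cyclic_def br_gens bf_gens add.commute)
  next
    case (cp \<tau> w)
    show ?case
    proof (cases "\<tau> = - \<sigma>")
      case True
      then show ?thesis using p cp f
        by (auto simp: cyclic_def br_gens bf_gens eps_bilinear eps_self null_roots_def dual_rad_apply polarC_simps polarC_commute)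
    next
      case False
      then have "\<sigma> \<noteq> - \<tau>" "\<sigma> + \<tau> \<noteq> 0" by (auto simp: eq_neg_iff_add_eq_0 add.commute)
      then show ?thesis using p cp f False null_roots_add[of \<sigma> \<tau>] by (auto simp: cyclic_def br_gens bf_gens)
    qed
  next
    case (cd g)
    then show ?case using p f by (auto simp: cyclic_def br_gens bf_gens dual_rad_apply)
  next
    case (add z z')
    then show ?case using p f cyclic_add by simp
  qed
next
  case d: (cd g)
  show ?case using z
  proof (induction z rule: V_induct)
    case (add z z')
    then show ?case using d f cyclic_add by simp
  qed (use d f in \<open>auto simp: cyclic_def br_gens bf_gens dual_rad_apply\<close>)
next
  case (add y y')
  then show ?case using z f cyclic_add by simp
qed

lemma cyclic_all:
  assumes "x \<in> V" "y \<in> V" "z \<in> V"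
  shows "cyclic x y z"
  using assms
proof (induction rule: V_trilinear_induct)
  case (gen x y z)
  then have V: "x \<in> V" "y \<in> V" "z \<in> V" by (auto simp: gens_def)
  show ?case
  proof (cases "x \<in> cd ` dual_rad \<or> y \<in> cd ` dual_rad \<or> z \<in> cd ` dual_rad")
    case True
    then show ?thesis
      using V cyclic_d[of _ y z] cyclic_d[of _ x y] cyclic_d[of _ z x] cyclic_third[of y z x] by auto
  next
    case False
    have pee: "cyclic (cp \<sigma> v) (ce a \<alpha>) (ce b \<beta>)"
      if "\<sigma> \<in> null_roots q" "\<alpha> \<in> real_roots q" "\<beta> \<in> real_roots q" for \<sigma> \<alpha> \<beta> v a b
      using cyclic_third[OF cyclic_eep(1) cyclic_eep(2)] that by blast
    have pep: "cyclic (cp \<sigma> v) (ce a \<alpha>) (cp \<tau> w)"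
      if "\<sigma> \<in> null_roots q" "\<tau> \<in> null_roots q" "\<alpha> \<in> real_roots q" for \<sigma> \<tau> \<alpha> v w a
      using cyclic_third[OF cyclic_epp(1) cyclic_epp(2)] that by blast
    from gen False show ?thesis
      by (auto simp: gens_def cyclic_eee cyclic_eep cyclic_epp cyclic_ppp pee pep)
  qed
qed (use cyclic_add in auto)

lemma bf_invariant:
  assumes "x \<in> V" "y \<in> V" "z \<in> V"
  shows "bf (br x y) z = bf x (br y z)"
  using cyclic_all[OF assms] bf_sym[of x "br y z"] assms by (simp add: cyclic_def)

text \<open>The \<open>i\<close>-th coordinate function, as an element of \<open>(rad\<^sub>\<complex> q)\<^sup>*\<close>.\<close>

definition coordf :: "'n \<Rightarrow> complex^'n \<Rightarrow> complex" where
  "coordf i v = (if v \<in> radC q then v $ i else 0)"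

lemma coordf_in_dual_rad [simp]: "coordf i \<in> dual_rad"
  by (auto simp: functionals_def coordf_def radC_closed)

text \<open>In degree \<open>\<sigma> \<noteq> 0\<close> the form is \<open>q\<close> on \<open>\<complex>\<^sup>n / rad\<^sub>\<complex> q\<close>, which is nondegenerate since \<open>rad\<^sub>\<complex> q\<close> is the whole
  radical of the complexified form. In degree \<open>0\<close> the missing radical is paired with its dual.\<close>

lemma bf_nondegenerate:
  assumes x: "x \<in> V" and z: "\<And>y. y \<in> V \<Longrightarrow> bf x y = 0"
  shows "x = 0"
proof -
  have e: "ec x \<alpha> = 0" for \<alpha>
    using z[of "ce 1 (- \<alpha>)"] V_D(2)[OF x, of \<alpha>] bf_ce[OF x, of 1 "- \<alpha>"]
    by (cases "\<alpha> \<in> real_roots q") auto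
  have "\<rho> (pc x 0) $ i = 0" for i
    using z[of "cd (coordf i)"] bf_cd[OF x, of "coordf i"] by (simp add: coordf_def \<rho>_in_radC)
  then have r: "\<rho> (pc x 0) = 0" by (simp add: vec_eq_iff)
  have "df x (\<rho> w) + polarC q (pc x 0) w = 0" for w
    using z[of "cp 0 w"] bf_cp[OF x, of 0 w] by (simp add: add.commute)
  note 0 = this
  have "df x (\<rho> w) = 0" for w using 0[of "\<rho> w"] by simp
  then have d: "df x w = 0" for w
    using V_D(5)[OF x] \<rho>_radC[of w] by (cases "w \<in> radC q") (metis, auto simp: functionals_def)
  have p: "pc x \<sigma> = 0" for \<sigma>
  proof (cases "\<sigma> \<in> null_roots q \<and> \<sigma> \<noteq> 0")
    case True
    then have "polarC q (pc x \<sigma>) w = 0" for w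
      using z[of "cp (- \<sigma>) w"] bf_cp[OF x, of "- \<sigma>" w] by simp
    then have "pc x \<sigma> \<in> radC q" by (simp add: mem_radC_iff)
    then have "C \<sigma> (pc x \<sigma>) = 0" using True by (simp add: C_def \<rho>_radC)
    then show ?thesis using V_D(4)[OF x, of \<sigma>] by simp
  next
    case False
    have "pc x 0 \<in> radC q" using 0 d by (simp add: mem_radC_iff)
    then have "pc x 0 = 0" using \<rho>_radC r by metis
    then show ?thesis using False V_D(3)[OF x] by blast
  qed
  show ?thesis by (rule coord_eqI) (simp_all add: e d p)
qed

section \<open>Separation of degrees\<close>

text \<open>By \<open>complement_from_polar\<close>, the coordinates of \<open>\<alpha>\<close> are values of \<open>\<alpha>\<close> at elements of \<open>H\<close>: those of
  \<open>\<alpha> - \<rho>(\<alpha>)\<close> at some \<open>\<pi>\<^sub>0(v)\<close>, and those of \<open>\<rho>(\<alpha>)\<close> at coordinate functions on the radical.\<close>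

lemma ev_separates: "\<exists>h. homog 0 h \<and> (\<forall>\<alpha>. ev \<alpha> h = of_int (\<alpha> $ i))"
proof -
  obtain a where a: "\<And>v. v - \<rho> v = (\<Sum>j\<in>UNIV. polarC q (axis j 1) v *s a j)"
    using complement_from_polar by blast
  let ?u = "\<Sum>j\<in>UNIV. (a j $ i) *s axis j 1"
  let ?h = "cp 0 ?u + cd (coordf i)"
  have "ev \<alpha> ?h = of_int (\<alpha> $ i)" for \<alpha>
  proof -
    have "ev \<alpha> ?h = (\<Sum>j\<in>UNIV. polarC q (axis j 1) (cvec \<alpha>) *s a j) $ i + \<rho> (cvec \<alpha>) $ i"
      by (simp add: ev_def C_zero polarC_sum polarC_simps coordf_def \<rho>_in_radC mult.commute)
    also have "\<dots> = cvec \<alpha> $ i" by (simp flip: a)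
    finally show ?thesis by (simp add: cvec_def)
  qed
  moreover have "homog 0 ?h"
    using supp_add[of "cp 0 ?u" "cd (coordf i)"] supp_gens(2)[of 0 ?u] supp_gens(3)[of "coordf i"]
    by (simp add: homog_def)
  ultimately show ?thesis by blast
qed

end

section \<open>Cosets of a subspace\<close>

lemma mem_coset_iff: "x \<in> v +o W \<longleftrightarrow> x - v \<in> (W :: 'a::ab_group_add set)"
  by (auto simp: elt_set_plus_def intro: bexI[of _ "x - v"])

context
  fixes W :: "(complex^'n::finite) set"
  assumes W: "vec.subspace W"
begin

lemma coset_eq_iff: "v +o W = w +o W \<longleftrightarrow> v - w \<in> W"
proof
  assume "v +o W = w +o W"
  then show "v - w \<in> W" using mem_coset_iff[of v v W] mem_coset_iff[of v w W] vec.subspace_0[OF W] by simp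
next
  assume d: "v - w \<in> W"
  have "x - v \<in> W \<longleftrightarrow> x - w \<in> W" for x
    using vec.subspace_add[OF W _ d, of "x - v"] vec.subspace_diff[OF W _ d, of "x - w"] by auto
  then show "v +o W = w +o W" by (auto simp: mem_coset_iff)
qed

lemma subset_add_absorb:
  assumes "A \<subseteq> W" "0 \<in> A"
  shows "A + W = W"
proof (intro equalityI subsetI)
  fix x assume "x \<in> A + W"
  then obtain a w where "a \<in> A" "w \<in> W" "x = a + w" by (rule set_plus_elim)
  then show "x \<in> W" using vec.subspace_add[OF W] assms by blast
next
  fix x assume "x \<in> W"
  from set_plus_intro[OF assms(2) this] show "x \<in> A + W" by simp
qed

lemma coset_add: "(v +o W) + (w +o W) = (v + w) +o W"
  using set_plus_rearrange[of v W w W] subset_add_absorb[OF order_refl vec.subspace_0[OF W]] by simp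

lemma coset_add_subset:
  assumes "A \<subseteq> W" "0 \<in> A"
  shows "(v +o A) + W = v +o W"
  using set_plus_rearrange[of v A 0 W] subset_add_absorb[OF assms] by simp

lemma coset_scale: "((*s) c) ` (v +o W) + W = (c *s v) +o W"
proof (intro equalityI subsetI)
  fix x assume "x \<in> ((*s) c) ` (v +o W) + W"
  then obtain y w where y: "y \<in> ((*s) c) ` (v +o W)" "w \<in> W" "x = y + w" by (rule set_plus_elim)
  then obtain z where z: "z \<in> v +o W" "y = c *s z" by blast
  have "c *s (z - v) + w \<in> W"
    using z y by (intro vec.subspace_add[OF W] vec.subspace_scale[OF W]) (simp_all add: mem_coset_iff)
  moreover have "x - c *s v = c *s (z - v) + w" using y z by (simp add: vec.scale_right_diff_distrib)
  ultimately show "x \<in> (c *s v) +o W" by (simp only: mem_coset_iff)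
next
  fix x assume "x \<in> (c *s v) +o W"
  then have "x - c *s v \<in> W" by (simp only: mem_coset_iff)
  moreover have "c *s v \<in> ((*s) c) ` (v +o W)"
    using vec.subspace_0[OF W] by (intro imageI) (simp add: mem_coset_iff)
  ultimately have "c *s v + (x - c *s v) \<in> ((*s) c) ` (v +o W) + W" by (intro set_plus_intro)
  then show "x \<in> ((*s) c) ` (v +o W) + W" by simp
qed

lemma rep_in_coset: "rep (v +o W) - v \<in> W" "v +o W = rep (v +o W) +o W"
proof -
  have "v \<in> v +o W" using vec.subspace_0[OF W] by (simp add: mem_coset_iff)
  then have "rep (v +o W) \<in> v +o W" unfolding rep_def by (rule someI)
  then show d: "rep (v +o W) - v \<in> W" by (simp add: mem_coset_iff)
  show "v +o W = rep (v +o W) +o W"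
    using vec.subspace_neg[OF W d] by (simp add: coset_eq_iff)
qed

end

context nonneg_unit_form
begin

section \<open>The coordinates of \<open>E(q)\<close>\<close>

lemma WE_subspace: "vec.subspace (WE q \<sigma>)"
  using radC_subspace by (auto simp: WE_def vec.subspace_def)

lemma WN_subspace: "vec.subspace (WN \<sigma>)"
  by (simp add: WN_def)

lemma C_eq_0_iff: "C \<sigma> v = 0 \<longleftrightarrow> v \<in> WE q \<sigma>"
proof -
  have "v - \<rho> v = 0 \<longleftrightarrow> v \<in> radC q" using \<rho>_radC[of v] \<rho>_in_radC[of v] by auto
  then show ?thesis by (simp add: C_def WE_def)
qed

lemma C_eq_iff: "C \<sigma> v = C \<sigma> w \<longleftrightarrow> v +o WE q \<sigma> = w +o WE q \<sigma>"
  using C_eq_0_iff[of \<sigma> "v - w"] by (simp add: coset_eq_iff[OF WE_subspace])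

lemma C_coset: "C \<sigma> v +o WE q \<sigma> = v +o WE q \<sigma>"
  using C_eq_iff[of \<sigma> "C \<sigma> v" v] by simp

lemma C_rep: "C \<sigma> (rep (v +o WE q \<sigma>)) = C \<sigma> v"
  unfolding C_eq_iff by (rule rep_in_coset(2)[OF WE_subspace, symmetric])

lemma WN_subset_WE: "\<sigma> \<in> null_roots q \<Longrightarrow> WN \<sigma> \<subseteq> WE q \<sigma>"
proof -
  assume "\<sigma> \<in> null_roots q"
  then have "c *s cvec \<sigma> \<in> WE q \<sigma>" for c
    using C_eq_0_iff[of \<sigma> "c *s cvec \<sigma>"] C_null[of \<sigma> \<sigma>] by auto
  then show ?thesis by (auto simp: WN_def vec.span_singleton)
qed

abbreviation E where "E \<equiv> gspace q (WE q)"

text \<open>The coordinates of an element of \<open>E(q)\<close>. The inverse map \<open>\<Gamma>\<close> forms the cosets again.\<close>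

definition \<Phi> :: "'n gelt \<Rightarrow> 'n coord" where
  "\<Phi> x = Coord (ecoeff x) (\<lambda>\<sigma>. if \<sigma> \<in> null_roots q then C \<sigma> (rep (pcoset x \<sigma>)) else 0) (dfun x)"

definition \<Gamma> :: "'n coord \<Rightarrow> 'n gelt" where
  "\<Gamma> x = Gelt (ec x) (\<lambda>\<sigma>. if \<sigma> \<in> null_roots q then pc x \<sigma> +o WE q \<sigma> else {}) (df x)"

lemma \<Phi>_sel [simp]: "ec (\<Phi> x) = ecoeff x" "df (\<Phi> x) = dfun x"
  by (simp_all add: \<Phi>_def)

lemma pc_\<Phi>: "pc (\<Phi> x) \<sigma> = (if \<sigma> \<in> null_roots q then C \<sigma> (rep (pcoset x \<sigma>)) else 0)"
  by (simp add: \<Phi>_def)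

lemma \<Gamma>_sel [simp]:
  "ecoeff (\<Gamma> x) = ec x" "dfun (\<Gamma> x) = df x"
  "pcoset (\<Gamma> x) \<sigma> = (if \<sigma> \<in> null_roots q then pc x \<sigma> +o WE q \<sigma> else {})"
  by (simp_all add: \<Gamma>_def)

lemma C_pc_\<Phi>: "C \<sigma> (pc (\<Phi> x) \<sigma>) = pc (\<Phi> x) \<sigma>"
  by (simp add: pc_\<Phi>)

lemma gelt_eqI:
  "(\<And>\<alpha>. ecoeff x \<alpha> = ecoeff y \<alpha>) \<Longrightarrow> (\<And>\<alpha>. pcoset x \<alpha> = pcoset y \<alpha>) \<Longrightarrow> (\<And>v. dfun x v = dfun y v) \<Longrightarrow> x = y"
  by (cases x; cases y) auto

lemma pcoset_eq_\<Phi>: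
  assumes "x \<in> E" "\<sigma> \<in> null_roots q"
  shows "pcoset x \<sigma> = pc (\<Phi> x) \<sigma> +o WE q \<sigma>"
proof -
  obtain v where "pcoset x \<sigma> = v +o WE q \<sigma>" using assms by (auto simp: gspace_def)
  then show ?thesis using assms(2) by (simp add: pc_\<Phi> C_coset C_rep)
qed

lemma coset_WE_trivial: "v +o WE q \<sigma> = WE q \<sigma> \<longleftrightarrow> C \<sigma> v = 0"
  using C_eq_iff[of \<sigma> v 0] by (simp add: elt_set_plus_def)

lemma supp_\<Phi>:
  assumes "x \<in> E"
  shows "supp (\<Phi> x) = esupp x \<union> psupp q (WE q) x"
proof -
  have "pcoset x \<sigma> \<noteq> WE q \<sigma> \<longleftrightarrow> pc (\<Phi> x) \<sigma> \<noteq> 0" if "\<sigma> \<in> null_roots q" for \<sigma>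
    using pcoset_eq_\<Phi>[OF assms that] coset_WE_trivial[of "pc (\<Phi> x) \<sigma>" \<sigma>] by (simp add: C_pc_\<Phi>)
  moreover have "pc (\<Phi> x) \<sigma> = 0" if "\<sigma> \<notin> null_roots q" for \<sigma> using that by (simp add: pc_\<Phi>)
  ultimately show ?thesis by (auto simp: supp_def esupp_def psupp_def)
qed

lemma \<Phi>_in_V [simp]: "x \<in> E \<Longrightarrow> \<Phi> x \<in> V"
  using supp_\<Phi>[of x] by (auto simp: V_def gspace_def esupp_def pc_\<Phi>)

lemma \<Gamma>_in_E [simp]:
  assumes "x \<in> V" shows "\<Gamma> x \<in> E"
proof -
  have "esupp (\<Gamma> x) \<subseteq> supp x" by (auto simp: esupp_def supp_def)
  moreover have "psupp q (WE q) (\<Gamma> x) \<subseteq> supp x"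
    using coset_WE_trivial[of 0] by (auto simp: psupp_def supp_def split: if_splits)
  moreover have "esupp (\<Gamma> x) \<subseteq> real_roots q" using V_D(2)[OF assms] by (auto simp: esupp_def)
  ultimately show ?thesis
    using V_D(1,5)[OF assms] by (auto simp: gspace_def intro: finite_subset)
qed

lemma \<Phi>_\<Gamma> [simp]: "x \<in> V \<Longrightarrow> \<Phi> (\<Gamma> x) = x"
  using V_D(3,4)[of x] by (auto intro!: coord_eqI simp: C_rep pc_\<Phi>)

lemma \<Gamma>_\<Phi> [simp]:
  assumes "x \<in> E"
  shows "\<Gamma> (\<Phi> x) = x"
proof (rule gelt_eqI)
  show "pcoset (\<Gamma> (\<Phi> x)) \<sigma> = pcoset x \<sigma>" for \<sigma>
  proof (cases "\<sigma> \<in> null_roots q")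
    case True
    then show ?thesis by (simp add: pcoset_eq_\<Phi>[OF assms])
  next
    case False
    then show ?thesis using assms by (simp add: gspace_def)
  qed
qed simp_all

lemma \<Phi>_inject: "x \<in> E \<Longrightarrow> y \<in> E \<Longrightarrow> \<Phi> x = \<Phi> y \<longleftrightarrow> x = y"
  by (metis \<Gamma>_\<Phi>)

lemma gzero_eq: "gzero q (WE q) = \<Gamma> 0"
  by (intro gelt_eqI) (simp_all add: gzero_def elt_set_plus_def)

lemma gadd_eq:
  assumes "x \<in> E" "y \<in> E"
  shows "gadd x y = \<Gamma> (\<Phi> x + \<Phi> y)"
proof -
  have "pcoset x \<sigma> + pcoset y \<sigma> = (pc (\<Phi> x) \<sigma> + pc (\<Phi> y) \<sigma>) +o WE q \<sigma>" if "\<sigma> \<in> null_roots q" for \<sigma>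
    by (simp only: pcoset_eq_\<Phi>[OF assms(1) that] pcoset_eq_\<Phi>[OF assms(2) that] coset_add[OF WE_subspace])
  moreover have "pcoset x \<sigma> + pcoset y \<sigma> = {}" if "\<sigma> \<notin> null_roots q" for \<sigma>
    using assms that by (auto simp: gspace_def set_plus_def)
  ultimately show ?thesis by (intro gelt_eqI) (simp_all add: gadd_def)
qed

lemma gsmult_eq:
  assumes "x \<in> E"
  shows "gsmult (WE q) c x = \<Gamma> (cscale c (\<Phi> x))"
proof -
  have "((*s) c) ` pcoset x \<sigma> + WE q \<sigma> = (c *s pc (\<Phi> x) \<sigma>) +o WE q \<sigma>" if "\<sigma> \<in> null_roots q" for \<sigma>
    by (simp only: pcoset_eq_\<Phi>[OF assms(1) that] coset_scale[OF WE_subspace])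
  moreover have "((*s) c) ` pcoset x \<sigma> + WE q \<sigma> = {}" if "\<sigma> \<notin> null_roots q" for \<sigma>
    using assms that by (auto simp: gspace_def set_plus_def)
  ultimately show ?thesis by (intro gelt_eqI) (simp_all add: gsmult_def)
qed

text \<open>Lifts of elements of \<open>E(q)\<close> to \<open>N(q)\<close> have the same coordinates.\<close>

lemma N_to_E_preimage:
  assumes "x \<in> E"
  defines "x' \<equiv> inv_into (gspace q WN) (N_to_E q) x"
  shows "x' \<in> gspace q WN" "ecoeff x' = ecoeff x" "dfun x' = dfun x"
    "\<sigma> \<in> null_roots q \<Longrightarrow> C \<sigma> (rep (pcoset x' \<sigma>)) = pc (\<Phi> x) \<sigma>"
    "\<sigma> \<in> null_roots q \<Longrightarrow> \<sigma> \<notin> psupp q WN x' \<Longrightarrow> pc (\<Phi> x) \<sigma> = 0"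
proof -
  define y where "y = Gelt (ecoeff x) (\<lambda>\<sigma>. if \<sigma> \<in> null_roots q then pc (\<Phi> x) \<sigma> +o WN \<sigma> else {}) (dfun x)"
  have "psupp q WN y \<subseteq> supp (\<Phi> x)"
    by (auto simp: psupp_def y_def supp_def elt_set_plus_def)
  then have "finite (psupp q WN y)" using V_D(1)[OF \<Phi>_in_V[OF assms(1)]] finite_subset by blast
  then have "y \<in> gspace q WN"
    using assms(1) by (auto simp: gspace_def y_def esupp_def)
  moreover have "N_to_E q y = x"
  proof (rule gelt_eqI)
    show "pcoset (N_to_E q y) \<sigma> = pcoset x \<sigma>" for \<sigma>
    proof (cases "\<sigma> \<in> null_roots q")
      case True
      then show ?thesis
        using coset_add_subset[OF WE_subspace WN_subset_WE[OF True] vec.subspace_0[OF WN_subspace]]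
          pcoset_eq_\<Phi>[OF assms(1) True] by (simp add: N_to_E_def y_def)
    next
      case False
      then show ?thesis using assms(1) by (simp add: N_to_E_def y_def gspace_def set_plus_def)
    qed
  qed (simp_all add: N_to_E_def y_def)
  ultimately have x: "x \<in> N_to_E q ` gspace q WN" by blast
  show g: "x' \<in> gspace q WN" unfolding x'_def by (rule inv_into_into[OF x])
  have e: "N_to_E q x' = x" unfolding x'_def by (rule f_inv_into_f[OF x])
  show "ecoeff x' = ecoeff x" "dfun x' = dfun x" by (simp_all add: N_to_E_def flip: e)
  have p: "pcoset x \<sigma> = rep (pcoset x' \<sigma>) +o WE q \<sigma>" if \<sigma>: "\<sigma> \<in> null_roots q" for \<sigma>
  proof -
    obtain v where "pcoset x' \<sigma> = v +o WN \<sigma>" using g \<sigma> by (auto simp: gspace_def)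
    then have "pcoset x' \<sigma> = rep (pcoset x' \<sigma>) +o WN \<sigma>"
      using rep_in_coset(2)[OF WN_subspace, of v \<sigma>] by metis
    then have "pcoset x' \<sigma> + WE q \<sigma> = rep (pcoset x' \<sigma>) +o WE q \<sigma>"
      using coset_add_subset[OF WE_subspace WN_subset_WE[OF \<sigma>] vec.subspace_0[OF WN_subspace]] by metis
    then show ?thesis by (simp add: N_to_E_def flip: e)
  qed
  show c: "C \<sigma> (rep (pcoset x' \<sigma>)) = pc (\<Phi> x) \<sigma>" if \<sigma>: "\<sigma> \<in> null_roots q" for \<sigma>
    using p[OF \<sigma>] \<sigma> by (simp add: C_rep pc_\<Phi>)
  show "pc (\<Phi> x) \<sigma> = 0" if \<sigma>: "\<sigma> \<in> null_roots q" and "\<sigma> \<notin> psupp q WN x'"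
  proof -
    have "pcoset x' \<sigma> = 0 +o WN \<sigma>" using that by (simp add: psupp_def elt_set_plus_def)
    then have "rep (pcoset x' \<sigma>) \<in> WE q \<sigma>"
      using rep_in_coset(1)[OF WN_subspace, of 0 \<sigma>] WN_subset_WE[OF \<sigma>] by auto
    then show ?thesis unfolding c[OF \<sigma>, symmetric] C_eq_0_iff .
  qed
qed

text \<open>The representatives of a lift to \<open>N(q)\<close> differ from the normal forms by elements of \<open>rad\<^sub>\<complex> q\<close>, on which all
  pairings vanish. It remains to sort the sums by the first degree.\<close>

lemma E_bracket_eq:
  assumes x: "x \<in> E" and y: "y \<in> E"
  shows "E_bracket q B \<rho> x y = \<Gamma> (br (\<Phi> x) (\<Phi> y))"
proof -
  define x' y' where "x' = inv_into (gspace q WN) (N_to_E q) x" and "y' = inv_into (gspace q WN) (N_to_E q) y"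
  let ?X = "\<Phi> x" and ?Y = "\<Phi> y" and ?P = "psupp q WN x'" and ?Q = "psupp q WN y'"
  let ?r = "\<lambda>\<sigma>. rep (pcoset x' \<sigma>)" and ?r' = "\<lambda>\<sigma>. rep (pcoset y' \<sigma>)"
  note X = N_to_E_preimage[OF x, folded x'_def] and Y = N_to_E_preimage[OF y, folded y'_def]
  define S where "S = esupp x \<union> ?P"
  have fin: "finite (esupp x)" "finite (?P)" "finite (?Q)"
    using x X(1) Y(1) by (auto simp: gspace_def)
  have es: "esupp x' = esupp x" by (simp add: esupp_def X)
  have real: "ecoeff x \<alpha> \<noteq> 0 \<Longrightarrow> \<alpha> \<in> real_roots q" for \<alpha> using x by (auto simp: gspace_def esupp_def)
  have ps: "\<sigma> \<in> psupp q WN z \<Longrightarrow> \<sigma> \<in> null_roots q" for \<sigma> z by (simp add: psupp_def)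
  have px: "pc ?X \<alpha> = 0" if "\<alpha> \<notin> ?P" for \<alpha>
    using X(5) that V_D(3)[OF \<Phi>_in_V[OF x]] by blast
  have py: "pc ?Y \<alpha> = 0" if "\<alpha> \<notin> ?Q" for \<alpha>
    using Y(5) that V_D(3)[OF \<Phi>_in_V[OF y]] by blast
  have "supp ?X \<subseteq> S"
    using px by (auto simp: supp_def S_def esupp_def)
  then have br: "br ?X ?Y = brS S ?X ?Y"
    using fin by (intro br_eq_brS) (auto simp: S_def)
  have pX: "polarC q (?r \<sigma>) w = polarC q (pc ?X \<sigma>) w" if "\<sigma> \<in> null_roots q" for \<sigma> w
    using C_simps(7)[of \<sigma> "?r \<sigma>" w] X(4)[OF that] by simp
  have pY: "polarC q (?r' \<sigma>) w = polarC q (pc ?Y \<sigma>) w"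
    "polarC q w (?r' \<sigma>) = polarC q w (pc ?Y \<sigma>)" if "\<sigma> \<in> null_roots q" for \<sigma> w
    using C_simps(7)[of \<sigma> "?r' \<sigma>" w] C_simps(8)[of w \<sigma> "?r' \<sigma>"] Y(4)[OF that] by simp_all
  have sumE: "(\<Sum>\<alpha>\<in>S. f \<alpha>) = (\<Sum>\<alpha>\<in>esupp x. f \<alpha>)" if "\<And>\<alpha>. ecoeff x \<alpha> = 0 \<Longrightarrow> f \<alpha> = 0"
    for f :: "_ \<Rightarrow> 'b::comm_monoid_add"
    using fin that by (intro sum.mono_neutral_right) (auto simp: S_def esupp_def)
  have sumP: "(\<Sum>\<alpha>\<in>S. f \<alpha>) = (\<Sum>\<alpha>\<in>?P. f \<alpha>)" if "\<And>\<alpha>. pc ?X \<alpha> = 0 \<Longrightarrow> f \<alpha> = 0"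
    for f :: "_ \<Rightarrow> 'b::comm_monoid_add"
    using fin that px by (intro sum.mono_neutral_right) (auto simp: S_def)
  \<comment> \<open>The sum over the null degrees of the second argument, written as a sum over \<open>\<alpha> = \<gamma> - \<tau>\<close>.\<close>
  have third: "(\<Sum>\<tau>\<in>?Q. eps B \<tau> (\<gamma> - \<tau>) * polarC q (?r' \<tau>) (cvec (\<gamma> - \<tau>)) * ecoeff x (\<gamma> - \<tau>))
     = (\<Sum>\<alpha>\<in>S. eps B \<alpha> (\<gamma> - \<alpha>) * (polarC q (pc ?Y (\<gamma> - \<alpha>)) (cvec \<alpha>) * ecoeff x \<alpha>))" for \<gamma>
  proof -
    define g where "g \<tau> = eps B \<tau> (\<gamma> - \<tau>) * polarC q (pc ?Y \<tau>) (cvec (\<gamma> - \<tau>)) * ecoeff x (\<gamma> - \<tau>)" for \<tau>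
    define U where "U = ?Q \<union> (\<lambda>\<alpha>. \<gamma> - \<alpha>) ` esupp x"
    have fU: "finite U" using fin by (simp add: U_def)
    have "(\<Sum>\<tau>\<in>?Q. g \<tau>) = (\<Sum>\<tau>\<in>U. g \<tau>)"
      using fU py by (intro sum.mono_neutral_left) (auto simp: U_def g_def polarC_simps)
    also have "\<dots> = (\<Sum>\<tau>\<in>(\<lambda>\<alpha>. \<gamma> - \<alpha>) ` esupp x. g \<tau>)"
    proof (intro sum.mono_neutral_right fU)
      show "\<forall>\<tau>\<in>U - (\<lambda>\<alpha>. \<gamma> - \<alpha>) ` esupp x. g \<tau> = 0"
      proof
        fix \<tau> assume "\<tau> \<in> U - (\<lambda>\<alpha>. \<gamma> - \<alpha>) ` esupp x"
        then have "\<gamma> - \<tau> \<notin> esupp x" using image_eqI[of \<tau> "\<lambda>\<alpha>. \<gamma> - \<alpha>" "\<gamma> - \<tau>"] by auto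
        then show "g \<tau> = 0" by (simp add: g_def esupp_def)
      qed
    qed (auto simp: U_def)
    also have "\<dots> = (\<Sum>\<alpha>\<in>esupp x. g (\<gamma> - \<alpha>))" by (subst sum.reindex) (auto simp: inj_on_def)
    also have "\<dots> = (\<Sum>\<alpha>\<in>esupp x. eps B \<alpha> (\<gamma> - \<alpha>) * (polarC q (pc ?Y (\<gamma> - \<alpha>)) (cvec \<alpha>) * ecoeff x \<alpha>))"
    proof (intro sum.cong refl)
      fix \<alpha>
      show "g (\<gamma> - \<alpha>) = eps B \<alpha> (\<gamma> - \<alpha>) * (polarC q (pc ?Y (\<gamma> - \<alpha>)) (cvec \<alpha>) * ecoeff x \<alpha>)"
        using eps_null_commute[of "\<gamma> - \<alpha>" \<alpha>] V_D(3)[OF \<Phi>_in_V[OF y], of "\<gamma> - \<alpha>"]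
        by (cases "\<gamma> - \<alpha> \<in> null_roots q") (simp_all add: g_def polarC_simps)
    qed
    also have "\<dots> = (\<Sum>\<alpha>\<in>S. eps B \<alpha> (\<gamma> - \<alpha>) * (polarC q (pc ?Y (\<gamma> - \<alpha>)) (cvec \<alpha>) * ecoeff x \<alpha>))"
      by (rule sumE[symmetric]) simp
    also have "(\<Sum>\<tau>\<in>?Q. g \<tau>) = (\<Sum>\<tau>\<in>?Q. eps B \<tau> (\<gamma> - \<tau>) *
        polarC q (?r' \<tau>) (cvec (\<gamma> - \<tau>)) * ecoeff x (\<gamma> - \<tau>))"
      by (intro sum.cong refl) (simp add: g_def pY ps)
    finally show ?thesis .
  qed
  have eP: "(\<Sum>\<alpha>\<in>S. real_term ?X ?Y \<alpha> (\<gamma> - \<alpha>)) =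
      (\<Sum>\<alpha>\<in>esupp x. eps B \<alpha> (\<gamma> - \<alpha>) * ecoeff x \<alpha> * ecoeff y (\<gamma> - \<alpha>))
      + (\<Sum>\<sigma>\<in>?P. eps B \<sigma> (\<gamma> - \<sigma>) * polarC q (?r \<sigma>) (cvec (\<gamma> - \<sigma>)) * ecoeff y (\<gamma> - \<sigma>))
      - (\<Sum>\<tau>\<in>?Q. eps B \<tau> (\<gamma> - \<tau>) * polarC q (?r' \<tau>) (cvec (\<gamma> - \<tau>)) * ecoeff x (\<gamma> - \<tau>))"
    for \<gamma>
  proof -
    have "(\<Sum>\<alpha>\<in>esupp x. eps B \<alpha> (\<gamma> - \<alpha>) * ecoeff x \<alpha> * ecoeff y (\<gamma> - \<alpha>))
        = (\<Sum>\<alpha>\<in>S. eps B \<alpha> (\<gamma> - \<alpha>) * ecoeff x \<alpha> * ecoeff y (\<gamma> - \<alpha>))"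
      by (rule sumE[symmetric]) simp
    moreover have "(\<Sum>\<sigma>\<in>?P. eps B \<sigma> (\<gamma> - \<sigma>) * polarC q (?r \<sigma>) (cvec (\<gamma> - \<sigma>)) * ecoeff y (\<gamma> - \<sigma>))
        = (\<Sum>\<sigma>\<in>?P. eps B \<sigma> (\<gamma> - \<sigma>) * polarC q (pc ?X \<sigma>) (cvec (\<gamma> - \<sigma>)) * ecoeff y (\<gamma> - \<sigma>))"
      by (intro sum.cong refl) (simp add: pX ps)
    moreover have "\<dots> = (\<Sum>\<sigma>\<in>S. eps B \<sigma> (\<gamma> - \<sigma>) * polarC q (pc ?X \<sigma>) (cvec (\<gamma> - \<sigma>)) * ecoeff y (\<gamma> - \<sigma>))"
      by (rule sumP[symmetric]) (simp add: polarC_simps)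
    ultimately show ?thesis unfolding third
      by (simp add: real_term_def sum.distrib sum_subtractf algebra_simps)
  qed
  have nP: "(\<Sum>\<alpha>\<in>S. null_term ?X ?Y \<alpha> (\<gamma> - \<alpha>) *s cvec \<alpha>) =
      (\<Sum>\<sigma>\<in>?P. (eps B \<sigma> (\<gamma> - \<sigma>) * polarC q (?r \<sigma>) (?r' (\<gamma> - \<sigma>))) *s cvec \<sigma>)
      + (\<Sum>\<alpha>\<in>esupp x. (eps B \<alpha> (\<gamma> - \<alpha>) * ecoeff x \<alpha> * ecoeff y (\<gamma> - \<alpha>)) *s cvec \<alpha>)"
    if \<gamma>: "\<gamma> \<in> null_roots q" for \<gamma>
  proof -
    have "(\<Sum>\<alpha>\<in>esupp x. (eps B \<alpha> (\<gamma> - \<alpha>) * ecoeff x \<alpha> * ecoeff y (\<gamma> - \<alpha>)) *s cvec \<alpha>)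
        = (\<Sum>\<alpha>\<in>S. (eps B \<alpha> (\<gamma> - \<alpha>) * ecoeff x \<alpha> * ecoeff y (\<gamma> - \<alpha>)) *s cvec \<alpha>)"
      by (rule sumE[symmetric]) simp
    moreover have "(\<Sum>\<sigma>\<in>?P. (eps B \<sigma> (\<gamma> - \<sigma>) * polarC q (?r \<sigma>) (?r' (\<gamma> - \<sigma>))) *s cvec \<sigma>)
        = (\<Sum>\<sigma>\<in>?P. (eps B \<sigma> (\<gamma> - \<sigma>) * polarC q (pc ?X \<sigma>) (pc ?Y (\<gamma> - \<sigma>))) *s cvec \<sigma>)"
      by (intro sum.cong refl) (simp add: pX pY ps null_roots_diff \<gamma>)
    moreover have "\<dots> = (\<Sum>\<sigma>\<in>S. (eps B \<sigma> (\<gamma> - \<sigma>) * polarC q (pc ?X \<sigma>) (pc ?Y (\<gamma> - \<sigma>))) *s cvec \<sigma>)"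
      by (rule sumP[symmetric]) (simp add: polarC_simps)
    ultimately show ?thesis
      by (simp add: null_term_def sum.distrib distrib_left vec.scale_left_distrib mult.assoc)
  qed
  show ?thesis
  proof (rule gelt_eqI)
    show "ecoeff (E_bracket q B \<rho> x y) \<gamma> = ecoeff (\<Gamma> (br ?X ?Y)) \<gamma>" for \<gamma>
      by (simp add: E_bracket_def N_to_E_def N_bracket_def flip: x'_def y'_def)
        (simp add: br brS_def eP es X Y)
    show "dfun (E_bracket q B \<rho> x y) v = dfun (\<Gamma> (br ?X ?Y)) v" for v
      by (simp add: E_bracket_def N_to_E_def N_bracket_def br brS_def)
    show "pcoset (E_bracket q B \<rho> x y) \<gamma> = pcoset (\<Gamma> (br ?X ?Y)) \<gamma>" for \<gamma>
    proof (cases "\<gamma> \<in> null_roots q")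
      case True
      define u where "u = (\<Sum>\<alpha>\<in>S. null_term ?X ?Y \<alpha> (\<gamma> - \<alpha>) *s cvec \<alpha>)
        + dfun x (\<rho> (cvec \<gamma>)) *s ?r' \<gamma> - dfun y (\<rho> (cvec \<gamma>)) *s ?r \<gamma>"
      have "pcoset (E_bracket q B \<rho> x y) \<gamma> = (u +o WN \<gamma>) + WE q \<gamma>"
        using True by (simp add: E_bracket_def N_to_E_def N_bracket_def u_def nP es X Y flip: x'_def y'_def)
      also have "\<dots> = u +o WE q \<gamma>"
        by (rule coset_add_subset[OF WE_subspace WN_subset_WE[OF True] vec.subspace_0[OF WN_subspace]])
      also have "\<dots> = C \<gamma> u +o WE q \<gamma>" by (simp add: C_coset)
      also have "C \<gamma> u = pc (br ?X ?Y) \<gamma>"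
        using True X(4)[OF True] Y(4)[OF True] V_D(4)[OF \<Phi>_in_V[OF x], of \<gamma>] V_D(4)[OF \<Phi>_in_V[OF y], of \<gamma>]
        by (simp add: u_def br brS_def)
      finally show ?thesis using True by simp
    next
      case False
      then show ?thesis by (simp add: E_bracket_def N_to_E_def N_bracket_def set_plus_def)
    qed
  qed
qed

end

lemma complex_ring_sel [simp]:
  "carrier complex_ring = UNIV" "x \<otimes>\<^bsub>complex_ring\<^esub> y = x * y" "x \<oplus>\<^bsub>complex_ring\<^esub> y = x + y"
  "\<one>\<^bsub>complex_ring\<^esub> = 1" "\<zero>\<^bsub>complex_ring\<^esub> = 0"
  by (simp_all add: complex_ring_def)

lemma cring_complex_ring: "cring complex_ring"
proof (intro cringI abelian_groupI)
  show "Group.comm_monoid complex_ring" by (intro comm_monoidI) (simp_all add: mult_ac)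
  show "\<exists>y\<in>carrier complex_ring. y \<oplus>\<^bsub>complex_ring\<^esub> x = \<zero>\<^bsub>complex_ring\<^esub>" for x
    by (auto intro: exI[of _ "- x"])
qed (simp_all add: algebra_simps)

context nonneg_unit_form
begin

section \<open>The Lie algebra structure\<close>

abbreviation L where "L \<equiv> E_alg q B \<rho>"
abbreviation H where "H \<equiv> E_comp q 0"

lemma L_sel [simp]:
  "carrier L = E" "\<zero>\<^bsub>L\<^esub> = \<Gamma> 0"
  "x \<in> E \<Longrightarrow> y \<in> E \<Longrightarrow> x \<oplus>\<^bsub>L\<^esub> y = \<Gamma> (\<Phi> x + \<Phi> y)"
  "x \<in> E \<Longrightarrow> c \<odot>\<^bsub>L\<^esub> x = \<Gamma> (cscale c (\<Phi> x))"
  "x \<in> E \<Longrightarrow> y \<in> E \<Longrightarrow> x \<otimes>\<^bsub>L\<^esub> y = \<Gamma> (br (\<Phi> x) (\<Phi> y))"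
  by (simp_all add: E_alg_def gzero_eq gadd_eq gsmult_eq E_bracket_eq)

lemma \<Gamma>_inject: "x \<in> V \<Longrightarrow> y \<in> V \<Longrightarrow> \<Gamma> x = \<Gamma> y \<longleftrightarrow> x = y"
  by (metis \<Phi>_\<Gamma>)

lemma abelian_group_L: "abelian_group L"
proof (rule abelian_groupI)
  show "\<exists>y\<in>carrier L. y \<oplus>\<^bsub>L\<^esub> x = \<zero>\<^bsub>L\<^esub>" if "x \<in> carrier L" for x
    using that by (auto intro!: bexI[of _ "\<Gamma> (- \<Phi> x)"])
qed (simp_all add: add_ac)

lemma module_L: "Module.module complex_ring L"
  by (rule Module.moduleI[OF cring_complex_ring abelian_group_L]) (simp_all add: cscale_add_left)

lemma br_self:
  assumes "x \<in> V"
  shows "br x x = 0"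
proof -
  have "br x x = - br x x" by (rule br_antisym[OF assms assms])
  then have "cscale 2 (br x x) = 0"
    using cscale_add_left[of 1 1 "br x x"] by (simp add: eq_neg_iff_add_eq_0)
  then have "cscale (1 / 2) (cscale 2 (br x x)) = 0" by simp
  then show ?thesis by simp
qed

lemma br_jacobi:
  assumes "x \<in> V" "y \<in> V" "z \<in> V"
  shows "br x (br y z) + br y (br z x) + br z (br x y) = 0"
proof -
  have "br x (br y z) + br y (br z x) + br z (br x y) = - jac x y z"
    using br_antisym[of "br y z" x] br_antisym[of "br z x" y] br_antisym[of "br x y" z] assms
    by (simp add: jac_def)
  then show ?thesis using jac_zero[OF assms] by simp
qed

lemma lie_algebra_L: "complex_lie_algebra L"
  unfolding complex_lie_algebra_def complex_lie_algebra_axioms_def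
  using module_L by (simp add: br_add br_cscale br_self br_jacobi)

lemma \<Phi>_finsum:
  assumes "finite S" "f \<in> S \<rightarrow> E"
  shows "(\<Oplus>\<^bsub>L\<^esub>s\<in>S. f s) \<in> E" "\<Phi> (\<Oplus>\<^bsub>L\<^esub>s\<in>S. f s) = (\<Sum>s\<in>S. \<Phi> (f s))"
proof -
  interpret L: abelian_group L by (rule abelian_group_L)
  have "(\<Oplus>\<^bsub>L\<^esub>s\<in>S. f s) \<in> E \<and> \<Phi> (\<Oplus>\<^bsub>L\<^esub>s\<in>S. f s) = (\<Sum>s\<in>S. \<Phi> (f s))"
    using assms
  proof (induction S)
    case (insert s S)
    then have "(\<Sum>s\<in>S. \<Phi> (f s)) \<in> V" by (intro V_sum) (auto simp: Pi_iff)
    then show ?case using insert by (simp add: L.finsum_insert Pi_iff)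
  qed simp
  then show "(\<Oplus>\<^bsub>L\<^esub>s\<in>S. f s) \<in> E" "\<Phi> (\<Oplus>\<^bsub>L\<^esub>s\<in>S. f s) = (\<Sum>s\<in>S. \<Phi> (f s))" by auto
qed

definition form :: "'n gelt \<Rightarrow> 'n gelt \<Rightarrow> complex" where
  "form x y = bf (\<Phi> x) (\<Phi> y)"

lemma EA1_L: "EA1 L form"
  unfolding EA1_def bilinear_form_on_def
proof (intro conjI ballI impI allI)
  fix x assume "x \<in> carrier L" and z: "\<forall>y\<in>carrier L. form x y = 0"
  then have x: "x \<in> E" by simp
  have "bf (\<Phi> x) y = 0" if "y \<in> V" for y
    using z[rule_format, of "\<Gamma> y"] that by (simp add: form_def)
  then have "\<Phi> x = 0" using bf_nondegenerate x by simp
  then show "x = \<zero>\<^bsub>L\<^esub>" using \<Gamma>_\<Phi>[OF x] by simp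
next
  show "form x y = form y x" if "x \<in> carrier L" "y \<in> carrier L" for x y
    using that by (simp add: form_def bf_sym)
qed (simp_all add: form_def bf_add bf_cscale bf_invariant)

section \<open>Root spaces\<close>

lemma E_comp_iff: "x \<in> E_comp q \<alpha> \<longleftrightarrow> x \<in> E \<and> homog \<alpha> (\<Phi> x)"
  using supp_\<Phi>[of x] by (auto simp: gcomp_def homog_def)

lemma \<Gamma>_in_E_comp: "homog \<alpha> x \<Longrightarrow> \<Gamma> x \<in> E_comp q \<alpha>"
  using homog_D(1)[of \<alpha> x] by (simp add: E_comp_iff)

lemma homog_zero: "homog \<alpha> 0"
  by (simp add: homog_def)

lemma homog_add: "homog \<alpha> x \<Longrightarrow> homog \<alpha> y \<Longrightarrow> homog \<alpha> (x + y)"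
  using supp_add[of x y] by (auto simp: homog_def)

lemma homog_cscale: "homog \<alpha> x \<Longrightarrow> homog \<alpha> (cscale c x)"
  using supp_cscale[of c x] by (auto simp: homog_def)

lemma homog_minus: "homog \<alpha> x \<Longrightarrow> homog \<alpha> (- x)"
  using homog_cscale[of \<alpha> x "-1"] by (simp add: cscale_uminus)

lemma homog_not_root:
  assumes "homog \<alpha> x" "\<alpha> \<notin> roots q"
  shows "x = 0"
proof (rule coord_eqI)
  have "supp x = {}" using homog_D(1,2)[OF assms(1)] supp_in_roots[of x] assms(2) by blast
  then show "ec x \<beta> = ec 0 \<beta>" "pc x \<beta> = pc 0 \<beta>" for \<beta> by (auto simp: supp_def)
  have "\<alpha> \<noteq> 0" using assms(2) by (auto simp: roots_def)
  then show "df x v = df 0 v" for v using homog_D(5)[OF assms(1)] by simp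
qed

lemma ev_injective:
  assumes "\<And>h. homog 0 h \<Longrightarrow> ev \<alpha> h = ev \<beta> h"
  shows "\<alpha> = \<beta>"
proof -
  have "\<alpha> $ i = \<beta> $ i" for i
    using ev_separates[of i] assms by (metis of_int_eq_iff)
  then show ?thesis by (simp add: vec_eq_iff)
qed

lemma pcoset_0:
  assumes "x \<in> E" shows "pcoset x 0 = {pc (\<Phi> x) 0}"
  using pcoset_eq_\<Phi>[OF assms zero_null_root] by (simp add: WE_def elt_set_plus_def)

lemma root_emb_eq: "root_emb q \<rho> \<alpha> x = (if x \<in> H then ev \<alpha> (\<Phi> x) else 0)"
  by (simp add: root_emb_def ev_def E_comp_iff pcoset_0)

lemma inj_root_emb: "inj (root_emb q \<rho>)"
proof (rule injI)
  fix \<alpha> \<beta> assume eq: "root_emb q \<rho> \<alpha> = root_emb q \<rho> \<beta>"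
  show "\<alpha> = \<beta>"
  proof (rule ev_injective)
    fix h assume h: "homog 0 h"
    show "ev \<alpha> h = ev \<beta> h"
      using fun_cong[OF eq, of "\<Gamma> h"] \<Gamma>_in_E_comp[OF h] homog_D(1)[OF h] by (simp add: root_emb_eq)
  qed
qed

text \<open>The bracket with \<open>h\<close> multiplies the component of degree \<open>\<alpha>\<close> by \<open>\<alpha>(h)\<close> and every component by \<open>\<kappa>(h)\<close>.\<close>

lemma root_space_ev:
  assumes x: "x \<in> root_space L H \<kappa>" and \<alpha>: "\<alpha> \<in> supp (\<Phi> x) \<or> \<alpha> = 0 \<and> df (\<Phi> x) \<noteq> (\<lambda>_. 0)"
    and h: "homog 0 h"
  shows "\<kappa> (\<Gamma> h) = ev \<alpha> h"
proof -
  have xE: "x \<in> E" using x by (simp add: root_space_def)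
  have hV: "h \<in> V" and hH: "\<Gamma> h \<in> H" using h homog_D(1) \<Gamma>_in_E_comp by auto
  have "\<Gamma> h \<otimes>\<^bsub>L\<^esub> x = \<kappa> (\<Gamma> h) \<odot>\<^bsub>L\<^esub> x" using x hH by (simp add: root_space_def)
  then have eq: "br h (\<Phi> x) = cscale (\<kappa> (\<Gamma> h)) (\<Phi> x)" using xE hV by (simp add: \<Gamma>_inject)
  note e = br_degree_zero[OF h \<Phi>_in_V[OF xE]]
  have "ev \<gamma> h * ec (\<Phi> x) \<gamma> = \<kappa> (\<Gamma> h) * ec (\<Phi> x) \<gamma>" "ev \<gamma> h *s pc (\<Phi> x) \<gamma> = \<kappa> (\<Gamma> h) *s pc (\<Phi> x) \<gamma>"
    "\<kappa> (\<Gamma> h) * df (\<Phi> x) v = 0" for \<gamma> v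
    unfolding e(1,2)[symmetric] eq using e(3)[of v, unfolded eq] by (simp_all only: coord_sel)
  note eqs = this(1)[of \<alpha>] this(2)[of \<alpha>] this(3)
  consider "ec (\<Phi> x) \<alpha> \<noteq> 0" | "pc (\<Phi> x) \<alpha> \<noteq> 0" | v where "\<alpha> = 0" "df (\<Phi> x) v \<noteq> 0"
    using \<alpha> unfolding supp_def fun_eq_iff by blast
  then show ?thesis
  proof cases
    case (3 v)
    then show ?thesis using eqs(3)[of v] hV by (simp del: \<Phi>_sel)
  qed (use eqs(1,2) in \<open>simp_all del: \<Phi>_sel\<close>)
qed

lemma E_comp_root_space: "root_space L H (root_emb q \<rho> \<alpha>) = E_comp q \<alpha>"
proof (intro equalityI subsetI)
  fix x assume x: "x \<in> root_space L H (root_emb q \<rho> \<alpha>)"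
  then have xE: "x \<in> E" by (simp add: root_space_def)
  have ev: "\<beta> = \<alpha>" if \<beta>: "\<beta> \<in> supp (\<Phi> x) \<or> \<beta> = 0 \<and> df (\<Phi> x) \<noteq> (\<lambda>_. 0)" for \<beta>
  proof (rule ev_injective)
    fix h assume h: "homog 0 h"
    show "ev \<beta> h = ev \<alpha> h"
      using root_space_ev[OF x \<beta> h] \<Gamma>_in_E_comp[OF h] homog_D(1)[OF h] by (simp add: root_emb_eq)
  qed
  have "supp (\<Phi> x) \<subseteq> {\<alpha>}" using ev by blast
  moreover have "df (\<Phi> x) = (\<lambda>_. 0)" if "\<alpha> \<noteq> 0" using ev[of 0] that by metis
  ultimately have "homog \<alpha> (\<Phi> x)" using xE by (simp add: homog_def)
  then show "x \<in> E_comp q \<alpha>" using xE by (simp add: E_comp_iff)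
next
  fix x assume x: "x \<in> E_comp q \<alpha>"
  then have xE: "x \<in> E" and h: "homog \<alpha> (\<Phi> x)" by (simp_all add: E_comp_iff)
  have "y \<otimes>\<^bsub>L\<^esub> x = root_emb q \<rho> \<alpha> y \<odot>\<^bsub>L\<^esub> x" if "y \<in> H" for y
    using that xE br_H_homog[OF _ h, of "\<Phi> y"] by (simp add: root_emb_eq E_comp_iff)
  then show "x \<in> root_space L H (root_emb q \<rho> \<alpha>)" using xE by (simp add: root_space_def)
qed

text \<open>A basis vector has \<open>q(e\<^sub>i, e\<^sub>i) = 2\<close>, hence it is not in the radical and gives a non-zero element in each
  null degree.\<close>

lemma E_comp_nonzero:
  assumes "\<alpha> \<in> roots q" shows "E_comp q \<alpha> \<noteq> {\<Gamma> 0}"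
proof -
  have "\<exists>x. homog \<alpha> x \<and> x \<noteq> 0"
  proof (cases "\<alpha> \<in> real_roots q")
    case True
    have "ce 1 \<alpha> \<noteq> 0" using gens_sel(1)[of 1 \<alpha> \<alpha>] by force
    then show ?thesis using homog_gens(1)[OF True] by blast
  next
    case False
    then have n: "\<alpha> \<in> null_roots q" using assms by (simp add: roots_def)
    fix i :: 'n
    have "polar q (axis i 1) (axis i 1) = 2" by (simp add: polar_self unit)
    then have "polarC q (cvec (axis i 1)) (cvec (axis i 1)) = 2" by (simp only: polarC_cvec) simp
    then have "cvec (axis i 1) \<notin> radC q" unfolding mem_radC_iff by (metis zero_neq_numeral)
    then have "C \<alpha> (cvec (axis i 1)) \<noteq> 0"
      using C_eq_0_iff[of \<alpha> "cvec (axis i 1)"] radC_closed(1) by (auto simp: WE_def split: if_splits)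
    then have "cp \<alpha> (cvec (axis i 1)) \<noteq> 0" using gens_sel(5)[of \<alpha> "cvec (axis i 1)" \<alpha>] by force
    then show ?thesis using homog_gens(2)[OF n] by blast
  qed
  then obtain x where x: "homog \<alpha> x" "x \<noteq> 0" by blast
  then have "\<Gamma> x \<noteq> \<Gamma> 0" using homog_D(1) by (simp add: \<Gamma>_inject)
  then show ?thesis using \<Gamma>_in_E_comp[OF x(1)] by blast
qed

lemma root_emb_dual: "root_emb q \<rho> \<alpha> \<in> dual_of L H"
proof -
  have "ev \<alpha> (x + y) = ev \<alpha> x + ev \<alpha> y" "ev \<alpha> (cscale c x) = c * ev \<alpha> x" for x y c
    by (simp_all add: ev_def polarC_simps algebra_simps)
  then show ?thesis
    by (auto simp: dual_of_def functionals_def root_emb_eq E_comp_iff homog_add homog_cscale)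
qed

lemma root_system_L: "root_system L H = root_emb q \<rho> ` roots q"
proof (intro equalityI subsetI)
  fix \<kappa> assume \<kappa>: "\<kappa> \<in> root_system L H"
  then have d: "\<kappa> \<in> dual_of L H" and ne: "root_space L H \<kappa> \<noteq> {\<zero>\<^bsub>L\<^esub>}" by (auto simp: root_system_def)
  have "\<Gamma> 0 \<in> root_space L H \<kappa>" by (auto simp: root_space_def E_comp_iff)
  with ne obtain x where x: "x \<in> root_space L H \<kappa>" "x \<noteq> \<Gamma> 0" by auto
  then have xE: "x \<in> E" by (simp add: root_space_def)
  have "\<exists>\<alpha>. \<alpha> \<in> supp (\<Phi> x) \<or> \<alpha> = 0 \<and> df (\<Phi> x) \<noteq> (\<lambda>_. 0)"
  proof (rule ccontr)
    assume "\<not> ?thesis"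
    then have "\<Phi> x = 0" by (intro coord_eqI) (auto simp: supp_def simp del: \<Phi>_sel)
    then show False using x(2) \<Gamma>_\<Phi>[OF xE] by simp
  qed
  then obtain \<alpha> where \<alpha>: "\<alpha> \<in> supp (\<Phi> x) \<or> \<alpha> = 0 \<and> df (\<Phi> x) \<noteq> (\<lambda>_. 0)" by blast
  have "\<kappa> y = root_emb q \<rho> \<alpha> y" for y
  proof (cases "y \<in> H")
    case True
    then have "homog 0 (\<Phi> y)" "\<Gamma> (\<Phi> y) = y" by (simp_all add: E_comp_iff)
    then show ?thesis using root_space_ev[OF x(1) \<alpha>, of "\<Phi> y"] True by (simp add: root_emb_eq)
  next
    case False
    then show ?thesis using d by (simp add: root_emb_eq dual_of_def functionals_def)
  qed
  moreover have "\<alpha> \<in> roots q"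
    using \<alpha> supp_in_roots[OF \<Phi>_in_V[OF xE]] by (auto simp: roots_def)
  ultimately show "\<kappa> \<in> root_emb q \<rho> ` roots q" by (intro image_eqI[of _ _ \<alpha>]) auto
next
  fix \<kappa> assume "\<kappa> \<in> root_emb q \<rho> ` roots q"
  then show "\<kappa> \<in> root_system L H"
    using root_emb_dual E_comp_root_space E_comp_nonzero by (auto simp: root_system_def)
qed

section \<open>The axioms of an extended affine Lie algebra\<close>

lemma submodule_H: "submodule H complex_ring L"
proof (rule Module.module.submoduleI[OF module_L])
  interpret L: abelian_group L by (rule abelian_group_L)
  show "\<ominus>\<^bsub>L\<^esub> a \<in> H" if "a \<in> H" for a
  proof -
    have "\<Gamma> (- \<Phi> a) \<oplus>\<^bsub>L\<^esub> a = \<zero>\<^bsub>L\<^esub>" using that by (simp add: E_comp_iff)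
    then have "\<ominus>\<^bsub>L\<^esub> a = \<Gamma> (- \<Phi> a)" using that by (intro L.minus_equality) (simp_all add: E_comp_iff)
    then show ?thesis using that by (simp add: \<Gamma>_in_E_comp homog_minus E_comp_iff)
  qed
qed (auto simp: E_comp_iff homog_zero homog_add homog_cscale)

lemma dual_rad_expansion:
  assumes f: "f \<in> dual_rad"
  shows "f w = (\<Sum>i\<in>UNIV. f (\<rho> (axis i 1)) * coordf i w)"
proof (cases "w \<in> radC q")
  case True
  have lin: "f (\<rho> (u + v)) = f (\<rho> u) + f (\<rho> v)" "f (\<rho> (c *s u)) = c * f (\<rho> u)" "f (\<rho> 0) = 0" for u v c
    by (simp_all add: dual_rad_apply[OF f])
  have s: "f (\<rho> (\<Sum>i\<in>A. (w $ i) *s axis i 1)) = (\<Sum>i\<in>A. f (\<rho> (axis i 1)) * w $ i)" for A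
    by (induction A rule: infinite_finite_induct) (simp_all add: lin mult.commute del: \<rho>_simps)
  have "f w = f (\<rho> w)" using True by (simp add: \<rho>_radC)
  also have "\<dots> = (\<Sum>i\<in>UNIV. f (\<rho> (axis i 1)) * w $ i)" by (simp flip: s vec_axis_expansion)
  finally show ?thesis using True by (simp add: coordf_def)
next
  case False
  then show ?thesis using f by (simp add: functionals_def coordf_def)
qed

text \<open>The spanning family may have repetitions, since the coordinate functionals can coincide on the
  radical. Coefficients of equal members are added up.\<close>

lemma finite_dim_H: "finite_dim_subspace L H"
proof -
  \<comment> \<open>Basis vectors of \<open>\<complex>\<^sup>n\<close> and coordinate functions on the radical.\<close>
  define g :: "'n + 'n \<Rightarrow> 'n coord" where "g = case_sum (\<lambda>i. cp 0 (axis i 1)) (\<lambda>i. cd (coordf i))"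
  have gh: "homog 0 (g i)" for i by (cases i) (auto simp: g_def homog_gens)
  then have gV: "g i \<in> V" for i using homog_D(1) by blast
  have span: "\<exists>k. h = (\<Sum>i\<in>UNIV. cscale (k i) (g i))" if h: "homog 0 h" for h
  proof
    let ?k = "case_sum (\<lambda>i. pc h 0 $ i) (\<lambda>i. df h (\<rho> (axis i 1)))"
    let ?s = "(\<Sum>i\<in>UNIV. cscale (pc h 0 $ i) (cp 0 (axis i 1)))
        + (\<Sum>i\<in>UNIV. cscale (df h (\<rho> (axis i 1))) (cd (coordf i)))"
    have "(\<Sum>i\<in>UNIV. cscale (?k i) (g i)) = ?s"
      by (subst UNIV_Plus_UNIV[symmetric], subst sum.Plus) (simp_all add: g_def)
    also have "\<dots> = h"
    proof (rule coord_eqI)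
      show "ec ?s \<gamma> = ec h \<gamma>" for \<gamma>
        using homog_D(3)[OF h, of \<gamma>] V_D(2)[OF homog_D(1)[OF h] zero_not_real]
        by (cases "\<gamma> = 0") (simp_all add: coord_sum_sel)
      show "pc ?s \<gamma> = pc h \<gamma>" for \<gamma>
        using homog_D(4)[OF h, of \<gamma>] vec_axis_expansion[of "pc h 0", symmetric]
        by (cases "\<gamma> = 0") (simp_all add: coord_sum_sel C_zero)
      show "df ?s v = df h v" for v
        by (simp add: coord_sum_sel flip: dual_rad_expansion[OF V_D(5)[OF homog_D(1)[OF h]]])
    qed
    finally show "h = (\<Sum>i\<in>UNIV. cscale (?k i) (g i))" by simp
  qed
  have "\<exists>c. h = (\<Oplus>\<^bsub>L\<^esub>s\<in>\<Gamma> ` range g. c s \<odot>\<^bsub>L\<^esub> s)" if h: "h \<in> H" for h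
  proof -
    have hE: "h \<in> E" and hh: "homog 0 (\<Phi> h)" using h by (simp_all add: E_comp_iff)
    obtain k where k: "\<Phi> h = (\<Sum>i\<in>UNIV. cscale (k i) (g i))" using span[OF hh] by blast
    define c where "c s = (\<Sum>i | g i = \<Phi> s. k i)" for s
    have fsum: "cscale (\<Sum>i\<in>A. k i) y = (\<Sum>i\<in>A. cscale (k i) y)" for A :: "('n + 'n) set" and y
      by (induction A rule: infinite_finite_induct) (simp_all add: cscale_add_left)
    have closed: "(\<lambda>s. c s \<odot>\<^bsub>L\<^esub> s) \<in> \<Gamma> ` range g \<rightarrow> E" using gV by auto
    have "\<Phi> (\<Oplus>\<^bsub>L\<^esub>s\<in>\<Gamma> ` range g. c s \<odot>\<^bsub>L\<^esub> s) = (\<Sum>s\<in>\<Gamma> ` range g. \<Phi> (c s \<odot>\<^bsub>L\<^esub> s))"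
      by (rule \<Phi>_finsum(2)[OF _ closed]) simp
    also have "\<dots> = (\<Sum>y\<in>range g. \<Phi> (c (\<Gamma> y) \<odot>\<^bsub>L\<^esub> \<Gamma> y))"
      by (subst sum.reindex) (use gV in \<open>auto simp: inj_on_def \<Gamma>_inject\<close>)
    also have "\<dots> = (\<Sum>y\<in>range g. \<Sum>i | i \<in> UNIV \<and> g i = y. cscale (k i) (g i))"
    proof (rule sum.cong[OF refl])
      fix y assume "y \<in> range g"
      then have "y \<in> V" using gV by blast
      then show "\<Phi> (c (\<Gamma> y) \<odot>\<^bsub>L\<^esub> \<Gamma> y) = (\<Sum>i | i \<in> UNIV \<and> g i = y. cscale (k i) (g i))"
        by (simp add: c_def fsum V_sum)
    qed
    also have "\<dots> = \<Phi> h" unfolding k by (rule sum.image_gen[symmetric]) simp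
    finally have "(\<Oplus>\<^bsub>L\<^esub>s\<in>\<Gamma> ` range g. c s \<odot>\<^bsub>L\<^esub> s) = h"
      using \<Phi>_inject \<Phi>_finsum(1)[OF _ closed] hE by simp
    then show ?thesis by (intro exI[of _ c]) simp
  qed
  moreover have "finite (\<Gamma> ` range g)" "\<Gamma> ` range g \<subseteq> H" using gh \<Gamma>_in_E_comp by auto
  ultimately show ?thesis unfolding finite_dim_subspace_def using submodule_H by blast
qed

lemma homog_hpart: "x \<in> V \<Longrightarrow> \<alpha> \<in> supp x \<Longrightarrow> homog \<alpha> (hpart x \<alpha>) \<and> supp (hpart x \<alpha>) = {\<alpha>}"
proof -
  assume x: "x \<in> V" and \<alpha>: "\<alpha> \<in> supp x"
  have "homog \<alpha> (hpart x \<alpha>)"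
    using homog_gens supp_in_roots[OF x] \<alpha> by (auto simp: hpart_def roots_def)
  moreover have "\<alpha> \<in> supp (hpart x \<alpha>)"
    using \<alpha> V_D(2-4)[OF x, of \<alpha>] real_not_null[of \<alpha>] by (auto simp: supp_def hpart_def)
  ultimately show ?thesis using homog_D(2) by blast
qed

lemma diagonalizable_H:
  assumes h: "h \<in> H"
  shows "diagonalizable L (\<lambda>x. h \<otimes>\<^bsub>L\<^esub> x)"
  unfolding diagonalizable_def
proof
  fix x assume "x \<in> carrier L"
  then have xE: "x \<in> E" by simp
  define X where "X = \<Phi> x"
  have X: "X \<in> V" using xE by (simp add: X_def)
  have hE: "h \<in> E" and hh: "homog 0 (\<Phi> h)" using h by (simp_all add: E_comp_iff)
  \<comment> \<open>The non-zero components are distinct, and distinct from the functional, since their supports differ.\<close>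
  define T where "T = insert (cd (df X)) (hpart X ` supp X)"
  have fin: "finite T" using V_D(1)[OF X] by (simp add: T_def)
  have TV: "T \<subseteq> V" using homog_hpart[OF X] homog_D(1) V_D(5)[OF X] by (auto simp: T_def)
  have "inj_on (hpart X) (supp X)"
    using homog_hpart[OF X] by (intro inj_onI) (metis singleton_inject)
  moreover have "cd (df X) \<notin> hpart X ` supp X"
    using homog_hpart[OF X] supp_gens(3)[of "df X"] by force
  ultimately have sum: "(\<Sum>s\<in>T. s) = X"
    using V_decompose[OF X V_D(1)[OF X] order_refl] V_D(1)[OF X]
    by (simp add: T_def sum.reindex add.commute)
  have eig: "\<exists>c. br (\<Phi> h) s = cscale c s" if "s \<in> T" for s
  proof -
    have "\<exists>\<alpha>. homog \<alpha> s"
      using that homog_hpart[OF X] homog_gens(3)[OF V_D(5)[OF X]] by (auto simp: T_def)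
    then show ?thesis using br_H_homog[OF hh] by blast
  qed
  have TE: "(\<lambda>s. s) \<in> \<Gamma> ` T \<rightarrow> E" using TV \<Gamma>_in_E by blast
  then have "\<Phi> (\<Oplus>\<^bsub>L\<^esub>s\<in>\<Gamma> ` T. s) = (\<Sum>s\<in>\<Gamma> ` T. \<Phi> s)"
    using fin by (intro \<Phi>_finsum(2)) auto
  also have "\<dots> = (\<Sum>s\<in>T. \<Phi> (\<Gamma> s))"
    by (subst sum.reindex) (use TV in \<open>auto simp: inj_on_def \<Gamma>_inject subset_iff\<close>)
  also have "\<dots> = (\<Sum>s\<in>T. s)" using TV by (intro sum.cong) auto
  also have "\<dots> = \<Phi> x" by (simp add: sum X_def)
  finally have "(\<Oplus>\<^bsub>L\<^esub>s\<in>\<Gamma> ` T. s) = x"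
    using \<Phi>_inject[OF \<Phi>_finsum(1)[of "\<Gamma> ` T" "\<lambda>s. s", OF _ TE] xE] fin by simp
  moreover have "\<Gamma> ` T \<subseteq> {y \<in> carrier L. \<exists>c. h \<otimes>\<^bsub>L\<^esub> y = c \<odot>\<^bsub>L\<^esub> y}"
    using TV eig hE by (force simp: subset_iff)
  ultimately show "\<exists>S. finite S \<and> S \<subseteq> {y \<in> carrier L. \<exists>c. h \<otimes>\<^bsub>L\<^esub> y = c \<odot>\<^bsub>L\<^esub> y} \<and> x = (\<Oplus>\<^bsub>L\<^esub>s\<in>S. s)"
    using fin by (intro exI[of _ "\<Gamma> ` T"]) simp
qed

lemma centralizer_H: "{x \<in> carrier L. \<forall>h\<in>H. h \<otimes>\<^bsub>L\<^esub> x = \<zero>\<^bsub>L\<^esub>} = H"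
proof -
  have "root_emb q \<rho> 0 h \<odot>\<^bsub>L\<^esub> x = \<zero>\<^bsub>L\<^esub>" if "x \<in> E" "h \<in> H" for x h
    using that by (simp add: root_emb_eq E_comp_iff)
  then have "{x \<in> carrier L. \<forall>h\<in>H. h \<otimes>\<^bsub>L\<^esub> x = \<zero>\<^bsub>L\<^esub>} = root_space L H (root_emb q \<rho> 0)"
    by (auto simp: root_space_def simp del: L_sel(3-5))
  then show ?thesis by (simp add: E_comp_root_space)
qed

lemma EA2_L: "EA2 L H"
  unfolding EA2_def
proof (intro conjI ballI)
  show "H \<noteq> {\<zero>\<^bsub>L\<^esub>}" using E_comp_nonzero[of 0] by (simp add: roots_def)
  show "x \<otimes>\<^bsub>L\<^esub> y = \<zero>\<^bsub>L\<^esub>" if "x \<in> H" "y \<in> H" for x y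
    using that centralizer_H by blast
qed (use finite_dim_H centralizer_H diagonalizable_H in auto)

text \<open>Degree \<open>0\<close> is orthogonal to all other degrees.\<close>

lemma form_H_nondegenerate:
  assumes x: "homog 0 x" and z: "\<And>h. homog 0 h \<Longrightarrow> bf x h = 0"
  shows "x = 0"
proof (rule bf_nondegenerate)
  show xV: "x \<in> V" using homog_D(1)[OF x] .
  have e0: "ec x \<gamma> = 0" for \<gamma>
    using homog_D(3)[OF x] V_D(2)[OF xV zero_not_real] by metis
  show "bf x y = 0" if "y \<in> V" for y
    using that
  proof (induction y rule: V_induct)
    case (cp \<sigma> v)
    then show ?case using z[OF homog_gens(2)[of 0 v]] homog_D(4)[OF x, of "- \<sigma>"]
      by (cases "\<sigma> = 0") (auto simp: bf_cp[OF xV] polarC_simps)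
  next
    case (cd f)
    then show ?case using z homog_gens(3) by blast
  qed (use xV in \<open>simp_all add: bf_ce e0 bf_add\<close>)
qed

text \<open>The functional \<open>\<alpha>\<close> on \<open>H\<close> is represented by \<open>\<pi>\<^sub>0(\<alpha>)\<close>.\<close>

lemma dual_form_root_emb: "dual_form H form (root_emb q \<rho> \<alpha>) (root_emb q \<rho> \<beta>) = of_int (polar q \<alpha> \<beta>)"
proof -
  define t where "t \<alpha> = \<Gamma> (cp 0 (cvec \<alpha>))" for \<alpha>
  have tH: "t \<alpha> \<in> H" for \<alpha> by (simp add: t_def \<Gamma>_in_E_comp homog_gens)
  have rep: "form (t \<alpha>) h = root_emb q \<rho> \<alpha> h" if "h \<in> H" for \<alpha> h
    using that bf_sym[of "cp 0 (cvec \<alpha>)" "\<Phi> h"] bf_cp[of "\<Phi> h" 0 "cvec \<alpha>"]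
    by (simp add: form_def t_def root_emb_eq ev_def E_comp_iff)
  have "(THE t. t \<in> H \<and> (\<forall>h\<in>H. form t h = root_emb q \<rho> \<alpha> h)) = t \<alpha>" for \<alpha>
  proof (rule the_equality)
    fix s assume s: "s \<in> H \<and> (\<forall>h\<in>H. form s h = root_emb q \<rho> \<alpha> h)"
    have V: "\<Phi> s \<in> V" "\<Phi> (t \<alpha>) \<in> V" using s tH by (simp_all add: E_comp_iff)
    have m: "x - y = x + cscale (-1) y" for x y :: "'n coord" by (auto intro!: coord_eqI)
    have "\<Phi> s - \<Phi> (t \<alpha>) = 0"
    proof (rule form_H_nondegenerate)
      show "homog 0 (\<Phi> s - \<Phi> (t \<alpha>))"
        unfolding m using s tH by (intro homog_add homog_cscale) (simp_all add: E_comp_iff)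
      fix h assume h: "homog 0 h"
      then have "form s (\<Gamma> h) = form (t \<alpha>) (\<Gamma> h)" using s rep \<Gamma>_in_E_comp by simp
      then show "bf (\<Phi> s - \<Phi> (t \<alpha>)) h = 0"
        using V homog_D(1)[OF h] unfolding m by (simp add: bf_add bf_cscale form_def)
    qed
    then show "s = t \<alpha>" using s tH \<Phi>_inject by (simp add: E_comp_iff)
  qed (use tH rep in auto)
  then have "dual_form H form (root_emb q \<rho> \<alpha>) (root_emb q \<rho> \<beta>) = root_emb q \<rho> \<alpha> (t \<beta>)"
    by (simp add: dual_form_def rep[OF tH])
  also have "\<dots> = of_int (polar q \<alpha> \<beta>)"
    using tH[of \<beta>] by (simp add: root_emb_eq ev_def t_def C_zero polarC_cvec polar_commute)
  finally show ?thesis .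
qed

lemma nonisotropic_roots_L: "nonisotropic_roots L H form = root_emb q \<rho> ` real_roots q"
  unfolding nonisotropic_roots_def root_system_L
  by (auto simp: dual_form_root_emb polar_self roots_def null_roots_def real_roots_def)

text \<open>The value of \<open>q\<close> is \<open>9 + q(\<beta>) + 3 q(\<alpha>, \<beta>)\<close>, where \<open>q(\<alpha>, \<beta>)\<close> is at least \<open>-2\<close>, and \<open>0\<close> if \<open>\<beta>\<close> is null.\<close>

lemma add_three_not_root:
  assumes "\<alpha> \<in> real_roots q" "\<beta> \<in> roots q"
  shows "\<alpha> + (\<alpha> + (\<alpha> + \<beta>)) \<notin> roots q"
proof -
  have "q (\<alpha> + (\<alpha> + (\<alpha> + \<beta>))) = 9 + q \<beta> + 3 * polar q \<alpha> \<beta>"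
    using assms(1) unfolding q_add polar_simps polar_self by (simp add: real_roots_def)
  moreover have "polar q \<alpha> \<beta> \<ge> - 2 \<and> (q \<beta> = 0 \<longrightarrow> polar q \<alpha> \<beta> = 0)"
    using assms nonneg[of "\<alpha> + \<beta>"] null_root_polar[of \<beta> \<alpha>]
    by (auto simp: roots_def real_roots_def null_roots_def q_add polar_commute)
  ultimately show ?thesis using assms(2) by (auto simp: roots_def real_roots_def null_roots_def)
qed

lemma ad_cube_zero:
  assumes \<alpha>: "\<alpha> \<in> real_roots q" and x: "homog \<alpha> x" and y: "y \<in> V"
  shows "br x (br x (br x y)) = 0"
  using y
proof (induction y rule: homog_induct)
  case (homog \<beta> y)
  then show ?case using br_homog x add_three_not_root[OF \<alpha>] homog_not_root by metis
next
  case (add y y')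
  then show ?case using homog_D(1)[OF x] by (simp add: br_add)
qed

lemma EA3_L: "EA3 L H form"
  unfolding EA3_def nonisotropic_roots_L
proof (intro ballI)
  fix \<kappa> x y assume "\<kappa> \<in> root_emb q \<rho> ` real_roots q" and x: "x \<in> root_space L H \<kappa>" and y: "y \<in> carrier L"
  then obtain \<alpha> where \<alpha>: "\<alpha> \<in> real_roots q" "x \<in> E_comp q \<alpha>" using E_comp_root_space by auto
  then have "homog \<alpha> (\<Phi> x)" "x \<in> E" by (simp_all add: E_comp_iff)
  then have "((\<lambda>z. x \<otimes>\<^bsub>L\<^esub> z) ^^ 3) y = \<zero>\<^bsub>L\<^esub>"
    using ad_cube_zero[OF \<alpha>(1), of "\<Phi> x" "\<Phi> y"] y by (simp add: numeral_3_eq_3)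
  then show "\<exists>k. ((\<lambda>z. x \<otimes>\<^bsub>L\<^esub> z) ^^ k) y = \<zero>\<^bsub>L\<^esub>" by blast
qed

text \<open>Suitable elements of \<open>H\<close> take integral values on the roots and separate them.\<close>

lemma EA4_L: "EA4 L H"
  unfolding EA4_def root_system_L
proof (rule discreteI)
  fix \<kappa> assume "\<kappa> \<in> root_emb q \<rho> ` roots q"
  then obtain \<alpha> where \<alpha>: "\<alpha> \<in> roots q" "\<kappa> = root_emb q \<rho> \<alpha>" by blast
  obtain h where h: "\<And>i. homog 0 (h i)" "\<And>i \<beta>. ev \<beta> (h i) = of_int (\<beta> $ i)"
    using ev_separates by metis
  have emb: "root_emb q \<rho> \<beta> (\<Gamma> (h i)) = of_int (\<beta> $ i)" for \<beta> i
    using \<Gamma>_in_E_comp[OF h(1)[of i]] homog_D(1)[OF h(1)[of i]] h(2) by (simp add: root_emb_eq)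
  \<comment> \<open>A neighbourhood in which every entry of the root is fixed up to less than \<open>1\<close>.\<close>
  define T where "T = (\<Inter>i\<in>UNIV. (\<lambda>f. f (\<Gamma> (h i))) -` ball (of_int (\<alpha> $ i)) 1 :: ('n gelt \<Rightarrow> complex) set)"
  have "open T"
    unfolding T_def by (intro open_INT ballI open_vimage open_ball continuous_on_product_coordinates) simp
  moreover have "T \<inter> root_emb q \<rho> ` roots q = {\<kappa>}"
  proof -
    have "\<beta> = \<alpha>" if "root_emb q \<rho> \<beta> \<in> T" for \<beta>
    proof -
      have "\<beta> $ i = \<alpha> $ i" for i
      proof -
        have "dist (complex_of_int (\<alpha> $ i)) (of_int (\<beta> $ i)) < 1" using that by (simp add: T_def emb)
        then have "norm (complex_of_int (\<alpha> $ i - \<beta> $ i)) < 1" by (simp add: dist_norm)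
        then have "\<bar>\<alpha> $ i - \<beta> $ i\<bar> < 1" unfolding norm_of_int by linarith
        then show ?thesis by simp
      qed
      then show ?thesis by (simp add: vec_eq_iff)
    qed
    moreover have "\<kappa> \<in> T" by (simp add: T_def \<alpha> emb)
    ultimately show ?thesis using \<alpha> by blast
  qed
  ultimately show "\<kappa> isolated_in root_emb q \<rho> ` roots q"
    unfolding isolated_in_def using \<alpha> by blast
qed

text \<open>By connectivity, an orthogonal decomposition has all basis vectors on one side. A real root \<open>\<alpha>\<close> on the
  other side would be orthogonal to all of them, hence to itself, contrary to \<open>q(\<alpha>, \<alpha>) = 2\<close>.\<close>

lemma EA5_L:
  assumes conn: "\<And>i j. (i, j) \<in> {(i, j). polar q (axis i 1) (axis j 1) \<noteq> 0}\<^sup>*"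
  shows "EA5 L H form"
  unfolding EA5_def nonisotropic_roots_L
proof
  assume "\<exists>R1 R2. R1 \<noteq> {} \<and> R2 \<noteq> {} \<and> R1 \<inter> R2 = {} \<and> R1 \<union> R2 = root_emb q \<rho> ` real_roots q \<and>
    (\<forall>\<kappa>\<in>R1. \<forall>\<mu>\<in>R2. dual_form H form \<kappa> \<mu> = 0)"
  then obtain R1 R2 where R: "R1 \<noteq> {}" "R2 \<noteq> {}" "R1 \<inter> R2 = {}" "R1 \<union> R2 = root_emb q \<rho> ` real_roots q"
    "\<forall>\<kappa>\<in>R1. \<forall>\<mu>\<in>R2. dual_form H form \<kappa> \<mu> = 0" by (elim exE conjE)
  let ?a = "\<lambda>i. root_emb q \<rho> (axis i 1)"
  have ax: "?a i \<in> R1 \<union> R2" for i unfolding R(4) by (intro imageI) (simp add: real_roots_def unit)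
  have orth: "polar q \<alpha> \<beta> = 0" "polar q \<beta> \<alpha> = 0"
    if "root_emb q \<rho> \<alpha> \<in> R1" "root_emb q \<rho> \<beta> \<in> R2" for \<alpha> \<beta>
    using R(5)[rule_format, OF that] by (simp_all add: dual_form_root_emb polar_commute)
  have edge: "?a i \<in> R1 \<longleftrightarrow> ?a j \<in> R1" if p: "polar q (axis i 1) (axis j 1) \<noteq> 0" for i j
  proof
    show "?a j \<in> R1" if "?a i \<in> R1"
      using orth(1)[OF that, of "axis j 1"] p ax[of j] by auto
    show "?a i \<in> R1" if "?a j \<in> R1"
      using orth(2)[OF that, of "axis i 1"] p ax[of i] by auto
  qed
  have all: "?a i \<in> R1 \<longleftrightarrow> ?a j \<in> R1" for i j
    using conn[of i j]
  proof (induction rule: rtrancl_induct)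
    case (step j k)
    then show ?case using edge[of j k] by simp
  qed simp
  have false: False if "\<alpha> \<in> real_roots q" "\<And>i. polar q \<alpha> (axis i 1) = 0" for \<alpha>
  proof -
    have p: "polar q \<alpha> (k *s y) = k * polar q \<alpha> y" for k y by (simp add: polar_eq_B B_scale algebra_simps)
    have "polar q \<alpha> (\<Sum>i\<in>A. (\<alpha> $ i) *s axis i 1) = 0" for A
      by (induction A rule: infinite_finite_induct) (simp_all add: polar_simps p that)
    from this[of UNIV] have "polar q \<alpha> \<alpha> = 0" by (simp flip: vec_axis_expansion)
    then show False using that(1) by (simp add: polar_self real_roots_def)
  qed
  fix i0 :: 'n
  show False
  proof (cases "?a i0 \<in> R1")
    case True
    obtain \<kappa> where \<kappa>: "\<kappa> \<in> R2" using R(2) by blast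
    then have "\<kappa> \<in> R1 \<union> R2" by blast
    then obtain \<alpha> where \<alpha>: "\<alpha> \<in> real_roots q" "root_emb q \<rho> \<alpha> \<in> R2" using \<kappa> unfolding R(4) by auto
    have "polar q \<alpha> (axis i 1) = 0" for i
      using orth(2)[OF _ \<alpha>(2), of "axis i 1"] all[of i i0] True by simp
    then show False by (rule false[OF \<alpha>(1)])
  next
    case False
    have r2: "?a i \<in> R2" for i using all[of i i0] ax[of i] False by blast
    obtain \<kappa> where \<kappa>: "\<kappa> \<in> R1" using R(1) by blast
    then have "\<kappa> \<in> R1 \<union> R2" by blast
    then obtain \<alpha> where \<alpha>: "\<alpha> \<in> real_roots q" "root_emb q \<rho> \<alpha> \<in> R1" using \<kappa> unfolding R(4) by auto
    show False by (rule false[OF \<alpha>(1) orth(1)[OF \<alpha>(2) r2]])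
  qed
qed

theorem E_is_EALA:
  assumes "\<And>i j. (i, j) \<in> {(i, j). polar q (axis i 1) (axis j 1) \<noteq> 0}\<^sup>*"
  shows "E_is_EALA_with_roots q B \<rho>"
  unfolding E_is_EALA_with_roots_def extended_affine_lie_algebra_def
  using lie_algebra_L EA1_L EA2_L EA3_L EA4_L EA5_L[OF assms] inj_root_emb root_system_L E_comp_root_space
  by (intro conjI exI[of _ form] ballI)

end

section \<open>Additive maps between lattices\<close>

text \<open>The function \<open>g\<close> stands for integer multiples in the target, which are written differently for
  integers and for vectors.\<close>

lemma additive_int_scale:
  fixes f :: "int^'n::finite \<Rightarrow> 'b::{ab_group_add}" and g :: "int \<Rightarrow> 'b \<Rightarrow> 'b"
  assumes f: "Modules.additive f" and g: "\<And>x. g 0 x = 0" "\<And>k x. g (k + 1) x = g k x + x" "\<And>k x. g (k - 1) x = g k x - x"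
  shows "f (k *s x) = g k (f x)"
proof (induction k rule: int_induct[where k = 0])
  case base
  show ?case using additive.zero[OF f] g by simp
next
  case (step1 i)
  then show ?case by (simp add: vector_sadd_rdistrib additive.add[OF f] g)
next
  case (step2 i)
  then show ?case by (simp add: vec.scale_left_diff_distrib additive.diff[OF f] g)
qed

lemma additive_eqI:
  fixes f g :: "int^'n::finite \<Rightarrow> int"
  assumes f: "Modules.additive f" and g: "Modules.additive g" and eq: "\<And>i. f (axis i 1) = g (axis i 1)"
  shows "f x = g x"
proof -
  have s: "h (k *s x) = k * h x" if "Modules.additive h" for h :: "int^'n \<Rightarrow> int" and k x
    by (rule additive_int_scale[OF that]) (simp_all add: algebra_simps)
  have e: "h x = (\<Sum>i\<in>UNIV. x $ i * h (axis i 1))" if "Modules.additive h" for h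
    by (subst vec_axis_expansion[of x]) (simp add: additive.sum[OF that] s[OF that])
  show ?thesis by (simp add: e[OF f] e[OF g] eq)
qed

text \<open>The \<open>\<complex>\<close>-linear extension of an additive map between lattices.\<close>

definition extC :: "(int^'n::finite \<Rightarrow> int^'m::finite) \<Rightarrow> complex^'n \<Rightarrow> complex^'m" where
  "extC \<psi> v = (\<Sum>i\<in>UNIV. (v $ i) *s cvec (\<psi> (axis i 1)))"

lemma extC_simps [simp]:
  "extC \<psi> (v + w) = extC \<psi> v + extC \<psi> w" "extC \<psi> (v - w) = extC \<psi> v - extC \<psi> w"
  "extC \<psi> (- v) = - extC \<psi> v" "extC \<psi> (c *s v) = c *s extC \<psi> v" "extC \<psi> 0 = 0"
  by (simp_all add: extC_def vec.scale_left_distrib vec.scale_left_diff_distrib sum.distrib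
      sum_subtractf sum_negf vec.scale_sum_right)

lemma extC_sum: "extC \<psi> (sum f A) = (\<Sum>i\<in>A. extC \<psi> (f i))"
  by (induction A rule: infinite_finite_induct) simp_all

lemma extC_cvec:
  assumes "Modules.additive \<psi>"
  shows "extC \<psi> (cvec x) = cvec (\<psi> x)"
proof -
  have s: "\<psi> (k *s x) = k *s \<psi> x" for k x
    by (rule additive_int_scale[OF assms]) (simp_all add: vector_sadd_rdistrib vec.scale_left_diff_distrib)
  have c: "cvec (\<Sum>i\<in>A. f i) = (\<Sum>i\<in>A. cvec (f i))" for A and f :: "'a \<Rightarrow> int^'b"
    by (induction A rule: infinite_finite_induct) simp_all
  have "\<psi> x = (\<Sum>i\<in>UNIV. (x $ i) *s \<psi> (axis i 1))"
    by (subst vec_axis_expansion[of x]) (simp add: additive.sum[OF assms] s)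
  then have "cvec (\<psi> x) = (\<Sum>i\<in>UNIV. cvec ((x $ i) *s \<psi> (axis i 1)))" by (simp only: c)
  moreover have "cvec ((x $ i) *s y) = (cvec x $ i) *s cvec y" for i and y :: "int^'b"
    by (simp add: cvec_def vec_eq_iff)
  ultimately show ?thesis by (simp add: extC_def)
qed

lemma additive_inv:
  assumes "Modules.additive \<psi>" "bij \<psi>"
  shows "Modules.additive (inv_into UNIV \<psi>)"
  by (rule additive.intro)
    (metis additive.add[OF assms(1)] assms(2) bij_inv_eq_iff)

lemma extC_inverse:
  assumes "Modules.additive \<psi>" "bij \<psi>"
  shows "extC (inv_into UNIV \<psi>) (extC \<psi> v) = v" "extC \<psi> (extC (inv_into UNIV \<psi>) w) = w"
proof -
  have g: "extC \<xi> (extC \<psi> v) = v" if "Modules.additive \<xi>" "Modules.additive \<psi>" "\<And>x. \<xi> (\<psi> x) = x"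
    for \<xi> :: "int^'c \<Rightarrow> int^'d" and \<psi> :: "int^'d \<Rightarrow> int^'c" and v
  proof -
    have "extC \<xi> (extC \<psi> v) = (\<Sum>i\<in>UNIV. (v $ i) *s cvec (axis i 1))"
      by (simp add: extC_def[of \<psi>] extC_sum extC_cvec[OF that(1)] that(3))
    then show ?thesis by (simp add: cvec_axis flip: vec_axis_expansion)
  qed
  note a = additive_inv[OF assms]
  show "extC (inv_into UNIV \<psi>) (extC \<psi> v) = v" by (rule g[OF a assms(1)]) (simp add: assms(2) bij_is_inj)
  show "extC \<psi> (extC (inv_into UNIV \<psi>) w) = w" by (rule g[OF assms(1) a]) (simp add: assms(2) bij_is_surj surj_f_inv_f)
qed

lemma lattice_iso_card:
  fixes \<psi> :: "int^'n::finite \<Rightarrow> int^'m::finite"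
  assumes "Modules.additive \<psi>" "bij \<psi>"
  shows "CARD('n) = CARD('m)"
proof -
  have lin: "Vector_Spaces.linear (*s) (*s) (extC \<psi>)"
    by unfold_locales (simp_all add: vec.scale_right_distrib vec.scale_left_distrib)
  have "inj (extC \<psi>)" by (metis injI extC_inverse(1)[OF assms])
  moreover have "range (extC \<psi>) = UNIV" using extC_inverse(2)[OF assms] by (metis surjI)
  ultimately have "vec.dim (UNIV :: (complex^'m) set) = vec.dim (UNIV :: (complex^'n) set)"
    using vec.dim_image_eq[OF lin, of UNIV] by simp
  then show ?thesis by (simp only: vec_dim_card)
qed

section \<open>Unit forms and their coefficients\<close>

lemma has_coeffs_axis:
  assumes "has_coeffs q c"
  shows "q (axis i 1) = 1" "i < j \<Longrightarrow> polar q (axis i 1) (axis j 1) = c i j"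
proof -
  have ax: "axis k (1::int) $ l = (if l = k then 1 else 0)" for k l :: 'a by (simp add: axis_def)
  have q: "q x = (\<Sum>i\<in>UNIV. (x $ i)\<^sup>2) + (\<Sum>(i, j)\<in>{(i, j). i < j}. c i j * x $ i * x $ j)" for x
    using assms by (simp add: has_coeffs_def)
  show one: "q (axis i 1) = 1" for i
  proof -
    have "(\<Sum>k\<in>UNIV. (axis i (1::int) $ k)\<^sup>2) = (\<Sum>k\<in>UNIV. if k = i then 1 else 0)"
      by (intro sum.cong) (auto simp: ax)
    moreover have "(\<Sum>(k, l)\<in>{(k, l). k < l}. c k l * axis i (1::int) $ k * axis i 1 $ l) = 0"
      by (intro sum.neutral) (auto simp: ax)
    ultimately show ?thesis by (simp add: q)
  qed
  show "polar q (axis i 1) (axis j 1) = c i j" if ij: "i < j"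
  proof -
    have "(\<Sum>k\<in>UNIV. ((axis i (1::int) + axis j 1) $ k)\<^sup>2)
        = (\<Sum>k\<in>UNIV. (if k = i then 1 else 0) + (if k = j then 1 else 0))"
      using ij by (intro sum.cong) (auto simp: ax)
    then have 1: "(\<Sum>k\<in>UNIV. ((axis i (1::int) + axis j 1) $ k)\<^sup>2) = 2" by (simp add: sum.distrib)
    have "(\<Sum>(k, l)\<in>{(k, l). k < l}. c k l * (axis i (1::int) + axis j 1) $ k * (axis i 1 + axis j 1) $ l)
        = (\<Sum>p\<in>{(k, l). k < l}. if p = (i, j) then c i j else 0)"
      using ij by (intro sum.cong refl) (auto simp: ax split: if_splits)
    also have "\<dots> = c i j" using ij by (subst sum.delta) auto
    finally have "q (axis i 1 + axis j 1) = 2 + c i j" by (simp only: q 1)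
    then show ?thesis by (simp add: polar_def one)
  qed
qed

lemma unit_formD:
  assumes "unit_form q" "nonneg_form q" "admissible_choice q B \<rho>"
  shows "nonneg_unit_form q B \<rho>"
  using assms has_coeffs_axis(1) by unfold_locales (auto simp: unit_form_def nonneg_form_def)

lemma connected_polar:
  assumes "connected_form q"
  shows "(i, j) \<in> {(i, j). polar q (axis i 1) (axis j 1) \<noteq> 0}\<^sup>*"
proof -
  obtain c where c: "has_coeffs q c"
    "(i, j) \<in> {(i, j). (i < j \<and> c i j \<noteq> 0) \<or> (j < i \<and> c j i \<noteq> 0)}\<^sup>*"
    using assms by (auto simp: connected_form_def)
  have "polar q (axis i 1) (axis j 1) \<noteq> 0" if "(i < j \<and> c i j \<noteq> 0) \<or> (j < i \<and> c j i \<noteq> 0)" for i j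
    using that has_coeffs_axis(2)[OF c(1), of i j] has_coeffs_axis(2)[OF c(1), of j i]
    by (auto simp: polar_def add.commute)
  then show ?thesis using c(2) rtrancl_mono[of "{(i, j). (i < j \<and> c i j \<noteq> 0) \<or> (j < i \<and> c j i \<noteq> 0)}"
        "{(i, j). polar q (axis i 1) (axis j 1) \<noteq> 0}"] by blast
qed

section \<open>The root system determines the form\<close>

text \<open>The double of a real root \<open>\<alpha>\<close> has \<open>q(2\<alpha>) = 4\<close>.\<close>

lemma (in nonneg_unit_form) null_roots_double: "\<alpha> \<in> null_roots q \<longleftrightarrow> \<alpha> \<in> roots q \<and> \<alpha> + \<alpha> \<in> roots q"
proof -
  have "q (\<alpha> + \<alpha>) = 4 * q \<alpha>" by (simp only: q_add polar_self)
  then show ?thesis unfolding null_roots_def roots_def real_roots_def by auto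
qed

text \<open>Null roots are recognised by their doubles. For real roots \<open>\<alpha>\<close>, \<open>\<beta>\<close> the number \<open>q(\<alpha>, \<beta>)\<close> lies between
  \<open>-2\<close> and \<open>2\<close>, and it can be read off from which of \<open>\<alpha> + \<beta>\<close> and \<open>\<alpha> - \<beta>\<close> are real or null roots. The basis
  vectors are real roots, so this determines \<open>q\<close>.\<close>

lemma roots_determine_form:
  assumes A: "nonneg_unit_form q B \<rho>" and A': "nonneg_unit_form q' B' \<rho>'"
    and \<psi>: "Modules.additive \<psi>" "bij \<psi>" and R: "\<psi> ` roots q = roots q'"
  shows "q' (\<psi> x) = q x"
proof -
  interpret A: nonneg_unit_form q B \<rho> by (rule A)
  interpret A': nonneg_unit_form q' B' \<rho>' by (rule A')
  have add: "\<psi> (x + y) = \<psi> x + \<psi> y" and diff: "\<psi> (x - y) = \<psi> x - \<psi> y" for x y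
    by (simp_all add: additive.add[OF \<psi>(1)] additive.diff[OF \<psi>(1)])
  have roots: "\<psi> \<alpha> \<in> roots q' \<longleftrightarrow> \<alpha> \<in> roots q" for \<alpha>
    using R \<psi>(2) by (metis bij_is_inj inj_image_mem_iff)
  have null: "\<psi> \<alpha> \<in> null_roots q' \<longleftrightarrow> \<alpha> \<in> null_roots q" for \<alpha>
    by (simp only: A.null_roots_double A'.null_roots_double roots add[symmetric])
  have real: "\<psi> \<alpha> \<in> real_roots q' \<longleftrightarrow> \<alpha> \<in> real_roots q" for \<alpha>
    using roots[of \<alpha>] null[of \<alpha>] A.real_not_null A'.real_not_null by (auto simp: roots_def)
  have pol: "polar q' (\<psi> \<alpha>) (\<psi> \<beta>) = polar q \<alpha> \<beta>" if r: "\<alpha> \<in> real_roots q" "\<beta> \<in> real_roots q" for \<alpha> \<beta>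
  proof -
    have r': "\<psi> \<alpha> \<in> real_roots q'" "\<psi> \<beta> \<in> real_roots q'" using r real by simp_all
    have m: "- \<beta> \<in> real_roots q" "- \<psi> \<beta> \<in> real_roots q'" using r r' by simp_all
    have "polar q \<alpha> \<beta> = -1 \<longleftrightarrow> polar q' (\<psi> \<alpha>) (\<psi> \<beta>) = -1"
      using A.real_roots_add_iff(1)[OF r] A'.real_roots_add_iff(1)[OF r'] real[of "\<alpha> + \<beta>"] by (simp add: add)
    moreover have "polar q \<alpha> \<beta> = -2 \<longleftrightarrow> polar q' (\<psi> \<alpha>) (\<psi> \<beta>) = -2"
      using A.real_roots_add_iff(2)[OF r] A'.real_roots_add_iff(2)[OF r'] null[of "\<alpha> + \<beta>"] by (simp add: add)
    moreover have "polar q \<alpha> \<beta> = 1 \<longleftrightarrow> polar q' (\<psi> \<alpha>) (\<psi> \<beta>) = 1"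
      using A.real_roots_add_iff(1)[OF r(1) m(1)] A'.real_roots_add_iff(1)[OF r'(1) m(2)] real[of "\<alpha> - \<beta>"]
      by (simp add: diff A.polar_simps A'.polar_simps)
    moreover have "polar q \<alpha> \<beta> = 2 \<longleftrightarrow> polar q' (\<psi> \<alpha>) (\<psi> \<beta>) = 2"
      using A.real_roots_add_iff(2)[OF r(1) m(1)] A'.real_roots_add_iff(2)[OF r'(1) m(2)] null[of "\<alpha> - \<beta>"]
      by (simp add: diff A.polar_simps A'.polar_simps)
    ultimately show ?thesis
      using A.real_polar_bounds[OF r] A'.real_polar_bounds[OF r'] by presburger
  qed
  have "polar q' (\<psi> x) (\<psi> y) = polar q x y" for x y
  proof (rule additive_eqI[of "\<lambda>x. polar q' (\<psi> x) (\<psi> y)" "\<lambda>x. polar q x y"])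
    fix i
    show "polar q' (\<psi> (axis i 1)) (\<psi> y) = polar q (axis i 1) y"
      by (rule additive_eqI[of "\<lambda>y. polar q' (\<psi> (axis i 1)) (\<psi> y)" "\<lambda>y. polar q (axis i 1) y"])
        (auto intro!: additive.intro pol simp: add A.polar_simps A'.polar_simps real_roots_def A.unit)
  qed (auto intro!: additive.intro simp: add A.polar_simps A'.polar_simps)
  then show ?thesis using A.polar_self[of x] A'.polar_self[of "\<psi> x"] by simp
qed

section \<open>Equivalent forms have isomorphic Lie algebras\<close>

text \<open>An alternating form is \<open>D(x, y) = U(x, y) - U(y, x)\<close>, where \<open>U\<close> is given by the upper triangle of its
  matrix. Modulo \<open>2\<close> this is the polarisation of \<open>u(x) = U(x, x)\<close>.\<close>

lemma sign_of_alternating: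
  fixes D :: "int^'n::finite \<Rightarrow> int^'n \<Rightarrow> int"
  assumes a1: "\<And>y. Modules.additive (\<lambda>x. D x y)" and a2: "\<And>x. Modules.additive (D x)" and alt: "\<And>x. D x x = 0"
  shows "\<exists>u. \<forall>x y. even (u (x + y) - u x - u y - D x y)"
proof -
  obtain f :: "'n \<Rightarrow> nat" where f: "inj f" using finite_imp_inj_to_nat_seg[of "UNIV :: 'n set"] by auto
  define d where "d i j = D (axis i 1) (axis j 1)" for i j
  have skew: "D x y = - D y x" for x y
  proof -
    have "D (x + y) (x + y) = D x x + D x y + D y x + D y y"
      by (simp add: additive.add[OF a1] additive.add[OF a2])
    then show ?thesis by (simp add: alt)
  qed
  define w where "w i j = (if f i < f j then d i j else 0)" for i j
  have dw: "d i j = w i j - w j i" for i j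
    using skew[of "axis i 1" "axis j 1"] injD[OF f, of i j] alt[of "axis i 1"]
    by (cases "f i" "f j" rule: linorder_cases) (auto simp: d_def w_def)
  define U where "U x y = (\<Sum>i\<in>UNIV. \<Sum>j\<in>UNIV. w i j * x $ i * y $ j)" for x y :: "int^'n"
  have s: "h (k *s x) = k * h x" if "Modules.additive h" for h :: "int^'n \<Rightarrow> int" and k x
    by (rule additive_int_scale[OF that]) (simp_all add: algebra_simps)
  have e: "h x = (\<Sum>i\<in>UNIV. x $ i * h (axis i 1))" if "Modules.additive h" for h and x :: "int^'n"
    by (subst vec_axis_expansion[of x]) (simp add: additive.sum[OF that] s[OF that])
  have DU: "D x y = U x y - U y x" for x y
  proof -
    have "D x y = (\<Sum>i\<in>UNIV. x $ i * D (axis i 1) y)" by (rule e[OF a1])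
    also have "\<dots> = (\<Sum>i\<in>UNIV. x $ i * (\<Sum>j\<in>UNIV. y $ j * d i j))"
      unfolding d_def by (intro sum.cong refl arg_cong2[where f = "(*)"] e[OF a2])
    also have "\<dots> = (\<Sum>i\<in>UNIV. \<Sum>j\<in>UNIV. w i j * x $ i * y $ j - w j i * y $ j * x $ i)"
      by (simp add: dw sum_distrib_left algebra_simps)
    also have "\<dots> = U x y - (\<Sum>i\<in>UNIV. \<Sum>j\<in>UNIV. w j i * y $ j * x $ i)"
      by (simp only: sum_subtractf U_def)
    also have "(\<Sum>i\<in>UNIV. \<Sum>j\<in>UNIV. w j i * y $ j * x $ i) = U y x"
      unfolding U_def by (rule sum.swap)
    finally show ?thesis .
  qed
  have "U (x + y) (x + y) - U x x - U y y = U x y + U y x" for x y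
    by (simp add: U_def algebra_simps sum.distrib)
  then have "even (U (x + y) (x + y) - U x x - U y y - D x y)" for x y by (simp add: DU)
  then show ?thesis by (intro exI[of _ "\<lambda>x. U x x"] allI)
qed

text \<open>An isometry \<open>\<psi>\<close> induces an isomorphism of the Lie algebras. Its construction has to compensate that the
  choices of \<open>B\<close> and \<open>\<rho>\<close> on the two sides do not correspond under \<open>\<psi>\<close>.\<close>

locale form_isometry =
  A: nonneg_unit_form q B \<rho> + A': nonneg_unit_form q' B' \<rho>'
  for q :: "int^'n::finite \<Rightarrow> int" and B \<rho> and q' :: "int^'m::finite \<Rightarrow> int" and B' \<rho>' +
  fixes \<psi> :: "int^'n \<Rightarrow> int^'m"
  assumes \<psi>_additive: "Modules.additive \<psi>" and \<psi>_bij: "bij \<psi>" and q_\<psi>: "q' (\<psi> x) = q x"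
begin

abbreviation T where "T \<equiv> inv_into UNIV \<psi>"

lemma \<psi>_simps [simp]:
  "\<psi> (x + y) = \<psi> x + \<psi> y" "\<psi> (x - y) = \<psi> x - \<psi> y" "\<psi> (- x) = - \<psi> x" "\<psi> 0 = 0"
  by (simp_all add: additive.add[OF \<psi>_additive] additive.diff[OF \<psi>_additive]
      additive.minus[OF \<psi>_additive] additive.zero[OF \<psi>_additive])

lemma \<psi>_inverse [simp]: "T (\<psi> x) = x" "\<psi> (T y) = y"
  by (simp_all add: \<psi>_bij bij_is_inj bij_is_surj surj_f_inv_f)

lemma T_zero [simp]: "T 0 = 0"
  using \<psi>_inverse(1)[of 0] by simp

lemma \<psi>_eq_iff [simp]: "\<psi> x = \<psi> y \<longleftrightarrow> x = y"
  by (metis \<psi>_inverse(1))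

lemma \<psi>_eq_0 [simp]: "\<psi> x = 0 \<longleftrightarrow> x = 0"
  using \<psi>_eq_iff[of x 0] by simp

lemma T_eq_iff: "T y = x \<longleftrightarrow> y = \<psi> x"
  by (metis \<psi>_inverse)

lemma polar_\<psi> [simp]: "polar q' (\<psi> x) (\<psi> y) = polar q x y"
  by (simp add: polar_def q_\<psi> flip: \<psi>_simps(1))

lemma roots_\<psi> [simp]:
  "\<psi> \<alpha> \<in> null_roots q' \<longleftrightarrow> \<alpha> \<in> null_roots q" "\<psi> \<alpha> \<in> real_roots q' \<longleftrightarrow> \<alpha> \<in> real_roots q"
  "\<psi> \<alpha> \<in> roots q' \<longleftrightarrow> \<alpha> \<in> roots q"
  by (simp_all add: null_roots_def real_roots_def roots_def q_\<psi>)

lemma image_roots: "\<psi> ` roots q = roots q'"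
proof (intro equalityI subsetI)
  fix \<beta> assume "\<beta> \<in> roots q'"
  then have "T \<beta> \<in> roots q" using roots_\<psi>(3)[of "T \<beta>"] by simp
  then show "\<beta> \<in> \<psi> ` roots q" by (intro image_eqI[of _ _ "T \<beta>"]) simp_all
qed auto

abbreviation \<Psi> where "\<Psi> \<equiv> extC \<psi>"
abbreviation \<Psi>i where "\<Psi>i \<equiv> extC T"

lemma \<Psi>_cvec [simp]: "\<Psi> (cvec x) = cvec (\<psi> x)"
  by (rule extC_cvec[OF \<psi>_additive])

lemma \<Psi>_inverse [simp]: "\<Psi>i (\<Psi> v) = v" "\<Psi> (\<Psi>i w) = w"
  using extC_inverse[OF \<psi>_additive \<psi>_bij] by auto

lemma polarC_\<Psi> [simp]: "polarC q' (\<Psi> v) (\<Psi> w) = polarC q v w"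
proof -
  have "polarC q v w = (\<Sum>i\<in>UNIV. \<Sum>j\<in>UNIV. v $ i * (w $ j * of_int (polar q (axis i 1) (axis j 1))))"
    by (simp add: polarC_def mult.assoc)
  also have "\<dots> = polarC q' (\<Psi> v) (\<Psi> w)"
    by (subst sum.swap)
      (simp add: extC_def A'.polarC_sum A'.polarC_simps A'.polarC_cvec sum_distrib_left mult.left_commute)
  finally show ?thesis by simp
qed

lemma \<Psi>_radC [simp]: "\<Psi> v \<in> radC q' \<longleftrightarrow> v \<in> radC q"
  unfolding A.mem_radC_iff A'.mem_radC_iff by (metis polarC_\<Psi> \<Psi>_inverse(2))

lemma \<Psi>i_radC [simp]: "\<Psi>i w \<in> radC q \<longleftrightarrow> w \<in> radC q'"
  using \<Psi>_radC[of "\<Psi>i w"] by simp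

lemma \<Psi>_eq_0 [simp]: "\<Psi> v = 0 \<longleftrightarrow> v = 0"
  by (metis \<Psi>_inverse(1) extC_simps(5))

lemma dual_\<Psi> [simp]:
  "f \<in> A.dual_rad \<Longrightarrow> (\<lambda>v. f (\<Psi>i v)) \<in> A'.dual_rad" "g \<in> A'.dual_rad \<Longrightarrow> (\<lambda>v. g (\<Psi> v)) \<in> A.dual_rad"
  by (auto simp: functionals_def)

text \<open>The signs of the two Lie algebras differ by a coboundary.\<close>

lemma sign_exists:
  "\<exists>\<theta> :: int^'n \<Rightarrow> complex. \<forall>x y. \<theta> (x + y) = \<theta> x * \<theta> y * eps B x y * eps B' (\<psi> x) (\<psi> y) \<and> \<theta> x * \<theta> x = 1"
proof -
  define D where "D x y = B x y - B' (\<psi> x) (\<psi> y)" for x y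
  have "\<exists>u. \<forall>x y. even (u (x + y) - u x - u y - D x y)"
    by (rule sign_of_alternating)
      (auto intro!: additive.intro simp: D_def A.B_simps A'.B_simps q_\<psi> simp flip: A.q_eq_B A'.q_eq_B)
  then obtain u where u: "\<And>x y. even (u (x + y) - u x - u y - D x y)" by blast
  define \<theta> where "\<theta> x = (if even (u x) then 1 else -1 :: complex)" for x
  have eps: "eps B x y = (if even (B x y) then 1 else -1)" "eps B' z w = (if even (B' z w) then 1 else -1)" for x y z w
    by (auto simp: eps_def power_int_minus_left)
  have "\<theta> (x + y) = \<theta> x * \<theta> y * eps B x y * eps B' (\<psi> x) (\<psi> y)" for x y
    using u[of x y] by (auto simp: \<theta>_def eps D_def)
  moreover have "\<theta> x * \<theta> x = 1" for x by (simp add: \<theta>_def)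
  ultimately show ?thesis by blast
qed

definition \<theta> :: "int^'n \<Rightarrow> complex" where
  "\<theta> = (SOME \<theta>. \<forall>x y. \<theta> (x + y) = \<theta> x * \<theta> y * eps B x y * eps B' (\<psi> x) (\<psi> y) \<and> \<theta> x * \<theta> x = 1)"

lemma \<theta>_add: "\<theta> (x + y) = \<theta> x * \<theta> y * eps B x y * eps B' (\<psi> x) (\<psi> y)"
  and \<theta>_square [simp]: "\<theta> x * \<theta> x = 1"
proof -
  have "\<forall>x y. \<theta> (x + y) = \<theta> x * \<theta> y * eps B x y * eps B' (\<psi> x) (\<psi> y) \<and> \<theta> x * \<theta> x = 1"
    unfolding \<theta>_def by (rule someI_ex[OF sign_exists])
  then show "\<theta> (x + y) = \<theta> x * \<theta> y * eps B x y * eps B' (\<psi> x) (\<psi> y)" "\<theta> x * \<theta> x = 1"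
    by simp_all
qed

lemma \<theta>_nonzero [simp]: "\<theta> x \<noteq> 0"
  using \<theta>_square[of x] by force

lemma \<theta>_zero [simp]: "\<theta> 0 = 1"
proof -
  have "\<theta> 0 = \<theta> 0 * \<theta> 0" using \<theta>_add[of 0 0] by (simp add: A.eps_bilinear A'.eps_bilinear)
  then show ?thesis by simp
qed

lemma eps_\<theta>: "eps B x y * \<theta> (x + y) = \<theta> x * \<theta> y * eps B' (\<psi> x) (\<psi> y)"
proof -
  have "eps B x y * \<theta> (x + y) = \<theta> x * \<theta> y * (eps B x y * eps B x y) * eps B' (\<psi> x) (\<psi> y)"
    by (simp add: \<theta>_add mult_ac)
  then show ?thesis by (simp add: eps_simps)
qed

text \<open>The two projections onto the radical differ by a map that vanishes on the radical. A
  functional composed with it is represented by an element of \<open>\<complex>\<^sup>n\<close>, which corrects the image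
  of the functional.\<close>

lemma correction_exists:
  "\<exists>a. \<forall>f\<in>A.dual_rad. \<forall>v. polarC q (\<Sum>j\<in>UNIV. f (\<rho> (a j) - \<Psi>i (\<rho>' (\<Psi> (a j)))) *s axis j 1) v
     = f (\<rho> v) - f (\<Psi>i (\<rho>' (\<Psi> v)))"
proof -
  obtain a where a: "\<And>v. v - \<rho> v = (\<Sum>j\<in>UNIV. polarC q (axis j 1) v *s a j)"
    using A.complement_from_polar by blast
  have "polarC q (\<Sum>j\<in>UNIV. f (\<rho> (a j) - \<Psi>i (\<rho>' (\<Psi> (a j)))) *s axis j 1) v = f (\<rho> v) - f (\<Psi>i (\<rho>' (\<Psi> v)))"
    if f: "f \<in> A.dual_rad" for f v
  proof -
    define d where "d w = \<rho> w - \<Psi>i (\<rho>' (\<Psi> w))" for w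
    have d_rad: "d w \<in> radC q" for w
      unfolding d_def by (intro A.radC_closed A.\<rho>_in_radC) (simp add: A'.\<rho>_in_radC)
    have d_lin: "d (x + y) = d x + d y" "d (c *s x) = c *s d x" "d 0 = 0" for x y c
      by (simp_all add: d_def vec.scale_right_diff_distrib)
    have d_\<rho>: "d (\<rho> w) = 0" for w
      by (simp add: d_def A'.\<rho>_radC A.\<rho>_in_radC)
    have fd: "f (d (x + y)) = f (d x) + f (d y)" "f (d (c *s x)) = c * f (d x)" "f (d 0) = 0" for x y c
      using f d_rad A.dual_rad_apply(4)[OF f] by (auto simp: d_lin functionals_def)
  have fd_sum: "f (d (\<Sum>j\<in>S. g j *s a j)) = (\<Sum>j\<in>S. g j * f (d (a j)))" for S g
      by (induction S rule: infinite_finite_induct) (simp_all add: fd)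
    have "polarC q (\<Sum>j\<in>UNIV. f (d (a j)) *s axis j 1) v = (\<Sum>j\<in>UNIV. polarC q (axis j 1) v * f (d (a j)))"
      by (simp add: A.polarC_sum A.polarC_simps mult.commute)
    also have "\<dots> = f (d (v - \<rho> v))" by (simp only: a fd_sum)
    \<comment> \<open>The map \<open>d\<close> vanishes on the radical, so it depends on \<open>v - \<rho> v\<close> only.\<close>
    also have "d (v - \<rho> v) = d v"
      using d_lin(1)[of v "- \<rho> v"] d_lin(2)[of "-1" "\<rho> v"] d_\<rho>[of v] by simp
    also have "f (d v) = f (\<rho> v) - f (\<Psi>i (\<rho>' (\<Psi> v)))"
    proof -
      have "f (d v + \<Psi>i (\<rho>' (\<Psi> v))) = f (d v) + f (\<Psi>i (\<rho>' (\<Psi> v)))"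
        using f d_rad A'.\<rho>_in_radC by (simp add: functionals_def)
      then show ?thesis by (simp add: d_def)
    qed
    finally show ?thesis by (simp add: d_def)
  qed
  then show ?thesis by blast
qed

definition cor :: "'n \<Rightarrow> complex^'n" where
  "cor = (SOME a. \<forall>f\<in>A.dual_rad. \<forall>v. polarC q (\<Sum>j\<in>UNIV. f (\<rho> (a j) - \<Psi>i (\<rho>' (\<Psi> (a j)))) *s axis j 1) v
     = f (\<rho> v) - f (\<Psi>i (\<rho>' (\<Psi> v))))"

definition shift :: "(complex^'n \<Rightarrow> complex) \<Rightarrow> complex^'n" where
  "shift f = (\<Sum>j\<in>UNIV. f (\<rho> (cor j) - \<Psi>i (\<rho>' (\<Psi> (cor j)))) *s axis j 1)"

lemma polarC_shift:
  assumes "f \<in> A.dual_rad"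
  shows "polarC q (shift f) v = f (\<rho> v) - f (\<Psi>i (\<rho>' (\<Psi> v)))"
proof -
  have "\<forall>f\<in>A.dual_rad. \<forall>v. polarC q (shift f) v = f (\<rho> v) - f (\<Psi>i (\<rho>' (\<Psi> v)))"
    unfolding shift_def cor_def by (rule someI_ex[OF correction_exists])
  then show ?thesis using assms by simp
qed

lemma shift_linear [simp]:
  "shift (\<lambda>v. f v + g v) = shift f + shift g" "shift (\<lambda>v. c * f v) = c *s shift f" "shift (\<lambda>_. 0) = 0"
  by (simp_all add: shift_def vec.scale_left_distrib sum.distrib vec.scale_sum_right)

text \<open>On generators this is \<open>e\<^sub>\<alpha> \<mapsto> \<theta>(\<alpha>) e\<^bsub>\<psi>(\<alpha>)\<^esub>\<close>, \<open>\<pi>\<^sub>\<sigma>(v) \<mapsto> \<theta>(\<sigma>) \<pi>\<^bsub>\<psi>(\<sigma>)\<^esub>(\<psi>(v))\<close> and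
  \<open>\<xi> \<mapsto> \<xi> \<circ> \<psi>\<^sup>-\<^sup>1 + \<pi>\<^sub>0(\<psi>(shift \<xi>))\<close>.\<close>

definition \<phi> :: "'n coord \<Rightarrow> 'm coord" where
  "\<phi> x = Coord (\<lambda>\<beta>. \<theta> (T \<beta>) * ec x (T \<beta>))
     (\<lambda>\<tau>. A'.C \<tau> (\<theta> (T \<tau>) *s \<Psi> (pc x (T \<tau>))) + (if \<tau> = 0 then \<Psi> (shift (df x)) else 0))
     (\<lambda>v. df x (\<Psi>i v))"

lemma \<phi>_add: "\<phi> (x + y) = \<phi> x + \<phi> y"
  by (rule coord_eqI) (simp_all add: \<phi>_def algebra_simps vec.scale_right_distrib)

lemma \<phi>_cscale: "\<phi> (cscale c x) = cscale c (\<phi> x)"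
  by (rule coord_eqI) (simp_all add: \<phi>_def algebra_simps vec.scale_right_distrib)

lemma \<phi>_zero [simp]: "\<phi> 0 = 0"
  by (rule coord_eqI) (simp_all add: \<phi>_def)

lemma C_\<Psi>: "A'.C (\<psi> \<sigma>) (\<Psi> (A.C \<sigma> v)) = A'.C (\<psi> \<sigma>) (\<Psi> v)"
proof (cases "\<sigma> = 0")
  case False
  have "\<Psi> (\<rho> v) \<in> radC q'" by (simp add: A.\<rho>_in_radC)
  then have "A'.C (\<psi> \<sigma>) (\<Psi> (\<rho> v)) = 0" using False by (simp add: A'.C_def A'.\<rho>_radC)
  then show ?thesis using False by (simp add: A.C_def)
qed (simp add: A.C_def)

lemma \<phi>_gens:
  "\<phi> (A.ce c \<alpha>) = A'.ce (\<theta> \<alpha> * c) (\<psi> \<alpha>)"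
  "\<phi> (A.cp \<sigma> v) = A'.cp (\<psi> \<sigma>) (\<theta> \<sigma> *s \<Psi> v)"
  "\<phi> (A.cd f) = A'.cd (\<lambda>v. f (\<Psi>i v)) + A'.cp 0 (\<Psi> (shift f))"
  by (rule coord_eqI; auto simp: \<phi>_def T_eq_iff C_\<Psi> A'.C_zero)+

lemma \<phi>_in_V [simp]: "x \<in> A.V \<Longrightarrow> \<phi> x \<in> A'.V"
  by (induction x rule: A.V_induct) (simp_all add: \<phi>_gens \<phi>_add)



text \<open>For \<open>[\<xi>, e\<^sub>\<alpha>]\<close> the correction term contributes \<open>q(shift \<xi>, \<alpha>)\<close>, which is the difference of the two
  values \<open>\<xi>(\<rho>(\<alpha>))\<close>. It acts as zero on null degrees.\<close>

lemma \<phi>_br: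
  assumes "x \<in> A.V" and y: "y \<in> A.V"
  shows "\<phi> (A.br x y) = A'.br (\<phi> x) (\<phi> y)"
  using assms(1)
proof (induction x rule: A.V_induct)
  case x: (ce c \<alpha>)
  show ?case using y
  proof (induction y rule: A.V_induct)
    case (ce d \<beta>)
    have e: "eps B \<alpha> \<beta> * c * d * \<theta> (\<alpha> + \<beta>) = eps B' (\<psi> \<alpha>) (\<psi> \<beta>) * (\<theta> \<alpha> * c) * (\<theta> \<beta> * d)"
      using eps_\<theta>[of \<alpha> \<beta>] by (simp add: mult_ac)
    have "\<psi> \<alpha> + \<psi> \<beta> \<in> real_roots q' \<longleftrightarrow> \<alpha> + \<beta> \<in> real_roots q" "\<psi> \<alpha> + \<psi> \<beta> \<in> null_roots q' \<longleftrightarrow> \<alpha> + \<beta> \<in> null_roots q"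
      using roots_\<psi>[of "\<alpha> + \<beta>"] by simp_all
    then show ?case
      by (simp add: A.br_ce_ce A'.br_ce_ce \<phi>_gens mult.commute[of "\<theta> (\<alpha> + \<beta>)"] e)
  next
    case (cp \<sigma> v)
    have e: "eps B \<sigma> \<alpha> * polarC q v (cvec \<alpha>) * c * \<theta> (\<sigma> + \<alpha>)
        = eps B' (\<psi> \<sigma>) (\<psi> \<alpha>) * (\<theta> \<sigma> * polarC q v (cvec \<alpha>)) * (\<theta> \<alpha> * c)"
      using eps_\<theta>[of \<sigma> \<alpha>] by (simp add: mult_ac)
    have p: "polarC q' (\<Psi> v) (cvec (\<psi> \<alpha>)) = polarC q v (cvec \<alpha>)" by (simp flip: \<Psi>_cvec)
    show ?case using x cp
      by (simp add: A.br_cp_ce A'.br_cp_ce \<phi>_gens A'.polarC_simps mult.commute[of "\<theta> (\<sigma> + \<alpha>)"] e p)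
  next
    case (cd f)
    have p: "polarC q' (\<Psi> (shift f)) (cvec (\<psi> \<alpha>)) = f (\<rho> (cvec \<alpha>)) - f (\<Psi>i (\<rho>' (cvec (\<psi> \<alpha>))))"
      using polarC_shift[OF cd, of "cvec \<alpha>"] polarC_\<Psi>[of "shift f" "cvec \<alpha>"] by simp
    show ?case using x cd
      by (simp add: p A.br_gens A'.br_gens \<phi>_gens A'.br_add A'.gens_linear A'.eps_bilinear algebra_simps)
  next
    case (add y y')
    then show ?case by (simp add: A.br_add A'.br_add \<phi>_add)
  qed
next
  case x: (cp \<sigma> v)
  show ?case using y
  proof (induction y rule: A.V_induct)
    case (ce d \<beta>)
    have e: "eps B \<sigma> \<beta> * polarC q v (cvec \<beta>) * d * \<theta> (\<sigma> + \<beta>)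
        = eps B' (\<psi> \<sigma>) (\<psi> \<beta>) * (\<theta> \<sigma> * polarC q v (cvec \<beta>)) * (\<theta> \<beta> * d)"
      using eps_\<theta>[of \<sigma> \<beta>] by (simp add: mult_ac)
    have p: "polarC q' (\<Psi> v) (cvec (\<psi> \<beta>)) = polarC q v (cvec \<beta>)" by (simp flip: \<Psi>_cvec)
    show ?case using x ce
      by (simp add: A.br_cp_ce A'.br_cp_ce \<phi>_gens A'.polarC_simps mult.commute[of "\<theta> (\<sigma> + \<beta>)"] e p)
  next
    case (cp \<tau> w)
    have e: "eps B \<sigma> \<tau> * polarC q v w * \<theta> (\<sigma> + \<tau>) = eps B' (\<psi> \<sigma>) (\<psi> \<tau>) * (\<theta> \<tau> * (\<theta> \<sigma> * polarC q v w))"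
      using eps_\<theta>[of \<sigma> \<tau>] by (simp add: mult_ac)
    show ?case using x cp
      by (simp add: A.br_cp_cp A'.br_cp_cp \<phi>_gens A'.polarC_simps mult.commute[of "\<theta> (\<sigma> + \<tau>)"] e)
  next
    case (cd f)
    have "A'.br (A'.cp (\<psi> \<sigma>) (\<theta> \<sigma> *s \<Psi> v)) (A'.cp 0 (\<Psi> (shift f))) = 0"
    proof -

      have "A'.br (A'.cp (\<psi> \<sigma>) (\<theta> \<sigma> *s \<Psi> v)) (A'.cp 0 (\<Psi> (shift f)))
          = A'.cp (\<psi> \<sigma>) ((\<theta> \<sigma> * polarC q v (shift f)) *s cvec (\<psi> \<sigma>))"
        using x by (simp add: A'.br_cp_cp A'.eps_bilinear A'.polarC_simps)
      then show ?thesis using x by (simp add: A'.cp_null)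
    qed
    moreover have "\<rho>' (cvec (\<psi> \<sigma>)) = cvec (\<psi> \<sigma>)" "\<rho> (cvec \<sigma>) = cvec \<sigma>" "\<Psi>i (cvec (\<psi> \<sigma>)) = cvec \<sigma>"
      using x A'.\<rho>_null[of "\<psi> \<sigma>"] A.\<rho>_null[of \<sigma>] \<Psi>_inverse(1)[of "cvec \<sigma>"] by simp_all
    ultimately show ?case using x cd
      by (simp add: A.br_gens A'.br_cd_cp \<phi>_gens A'.br_add mult.commute)
  next
    case (add y y')
    then show ?case by (simp add: A.br_add A'.br_add \<phi>_add)
  qed
next
  case x: (cd f)
  show ?case using y
  proof (induction y rule: A.V_induct)
    case (ce d \<beta>)
    have p: "polarC q' (\<Psi> (shift f)) (cvec (\<psi> \<beta>)) = f (\<rho> (cvec \<beta>)) - f (\<Psi>i (\<rho>' (cvec (\<psi> \<beta>))))"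
      using polarC_shift[OF x, of "cvec \<beta>"] polarC_\<Psi>[of "shift f" "cvec \<beta>"] by simp
    show ?case using x ce
      by (simp add: p A.br_gens A'.br_gens \<phi>_gens A'.br_add A'.gens_linear A'.eps_bilinear algebra_simps)
  next
    case (cp \<tau> w)
    have "A'.br (A'.cp 0 (\<Psi> (shift f))) (A'.cp (\<psi> \<tau>) (\<theta> \<tau> *s \<Psi> w)) = 0"
      using cp by (simp add: A'.br_cp_cp)
    moreover have "\<rho>' (cvec (\<psi> \<tau>)) = cvec (\<psi> \<tau>)" "\<rho> (cvec \<tau>) = cvec \<tau>" "\<Psi>i (cvec (\<psi> \<tau>)) = cvec \<tau>"
      using cp A'.\<rho>_null[of "\<psi> \<tau>"] A.\<rho>_null[of \<tau>] \<Psi>_inverse(1)[of "cvec \<tau>"] by simp_all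
    ultimately show ?case using x cp
      by (simp add: A.br_gens A'.br_cd_cp \<phi>_gens A'.br_add mult.commute)
  next
    case (cd g)
    then show ?case using x
      by (simp add: A.br_gens A'.br_gens \<phi>_gens A'.br_add A.dual_rad_apply)
  next
    case (add y y')
    then show ?case by (simp add: A.br_add A'.br_add \<phi>_add)
  qed
next
  case (add x x')
  then show ?case using y by (simp add: A.br_add A'.br_add \<phi>_add)
qed

lemma \<phi>_homog:
  assumes "A.homog \<alpha> x"
  shows "A'.homog (\<psi> \<alpha>) (\<phi> x)"
proof -
  note x = A.homog_D[OF assms]
  have "supp (\<phi> x) \<subseteq> {\<psi> \<alpha>}"
  proof -
    have "ec (\<phi> x) \<beta> = 0" "pc (\<phi> x) \<beta> = 0" if "\<beta> \<noteq> \<psi> \<alpha>" for \<beta>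
    proof -
      have "T \<beta> \<noteq> \<alpha>" using that by (simp add: T_eq_iff)
      moreover have "df x = (\<lambda>_. 0)" if "\<beta> = 0" using x(5) that \<open>\<beta> \<noteq> \<psi> \<alpha>\<close> by (cases "\<alpha> = 0") simp_all
      ultimately show "ec (\<phi> x) \<beta> = 0" "pc (\<phi> x) \<beta> = 0" using x(3,4) by (auto simp: \<phi>_def)
    qed
    then show ?thesis by (auto simp: supp_def)
  qed
  moreover have "df (\<phi> x) = (\<lambda>_. 0)" if "\<psi> \<alpha> \<noteq> 0" using that x(5) by (simp add: \<phi>_def)
  ultimately show ?thesis using x(1) by (simp add: A'.homog_def)
qed

lemma \<phi>_kernel:
  assumes x: "x \<in> A.V" and z: "\<phi> x = 0"
  shows "x = 0"
proof (rule coord_eqI)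
  show "ec x \<alpha> = ec 0 \<alpha>" for \<alpha>
    using arg_cong[OF z, of "\<lambda>y. ec y (\<psi> \<alpha>)"] by (simp add: \<phi>_def)
  show d: "df x v = df 0 v" for v
    using arg_cong[OF z, of "\<lambda>y. df y (\<Psi> v)"] by (simp add: \<phi>_def)
  have "df x = (\<lambda>_. 0)" using d by (simp add: fun_eq_iff)
  then have c: "\<theta> \<alpha> *s A'.C (\<psi> \<alpha>) (\<Psi> (pc x \<alpha>)) = 0" for \<alpha>
    using arg_cong[OF z, of "\<lambda>y. pc y (\<psi> \<alpha>)"] by (cases "\<alpha> = 0") (simp_all add: \<phi>_def)
  show "pc x \<alpha> = pc 0 \<alpha>" for \<alpha>
  proof (cases "\<alpha> = 0")
    case True
    then show ?thesis using c[of 0] by (simp add: A'.C_zero)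
  next
    case False
    have "A'.C (\<psi> \<alpha>) (\<Psi> (pc x \<alpha>)) = 0" using c[of \<alpha>] by simp
    then have "\<Psi> (pc x \<alpha>) = \<rho>' (\<Psi> (pc x \<alpha>))" using False by (simp add: A'.C_def)
    then have "\<Psi> (pc x \<alpha>) \<in> radC q'" using A'.\<rho>_in_radC by metis
    then have "A.C \<alpha> (pc x \<alpha>) = 0" using False by (simp add: A.C_def A.\<rho>_radC)
    then show ?thesis using A.V_D(4)[OF x, of \<alpha>] by simp
  qed
qed

lemma \<phi>_inj: "inj_on \<phi> A.V"
proof (rule inj_onI)
  fix x y assume xy: "x \<in> A.V" "y \<in> A.V" "\<phi> x = \<phi> y"
  have "\<phi> (x - y) = \<phi> x - \<phi> y"
    using \<phi>_add[of "x - y" y] by simp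
  then have "x - y = 0" using xy by (intro \<phi>_kernel) simp_all
  then show "x = y" by simp
qed

text \<open>The preimages of generators are given by the same formulas with \<open>\<psi>\<^sup>-\<^sup>1\<close>, as \<open>\<theta>(\<alpha>)\<^sup>2 = 1\<close>.\<close>

lemma \<phi>_homog_surj:
  assumes y: "A'.homog (\<psi> \<alpha>) y" and r: "\<alpha> \<in> roots q"
  shows "\<exists>x. A.homog \<alpha> x \<and> \<phi> x = y"
proof -
  note y' = A'.homog_D[OF y]
  have dec: "y = A'.hpart y (\<psi> \<alpha>) + A'.cd (df y)"
    using A'.V_decompose[OF y'(1), of "{\<psi> \<alpha>}"] y'(2) by simp
  have 1: "\<exists>x. A.homog \<alpha> x \<and> \<phi> x = A'.hpart y (\<psi> \<alpha>)"
  proof (cases "\<alpha> \<in> real_roots q")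
    case True
    have "\<phi> (A.ce (\<theta> \<alpha> * ec y (\<psi> \<alpha>)) \<alpha>) = A'.hpart y (\<psi> \<alpha>)"
      using True by (simp add: \<phi>_gens A'.hpart_def flip: mult.assoc)
    then show ?thesis using A.homog_gens(1)[OF True] by blast
  next
    case False
    then have n: "\<alpha> \<in> null_roots q" using r by (simp add: roots_def)
    have "\<phi> (A.cp \<alpha> (\<theta> \<alpha> *s \<Psi>i (pc y (\<psi> \<alpha>)))) = A'.hpart y (\<psi> \<alpha>)"
      using False by (simp add: \<phi>_gens A'.hpart_def)
    then show ?thesis using A.homog_gens(2)[OF n] by blast
  qed
  have 2: "\<exists>x. A.homog \<alpha> x \<and> \<phi> x = A'.cd (df y)"
  proof (cases "\<alpha> = 0")
    case True
    let ?g = "\<lambda>v. df y (\<Psi> v)"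
    have g: "?g \<in> A.dual_rad" using A'.V_D(5)[OF y'(1)] by simp
    have "\<phi> (A.cd ?g + A.cp 0 (- shift ?g)) = A'.cd (df y)"
      by (simp add: \<phi>_add \<phi>_gens add.assoc A'.gens_linear)
    moreover have "A.homog \<alpha> (A.cd ?g + A.cp 0 (- shift ?g))"
      using True g by (simp add: A.homog_add A.homog_gens)
    ultimately show ?thesis by blast
  next
    case False
    then have "A'.cd (df y) = 0" using y'(5) by simp
    then show ?thesis using A.homog_zero \<phi>_zero by metis
  qed
  show ?thesis using 1 2 dec A.homog_add \<phi>_add by metis
qed

lemma \<phi>_surj: "y \<in> A'.V \<Longrightarrow> \<exists>x\<in>A.V. \<phi> x = y"
proof (induction y rule: A'.homog_induct)
  case (homog \<beta> y)
  then show ?case using \<phi>_homog_surj[of "T \<beta>" y] A.homog_D(1) roots_\<psi>(3)[of "T \<beta>"] by auto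
next
  case (add y y')
  then show ?case using \<phi>_add A.V_closed(2) by metis
qed

theorem graded_isomorphic: "E_graded_isomorphic q B \<rho> q' B' \<rho>'"
proof -
  define F where "F x = A'.\<Gamma> (\<phi> (A.\<Phi> x))" for x
  have F_image: "F ` E_comp q \<alpha> = E_comp q' (\<psi> \<alpha>)" if \<alpha>: "\<alpha> \<in> roots q" for \<alpha>
  proof (intro equalityI subsetI)
    fix y assume "y \<in> F ` E_comp q \<alpha>"
    then show "y \<in> E_comp q' (\<psi> \<alpha>)"
      using \<phi>_homog by (auto simp: F_def A.E_comp_iff A'.\<Gamma>_in_E_comp)
  next
    fix y assume y: "y \<in> E_comp q' (\<psi> \<alpha>)"
    then have yE: "y \<in> A'.E" and "A'.homog (\<psi> \<alpha>) (A'.\<Phi> y)" by (simp_all add: A'.E_comp_iff)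
    then obtain x where x: "A.homog \<alpha> x" "\<phi> x = A'.\<Phi> y" using \<phi>_homog_surj[OF _ \<alpha>] by blast
    then have "F (A.\<Gamma> x) = y" using A.homog_D(1)[OF x(1)] yE by (simp add: F_def)
    then show "y \<in> F ` E_comp q \<alpha>" using A.\<Gamma>_in_E_comp[OF x(1)] by blast
  qed
  have F_bij: "bij_betw F A.E A'.E"
  proof (rule bij_betwI')
    show "F x = F y \<longleftrightarrow> x = y" if "x \<in> A.E" "y \<in> A.E" for x y
      using that inj_on_eq_iff[OF \<phi>_inj, of "A.\<Phi> x" "A.\<Phi> y"]
      by (simp add: F_def A'.\<Gamma>_inject A.\<Phi>_inject)
    show "F x \<in> A'.E" if "x \<in> A.E" for x using that by (simp add: F_def)
    show "\<exists>x\<in>A.E. y = F x" if "y \<in> A'.E" for y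
    proof -
      obtain x where "x \<in> A.V" "\<phi> x = A'.\<Phi> y" using \<phi>_surj[of "A'.\<Phi> y"] \<open>y \<in> A'.E\<close> by auto
      then show ?thesis using \<open>y \<in> A'.E\<close> by (intro bexI[of _ "A.\<Gamma> x"]) (simp_all add: F_def)
    qed
  qed
  have "lie_iso (E_alg q B \<rho>) (E_alg q' B' \<rho>') F"
    unfolding lie_iso_def using F_bij by (simp add: F_def \<phi>_add \<phi>_cscale \<phi>_br)
  then show ?thesis
    unfolding E_graded_isomorphic_def using \<psi>_additive \<psi>_bij image_roots F_image
    by (intro exI[of _ F] exI[of _ \<psi>]) blast
qed

end

theorem theorem1p1:
  fixes q :: "int^'n::{finite,linorder} \<Rightarrow> int"
  assumes "unit_form q" and "nonneg_form q" and "connected_form q"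
    and "admissible_choice q B \<rho>"
  shows "E_is_EALA_with_roots q B \<rho> \<and>
    (\<forall>(q' :: int^'m::{finite,linorder} \<Rightarrow> int) B' \<rho>'.
       unit_form q' \<and> nonneg_form q' \<and> connected_form q' \<and> admissible_choice q' B' \<rho>' \<longrightarrow>
       (equivalent_forms q q' \<longleftrightarrow> E_graded_isomorphic q B \<rho> q' B' \<rho>'))"
proof (intro conjI allI impI)
  have A: "nonneg_unit_form q B \<rho>" by (rule unit_formD) (rule assms)+
  then show "E_is_EALA_with_roots q B \<rho>"
    by (rule nonneg_unit_form.E_is_EALA) (rule connected_polar[OF assms(3)])
  fix q' :: "int^'m::{finite,linorder} \<Rightarrow> int" and B' \<rho>'
  assume "unit_form q' \<and> nonneg_form q' \<and> connected_form q' \<and> admissible_choice q' B' \<rho>'"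
  then have A': "nonneg_unit_form q' B' \<rho>'" using unit_formD by blast
  show "equivalent_forms q q' \<longleftrightarrow> E_graded_isomorphic q B \<rho> q' B' \<rho>'"
  proof
    assume "equivalent_forms q q'"
    then obtain T where T: "Modules.additive T" "bij T" "q' = q \<circ> T"
      by (auto simp: equivalent_forms_def)
    have "form_isometry q B \<rho> q' B' \<rho>' (inv_into UNIV T)"
    proof (intro form_isometry.intro form_isometry_axioms.intro A A')
      show "Modules.additive (inv_into UNIV T)" using additive_inv T by blast
      show "bij (inv_into UNIV T)" using T(2) by (rule bij_imp_bij_inv)
      show "q' (inv_into UNIV T x) = q x" for x
        using T(2) by (simp add: T(3) bij_is_surj surj_f_inv_f)
    qed
    then show "E_graded_isomorphic q B \<rho> q' B' \<rho>'" by (rule form_isometry.graded_isomorphic)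
  next
    assume "E_graded_isomorphic q B \<rho> q' B' \<rho>'"
    then obtain \<psi> where \<psi>: "Modules.additive \<psi>" "bij \<psi>" "\<psi> ` roots q = roots q'"
      by (auto simp: E_graded_isomorphic_def)
    have "q' y = q (inv_into UNIV \<psi> y)" for y
      using roots_determine_form[OF A A' \<psi>, of "inv_into UNIV \<psi> y"] \<psi>(2)
      by (simp add: bij_is_surj surj_f_inv_f)
    then have "q' = q \<circ> inv_into UNIV \<psi>" by (simp add: fun_eq_iff)
    then show "equivalent_forms q q'"
      unfolding equivalent_forms_def
      using lattice_iso_card[OF \<psi>(1,2)] additive_inv[OF \<psi>(1,2)] bij_imp_bij_inv[OF \<psi>(2)] by blast
  qed
qed

end
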